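(* Let $\lambda$ and $\mu$ be $\sigma$-finite measures on a measurable space $(\mathbb X,\mathcal X)$. (i) The formula $$\mathbb E_{\lambda+\mu}f(\Phi)=\mathbb E_\lambda f(\Phi)+\sum_{n=1}^\infty\frac1{n!}\int\big(\mathbb E_\lambda D^n_{x_1,\ldots,x_n}f(\Phi)\big)\,\mu^n(\mathrm d(x_1,\ldots,x_n))$$ holds for all bounded and measurable $f:\mathbf N\to\mathbb R$ if and only if $h:=\mathrm d\lambda/\mathrm d(\lambda+\mu)$ satisfies $\int(1-h)^2\,\mathrm d(\lambda+\mu)<\infty$. (ii) Assume that $\mu\le\lambda$ and let $\nu:=\lambda-\mu$. Then $$\mathbb E_\nu f(\Phi)=\mathbb E_\lambda f(\Phi)+\sum_{n=1}^\infty\frac1{n!}\int\big(\mathbb E_\lambda D^n_{x_1,\ldots,x_n}f(\Phi)\big)\,(\nu-\lambda)^n(\mathrm d(x_1,\ldots,x_n))$$ holds for all bounded and measurable $f:\mathbf N\to\mathbb R$ if and only if $h_\mu:=\mathrm d\mu/\mathrm d\lambda$ satisfies $\int h_\mu^2\,\mathrm d\lambda<\infty$.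
   Context: $\mathbf N$ is the space of $\sigma$-finite measures $\varphi$ on $\mathbb X$ with values in $\{0,1,2,\ldots\}\cup\{\infty\}$, equipped with the smallest $\sigma$-field making all maps $\varphi\mapsto\varphi(B)$, $B\in\mathcal X$, measurable. For a $\sigma$-finite measure $\lambda$ on $\mathbb X$, $\Pi_\lambda$ denotes the distribution (on $\mathbf N$) of a Poisson process with intensity measure $\lambda$. $\Phi:\Omega\to\mathbf N$ is a fixed measurable map on a measurable space $\Omega$, and $\mathbb P_\lambda$ is a probability measure on $\Omega$ with $\mathbb P_\lambda(\Phi\in\cdot)=\Pi_\lambda$; $\mathbb E_\lambda$ is the corresponding expectation. For $f:\mathbf N\to\mathbb R$ measurable, $n\in\mathbb N$ and $x_1,\ldots,x_n\in\mathbb X$, $$D^n_{x_1,\ldots,x_n}f(\varphi)=\sum_{J\subset\{1,\ldots,n\}}(-1)^{n-|J|}f\Big(\varphi+\sum_{j\in J}\delta_{x_j}\Big).$$ For $\sigma$-finite $\lambda,\nu$ with densities $h_\lambda,h_\nu$ with respect to a dominating $\sigma$-finite measure $\rho$, $\int g\,\mathrm d(\nu-\lambda)^n:=\int g(x_1,\ldots,x_n)\prod_{j=1}^n(h_\nu(x_j)-h_\lambda(x_j))\,\rho^n(\mathrm d(x_1,\ldots,x_n))$, which is independent of the choice of $\rho$. In (ii), $\nu=\lambda-\mu$ is the measure with density $1-h_\mu$ with respect to $\lambda$. *)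

theory Defs
  imports "HOL-Probability.Probability"
begin

text \<open>In \<open>configs X\<close> and \<open>config_space X\<close>, the measure carried by \<open>X\<close> is irrelevant.\<close>

definition configs :: "'a measure \<Rightarrow> 'a measure set" where
  "configs X = {\<phi>. sets \<phi> = sets X \<and> sigma_finite_measure \<phi> \<and>
     (\<forall>B\<in>sets X. emeasure \<phi> B \<in> range ennreal_of_enat)}"

definition config_space :: "'a measure \<Rightarrow> 'a measure measure" where
  "config_space X = (SUP B \<in> sets X. vimage_algebra (configs X) (\<lambda>\<phi>. emeasure \<phi> B) borel)"

definition add_measure :: "'a measure \<Rightarrow> 'a measure \<Rightarrow> 'a measure" where
  "add_measure M N = measure_of (space M) (sets M) (\<lambda>B. emeasure M B + emeasure N B)"

text \<open>The library's \<open>diff_measure\<close> subtracts set by set, which gives \<open>\<infinity> - \<infinity>\<close> on sets of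
  infinite measure; the difference is therefore taken at the level of densities.\<close>

definition sub_measure :: "'a measure \<Rightarrow> 'a measure \<Rightarrow> 'a measure" where
  "sub_measure M N = density M (\<lambda>x. 1 - RN_deriv M N x)"

definition add_points :: "'a measure \<Rightarrow> nat set \<Rightarrow> (nat \<Rightarrow> 'a) \<Rightarrow> 'a measure" where
  "add_points \<phi> J x = measure_of (space \<phi>) (sets \<phi>)
     (\<lambda>B. emeasure \<phi> B + (\<Sum>j\<in>J. emeasure (return \<phi> (x j)) B))"

definition diff_op :: "nat \<Rightarrow> (nat \<Rightarrow> 'a) \<Rightarrow> ('a measure \<Rightarrow> real) \<Rightarrow> 'a measure \<Rightarrow> real" where
  "diff_op n x f \<phi> = (\<Sum>J\<in>Pow {1..n}. (- 1) ^ (n - card J) * f (add_points \<phi> J x))"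

text \<open>\<open>Q\<close> is the law of a Poisson process with intensity \<open>\<kappa>\<close>. The library's \<open>poisson_pmf\<close> requires
  a positive rate, so the counting probabilities are written out; the formula also covers rate \<open>0\<close>
  (with \<open>0 ^ 0 = 1\<close>). A Poisson variable with infinite mean is almost surely infinite.\<close>

definition poisson_process_law :: "'a measure \<Rightarrow> 'a measure measure \<Rightarrow> bool" where
  "poisson_process_law \<kappa> Q \<longleftrightarrow>
     prob_space Q \<and> sets Q = sets (config_space \<kappa>) \<and>
     (\<forall>B\<in>sets \<kappa>. emeasure \<kappa> B < \<infinity> \<longrightarrow>
        (\<forall>k::nat. measure Q {\<phi>\<in>space Q. emeasure \<phi> B = of_nat k}
           = measure \<kappa> B ^ k / fact k * exp (- measure \<kappa> B))) \<and>
     (\<forall>B\<in>sets \<kappa>. emeasure \<kappa> B = \<infinity> \<longrightarrow> (AE \<phi> in Q. emeasure \<phi> B = \<infinity>)) \<and>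
     (\<forall>(m::nat) B. B ` {1..m} \<subseteq> sets \<kappa> \<longrightarrow> disjoint_family_on B {1..m} \<longrightarrow>
        prob_space.indep_vars Q (\<lambda>_. borel) (\<lambda>i \<phi>. emeasure \<phi> (B i)) {1..m})"

text \<open>Density of the signed measure \<open>\<nu> - \<kappa>\<close> with respect to a dominating measure \<open>\<rho>\<close>.\<close>

definition density_diff :: "'a measure \<Rightarrow> 'a measure \<Rightarrow> 'a measure \<Rightarrow> 'a \<Rightarrow> real" where
  "density_diff \<rho> \<nu> \<kappa> x = enn2real (RN_deriv \<rho> \<nu> x) - enn2real (RN_deriv \<rho> \<kappa> x)"

lemma space_add_measure [simp]: "space (add_measure M N) = space M"
  and sets_add_measure [simp, measurable_cong]: "sets (add_measure M N) = sets M"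
  by (simp_all add: add_measure_def)

lemma emeasure_add_measure:
  assumes "sets N = sets M" "B \<in> sets M"
  shows "emeasure (add_measure M N) B = emeasure M B + emeasure N B"
  using add_measure_def
proof (rule emeasure_measure_of)
  show "countably_additive (sets (add_measure M N)) (\<lambda>B. emeasure M B + emeasure N B)"
  proof (rule countably_additiveI)
    fix A :: "nat \<Rightarrow> _"
    assume "range A \<subseteq> sets (add_measure M N)" "disjoint_family A"
    then show "(\<Sum>i. emeasure M (A i) + emeasure N (A i)) = emeasure M (\<Union>i. A i) + emeasure N (\<Union>i. A i)"
      using assms(1) by (subst suminf_add[symmetric]) (auto simp: suminf_emeasure)
  qed
qed (use assms sets.space_closed in \<open>auto simp: positive_def\<close>)

lemma space_add_points [simp]: "space (add_points \<phi> J x) = space \<phi>"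
  and sets_add_points [simp, measurable_cong]: "sets (add_points \<phi> J x) = sets \<phi>"
  by (simp_all add: add_points_def)

lemma emeasure_add_points:
  assumes "B \<in> sets \<phi>"
  shows "emeasure (add_points \<phi> J x) B = emeasure \<phi> B + (\<Sum>j\<in>J. indicator B (x j))"
proof -
  have "emeasure (add_points \<phi> J x) B = emeasure \<phi> B + (\<Sum>j\<in>J. emeasure (return \<phi> (x j)) B)"
    using add_points_def
  proof (rule emeasure_measure_of)
    show "countably_additive (sets (add_points \<phi> J x))
            (\<lambda>B. emeasure \<phi> B + (\<Sum>j\<in>J. emeasure (return \<phi> (x j)) B))"
    proof (rule countably_additiveI)
      fix A :: "nat \<Rightarrow> _"
      assume A: "range A \<subseteq> sets (add_points \<phi> J x)" "disjoint_family A"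
      have "(\<Sum>i. \<Sum>j\<in>J. emeasure (return \<phi> (x j)) (A i))
              = (\<Sum>j\<in>J. \<Sum>i. emeasure (return \<phi> (x j)) (A i))"
        by (intro suminf_sum) auto
      also have "\<dots> = (\<Sum>j\<in>J. emeasure (return \<phi> (x j)) (\<Union>i. A i))"
        using A by (intro sum.cong refl suminf_emeasure) auto
      finally show "(\<Sum>i. emeasure \<phi> (A i) + (\<Sum>j\<in>J. emeasure (return \<phi> (x j)) (A i)))
          = emeasure \<phi> (\<Union>i. A i) + (\<Sum>j\<in>J. emeasure (return \<phi> (x j)) (\<Union>i. A i))"
        using A by (subst suminf_add[symmetric]) (auto simp: suminf_emeasure)
    qed
  qed (use assms sets.space_closed in \<open>auto simp: positive_def\<close>)
  then show ?thesis using assms by simp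
qed

lemma space_config_space: "space (config_space X) = configs X"
  unfolding config_space_def by (subst space_Sup_eq_UN) auto

end

theory Submission
  imports Defs
begin

text \<open>Write \<open>T\<^sub>n f = E\<^sub>\<rho> D\<^sup>n f(\<Phi>)\<close>. On the exponential functionals \<open>\<phi> \<mapsto> exp (- \<phi>(u))\<close> everything is explicit, and a
  monotone class argument transports from them to all bounded \<open>f\<close> first the Bessel inequality
  \<open>\<integral> (T\<^sub>n f)\<^sup>2 d\<rho>\<^sup>n \<le> n! E\<^sub>\<rho> f\<^sup>2\<close>, which makes \<open>\<Sum>\<^sub>n 1/n! \<integral> T\<^sub>n f \<cdot> a\<^sup>\<otimes>\<^sup>n d\<rho>\<^sup>n\<close> absolutely convergent and continuous in
  \<open>f\<close> for \<open>a \<in> L\<^sup>2(\<rho>)\<close>, and then the identity of that sum with \<open>E\<^sub>\<nu> f\<close> for \<open>\<nu> = (1 + a)\<rho>\<close>. This is sufficiency in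
  (ii). For (i) expand around \<open>\<rho> = \<lambda> + \<mu>\<close> with \<open>a = h - 1\<close> and invert the expansion. Conversely, if the
  density is not square integrable, already the term \<open>n = 1\<close> fails to be integrable for a suitable \<open>f\<close>.\<close>

subsection \<open>Bounded pointwise closure of a function algebra\<close>

text \<open>In (i) the measure \<mu> need not have a density with respect to \<lambda>, and where it
  has one, this density need not be square integrable under the stated condition. With respect to
  \<lambda> + \<mu> both densities lie in [0, 1] and add up to 1, so \<lambda> arises from \<lambda>
  + \<mu> by subtracting a smaller measure, as in (ii). The price is that the resulting expansion
  runs in the wrong direction. It can be inverted because the n-th coefficient is only of the order
  of the square root of n!: after division by n! there is still room for the factor 2^n that
  rearranging the double series costs. For the converse, the obstacle is that f must be bounded. A
  linear functional \<Phi>(u) has first difference u, which can be tuned to be non-integrable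
  against the density, but it is unbounded. Centring makes a suitable infinite combination converge
  almost surely, and arctan makes it bounded while keeping the first difference comparable to u
  after averaging. The formula is read as including integrability of every term, so a bad term n = 1
  already refutes it.\<close>

inductive_set lin_span :: "('b \<Rightarrow> real) set \<Rightarrow> ('b \<Rightarrow> real) set" for M where
  gen: "g \<in> M \<Longrightarrow> g \<in> lin_span M"
| scale: "f \<in> lin_span M \<Longrightarrow> (\<lambda>x. c * f x) \<in> lin_span M"
| add: "f \<in> lin_span M \<Longrightarrow> g \<in> lin_span M \<Longrightarrow> (\<lambda>x. f x + g x) \<in> lin_span M"

lemma lin_span_mult:
  assumes M: "\<And>f g. f \<in> M \<Longrightarrow> g \<in> M \<Longrightarrow> (\<lambda>x. f x * g x) \<in> M"
    and f: "f \<in> lin_span M" and g: "g \<in> lin_span M"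
  shows "(\<lambda>x. f x * g x) \<in> lin_span M"
  using f
proof induction
  case f: (gen f)
  from g show ?case
  proof induction
    case (gen g) with f show ?case by (intro lin_span.gen M)
  next
    case (scale g c) then show ?case
      using lin_span.scale[of "\<lambda>x. f x * g x" M c] by (simp add: mult.left_commute)
  next
    case (add g h) then show ?case
      using lin_span.add[of "\<lambda>x. f x * g x" M "\<lambda>x. f x * h x"] by (simp add: distrib_left)
  qed
next
  case (scale f c) then show ?case
    using lin_span.scale[of "\<lambda>x. f x * g x" M c] by (simp add: mult.assoc)
next
  case (add f h) then show ?case
    using lin_span.add[of "\<lambda>x. f x * g x" M "\<lambda>x. h x * g x"] by (simp add: distrib_right)
qed

lemma lin_span_repr:
  assumes "f \<in> lin_span M"
  shows "\<exists>n c g. (\<forall>i<(n::nat). g i \<in> M) \<and> f = (\<lambda>x. \<Sum>i<n. c i * g i x)"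
  using assms
proof induction
  case (gen g)
  show ?case by (intro exI[of _ 1] exI[of _ "\<lambda>_. 1"] exI[of _ "\<lambda>_. g"]) (use gen in auto)
next
  case (scale f c)
  then obtain n d g where "\<forall>i<(n::nat). g i \<in> M" "f = (\<lambda>x. \<Sum>i<n. d i * g i x)" by blast
  then show ?case
    by (intro exI[of _ n] exI[of _ "\<lambda>i. c * d i"] exI[of _ g]) (auto simp: sum_distrib_left mult.assoc)
next
  case (add f h)
  obtain n d g where 1: "\<forall>i<(n::nat). g i \<in> M" "f = (\<lambda>x. \<Sum>i<n. d i * g i x)" using add.IH(1) by blast
  obtain m e k where 2: "\<forall>i<(m::nat). k i \<in> M" "h = (\<lambda>x. \<Sum>i<m. e i * k i x)" using add.IH(2) by blast
  let ?d = "\<lambda>i. if i < n then d i else e (i - n)" and ?g = "\<lambda>i. if i < n then g i else k (i - n)"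
  have "(\<Sum>i<n+m. ?d i * ?g i x) = f x + h x" for x
  proof -
    have "(\<Sum>i<n+m. ?d i * ?g i x) = (\<Sum>i<n. ?d i * ?g i x) + (\<Sum>i=n..<n+m. ?d i * ?g i x)"
      using sum.atLeastLessThan_concat[of 0 n "n+m" "\<lambda>i. ?d i * ?g i x"] by (simp only: lessThan_atLeast0)
    also have "(\<Sum>i=n..<n+m. ?d i * ?g i x) = (\<Sum>i<m. ?d (i + n) * ?g (i + n) x)"
      using sum.shift_bounds_nat_ivl[of "\<lambda>i. ?d i * ?g i x" 0 n m]
      by (simp add: lessThan_atLeast0 add.commute)
    finally show ?thesis using 1 2 by simp
  qed
  moreover have "\<forall>i<n+m. ?g i \<in> M" using 1 2 by auto
  ultimately show ?case
    by (intro exI[of _ "n+m"] exI[of _ ?d] exI[of _ ?g]) auto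
qed

text \<open>Closing inductively iterates bounded sequential limits as often as needed, so any
  property stable under one such limit passes to the whole class by induction. Bounds and
  convergence are demanded only on \<open>S\<close>, hence functions that agree on \<open>S\<close>
  are interchangeable.\<close>

inductive_set bounded_closure :: "'b set \<Rightarrow> ('b \<Rightarrow> real) set \<Rightarrow> ('b \<Rightarrow> real) set" for S A where
  base: "f \<in> A \<Longrightarrow> f \<in> bounded_closure S A"
| lim: "(\<And>k::nat. F k \<in> bounded_closure S A) \<Longrightarrow> (\<And>k x. x \<in> S \<Longrightarrow> \<bar>F k x\<bar> \<le> K)
    \<Longrightarrow> (\<And>x. x \<in> S \<Longrightarrow> (\<lambda>k. F k x) \<longlonglongrightarrow> f x) \<Longrightarrow> f \<in> bounded_closure S A"

locale function_algebra =
  fixes S :: "'b set" and A :: "('b \<Rightarrow> real) set"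
  assumes one: "(\<lambda>_. 1) \<in> A"
    and scale: "f \<in> A \<Longrightarrow> (\<lambda>x. c * f x) \<in> A"
    and add: "f \<in> A \<Longrightarrow> g \<in> A \<Longrightarrow> (\<lambda>x. f x + g x) \<in> A"
    and mult: "f \<in> A \<Longrightarrow> g \<in> A \<Longrightarrow> (\<lambda>x. f x * g x) \<in> A"
    and bdd: "f \<in> A \<Longrightarrow> \<exists>K. \<forall>x\<in>S. \<bar>f x\<bar> \<le> K"
begin

abbreviation "C \<equiv> bounded_closure S A"

lemma closure_bounded: "f \<in> C \<Longrightarrow> \<exists>K. \<forall>x\<in>S. \<bar>f x\<bar> \<le> K"
proof (induction rule: bounded_closure.induct)
  case (lim F K f)
  have "\<bar>f x\<bar> \<le> K" if "x \<in> S" for x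
    by (rule tendsto_upperbound[OF tendsto_rabs[OF lim.hyps(3)[OF that]]]) (use lim that in auto)
  then show ?case by blast
qed (use bdd in auto)

text \<open>A double induction: first the second argument stays in \<open>A\<close> while the first
  runs through the closure, then the first is a fixed closure element while the second runs. Each
  limit step has only one moving argument, and \<open>h_bdd\<close> supplies its uniform
  bound.\<close>

lemma closure_binary:
  fixes h :: "real \<Rightarrow> real \<Rightarrow> real"
  assumes A: "\<And>f g. f \<in> A \<Longrightarrow> g \<in> A \<Longrightarrow> (\<lambda>x. h (f x) (g x)) \<in> A"
    and h_bdd: "\<And>K L. \<exists>B. \<forall>a b. \<bar>a\<bar> \<le> K \<longrightarrow> \<bar>b\<bar> \<le> L \<longrightarrow> \<bar>h a b\<bar> \<le> B"
    and h_lim: "\<And>(F :: nat \<Rightarrow> real) G a b. F \<longlonglongrightarrow> a \<Longrightarrow> G \<longlonglongrightarrow> b \<Longrightarrow> (\<lambda>k. h (F k) (G k)) \<longlonglongrightarrow> h a b"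
    and f: "f \<in> C" and g: "g \<in> C"
  shows "(\<lambda>x. h (f x) (g x)) \<in> C"
proof -
  have base: "(\<lambda>x. h (f x) (g x)) \<in> C" if g: "g \<in> A" for g
    using f
  proof induction
    case (lim F K f)
    obtain L where L: "\<forall>x\<in>S. \<bar>g x\<bar> \<le> L" using bdd[OF g] by blast
    obtain B where B: "\<forall>a b. \<bar>a\<bar> \<le> K \<longrightarrow> \<bar>b\<bar> \<le> L \<longrightarrow> \<bar>h a b\<bar> \<le> B" using h_bdd by blast
    show ?case
      by (rule bounded_closure.lim[OF lim.IH, where K=B]) (use lim.hyps B L in \<open>auto intro!: h_lim\<close>)
  qed (auto intro: A g bounded_closure.base)
  obtain L where L: "\<forall>x\<in>S. \<bar>f x\<bar> \<le> L" using closure_bounded[OF f] by blast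
  from g show ?thesis
  proof induction
    case (lim G K g)
    obtain B where B: "\<forall>a b. \<bar>a\<bar> \<le> L \<longrightarrow> \<bar>b\<bar> \<le> K \<longrightarrow> \<bar>h a b\<bar> \<le> B" using h_bdd by blast
    show ?case
      by (rule bounded_closure.lim[OF lim.IH, where K=B]) (use lim.hyps B L in \<open>auto intro!: h_lim\<close>)
  qed (rule base)
qed

lemma closure_add: "f \<in> C \<Longrightarrow> g \<in> C \<Longrightarrow> (\<lambda>x. f x + g x) \<in> C"
proof (rule closure_binary[where h="(+)"])
  show "\<exists>B. \<forall>a b. \<bar>a\<bar> \<le> K \<longrightarrow> \<bar>b\<bar> \<le> L \<longrightarrow> \<bar>a + b\<bar> \<le> B" for K L :: real
    by (intro exI[of _ "K + L"]) fastforce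
qed (auto intro: add tendsto_intros)

lemma closure_mult: "f \<in> C \<Longrightarrow> g \<in> C \<Longrightarrow> (\<lambda>x. f x * g x) \<in> C"
proof (rule closure_binary[where h="(*)"])
  show "\<exists>B. \<forall>a b. \<bar>a\<bar> \<le> K \<longrightarrow> \<bar>b\<bar> \<le> L \<longrightarrow> \<bar>a * b\<bar> \<le> B" for K L :: real
    by (intro exI[of _ "K * L"]) (auto simp: abs_mult intro!: mult_mono intro: order_trans[OF abs_ge_zero])
qed (auto intro: mult tendsto_intros)

lemma closure_const: "(\<lambda>_. c) \<in> C"
  using bounded_closure.base[OF scale[OF one, of c]] by simp

lemma closure_scale: "f \<in> C \<Longrightarrow> (\<lambda>x. c * f x) \<in> C"
  by (rule closure_mult[OF closure_const])

lemma closure_power: "f \<in> C \<Longrightarrow> (\<lambda>x. f x ^ n) \<in> C"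
  by (induction n) (auto intro: closure_const closure_mult)

lemma closure_sum: "finite I \<Longrightarrow> (\<And>i. i \<in> I \<Longrightarrow> f i \<in> C) \<Longrightarrow> (\<lambda>x. \<Sum>i\<in>I. f i x) \<in> C"
  by (induction I rule: finite_induct) (auto intro: closure_const closure_add)

text \<open>Since g and a lie in [0, 1], the number 1 - (g - a)^2 lies in [0, 1] and equals 1
  exactly on the level set; its powers therefore decrease to the indicator.\<close>

lemma closure_level_set:
  assumes g: "g \<in> A" "\<And>x. x \<in> S \<Longrightarrow> g x \<in> {0..1}" and a: "a \<in> {0..1}"
  shows "indicator (g -` {a} \<inter> S) \<in> C"
proof (rule bounded_closure.lim[where F="\<lambda>N x. (1 + (-1) * (g x + - a)\<^sup>2) ^ N" and K=1])
  show "(\<lambda>x. (1 + (-1) * (g x + - a)\<^sup>2) ^ N) \<in> C" for N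
    by (intro closure_power closure_add closure_const closure_scale bounded_closure.base[OF g(1)])
next
  fix x N assume x: "x \<in> S"
  have *: "\<bar>g x - a\<bar> \<le> 1" using g(2)[OF x] a by auto
  then have 1: "(g x - a)\<^sup>2 \<le> 1" by (simp add: abs_square_le_1)
  then show "\<bar>(1 + (-1) * (g x + - a)\<^sup>2) ^ N\<bar> \<le> 1" by (simp add: power_abs power_le_one)
  show "(\<lambda>N. (1 + (-1) * (g x + - a)\<^sup>2) ^ N) \<longlonglongrightarrow> indicator (g -` {a} \<inter> S) x"
  proof (cases "g x = a")
    case False
    then have "norm (1 + (-1) * (g x + - a)\<^sup>2) < 1" using 1 by (simp add: abs_if)
    from LIMSEQ_power_zero[OF this] False show ?thesis by simp
  qed (use x in auto)
qed

text \<open>Complements and finite unions are polynomial operations on indicators, available because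
  the closure is an algebra; countable unions are bounded limits of finite ones. No
  intersection-stable generator is required.\<close>

lemma closure_indicator:
  assumes G: "\<And>T. T \<in> G \<Longrightarrow> indicator T \<in> C" and T: "T \<in> sigma_sets S G"
  shows "indicator T \<in> C"
  using T
proof induction
  case (Basic T) then show ?case by (rule G)
next
  case Empty show ?case using closure_const[of 0] by (simp add: indicator_def)
next
  case (Compl T)
  have 1: "(\<lambda>x. 1 + (-1) * indicator T x) \<in> C"
    by (intro closure_add closure_const closure_scale Compl)
  \<comment> \<open>A constant sequence: 1 minus the indicator of T equals the indicator of S - T
    only on \<open>S\<close>, and a limit step is what replaces a function by one agreeing with it
    on \<open>S\<close>.\<close>
  show ?case by (rule bounded_closure.lim[OF 1, where K=1]) (auto simp: indicator_def)
next
  case (Union T)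
  have fin: "indicator (\<Union>i<n. T i) \<in> C" for n :: nat
  proof (induction n)
    case 0 show ?case using closure_const[of 0] by (simp add: indicator_def)
  next
    case (Suc n)
    have "(\<lambda>x. (indicator (\<Union>i<n. T i) x + indicator (T n) x)
            + (-1) * (indicator (\<Union>i<n. T i) x * indicator (T n) x)) \<in> C"
      by (intro closure_add closure_scale closure_mult Suc Union)
    also have "(\<lambda>x. (indicator (\<Union>i<n. T i) x + indicator (T n) x)
            + (-1) * (indicator (\<Union>i<n. T i) x * indicator (T n) x)) = (indicator (\<Union>i<Suc n. T i) :: _ \<Rightarrow> real)"
      by (auto simp: fun_eq_iff indicator_def lessThan_Suc)
    finally show ?case .
  qed
  show ?case
  proof (rule bounded_closure.lim[OF fin, where K=1])
    show "(\<lambda>n. indicator (\<Union>i<n. T i) x) \<longlonglongrightarrow> (indicator (\<Union> (range T)) x :: real)" for x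
      by (rule LIMSEQ_indicator_UN)
  qed (auto simp: indicator_def)
qed

text \<open>Rounding f down to multiples of 1 / (n + 1) gives finite combinations of indicators, by
  boundedness of f, with uniform error at most 1 / (n + 1).\<close>

lemma closure_borel:
  assumes G: "\<And>T. T \<in> G \<Longrightarrow> indicator T \<in> C" and N: "space N = S" "sets N \<subseteq> sigma_sets S G"
    and f: "f \<in> borel_measurable N" and K: "\<And>x. x \<in> S \<Longrightarrow> \<bar>f x\<bar> \<le> K"
  shows "f \<in> C"
proof (rule bounded_closure.lim)
  let ?F = "\<lambda>(n::nat) x. \<Sum>j\<in>{\<lfloor>- K * (Suc n)\<rfloor>..\<lfloor>K * (Suc n)\<rfloor>}.
    (real_of_int j / (Suc n)) * indicator {x\<in>space N. \<lfloor>f x * Suc n\<rfloor> = j} x"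
  show "?F n \<in> C" for n
    by (intro closure_sum closure_scale closure_indicator[OF G])
       (use f N in \<open>auto intro!: subsetD[OF N(2)]\<close>)
  have eq: "?F n x = \<lfloor>f x * Suc n\<rfloor> / Suc n" if "x \<in> S" for n x
  proof -
    have "\<lfloor>f x * Suc n\<rfloor> \<in> {\<lfloor>- K * (Suc n)\<rfloor>..\<lfloor>K * (Suc n)\<rfloor>}"
      using mult_right_mono[of "- K" "f x" "Suc n"] mult_right_mono[of "f x" K "Suc n"] K[OF that]
      by (auto intro!: floor_mono simp del: of_nat_Suc)
    moreover have "?F n x = (\<Sum>j\<in>{\<lfloor>- K * (Suc n)\<rfloor>..\<lfloor>K * (Suc n)\<rfloor>}.
       if \<lfloor>f x * Suc n\<rfloor> = j then real_of_int j / (Suc n) else 0)"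
      by (intro sum.cong) (use that N in auto)
    ultimately show ?thesis by simp
  qed
  have close: "\<bar>?F n x - f x\<bar> \<le> 1 / Suc n" if "x \<in> S" for n x
  proof -
    have "?F n x - f x = (\<lfloor>f x * Suc n\<rfloor> - f x * Suc n) / Suc n"
      unfolding eq[OF that] by (simp add: diff_divide_distrib del: of_nat_Suc)
    moreover have "\<bar>\<lfloor>f x * Suc n\<rfloor> - f x * Suc n\<bar> \<le> 1" by linarith
    ultimately show ?thesis by (simp add: abs_divide divide_right_mono del: of_nat_Suc)
  qed
  fix x n assume x: "x \<in> S"
  have "1 / real (Suc n) \<le> 1" by simp
  then show "\<bar>?F n x\<bar> \<le> K + 1" using close[OF x, of n] K[OF x] by linarith
  have "(\<lambda>n. ?F n x - f x) \<longlonglongrightarrow> 0"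
    by (rule Lim_null_comparison[OF _ LIMSEQ_Suc[OF lim_1_over_n]]) (use close[OF x] in auto)
  then show "(\<lambda>n. ?F n x) \<longlonglongrightarrow> f x" by (simp only: LIM_zero_iff)
qed

end

text \<open>A functional monotone class theorem. Multiplicativity of \<open>M\<close> makes its
  linear span an algebra, so the closure contains the indicators of all generated sets. Generation
  is asked for by level sets, which suits functions with countably many values such as exponentials
  of counts. The \<open>span\<close> case is a plain finite sum, on which explicit formulas can be
  checked.\<close>

theorem multiplicative_class [consumes 5, case_names span lim]:
  fixes M :: "('b \<Rightarrow> real) set"
  assumes M: "(\<lambda>_. 1) \<in> M" "\<And>f g. f \<in> M \<Longrightarrow> g \<in> M \<Longrightarrow> (\<lambda>x. f x * g x) \<in> M"
      "\<And>f x. f \<in> M \<Longrightarrow> x \<in> space N \<Longrightarrow> f x \<in> {0..1}"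
    and N: "sets N \<subseteq> sigma_sets (space N) {g -` {a} \<inter> space N |g a. g \<in> M \<and> a \<in> {0..1}}"
    and f: "f \<in> borel_measurable N \<and> (\<exists>K. \<forall>x\<in>space N. \<bar>f x\<bar> \<le> K)"
    and span: "\<And>n c g. (\<And>i. i < (n::nat) \<Longrightarrow> g i \<in> M) \<Longrightarrow> P (\<lambda>x. \<Sum>i<n. c i * g i x)"
    and lim: "\<And>F K f. (\<And>k::nat. P (F k)) \<Longrightarrow> (\<And>k x. x \<in> space N \<Longrightarrow> \<bar>F k x\<bar> \<le> K)
      \<Longrightarrow> (\<And>x. x \<in> space N \<Longrightarrow> (\<lambda>k. F k x) \<longlonglongrightarrow> f x) \<Longrightarrow> P f"
  shows "P f"
proof -
  interpret function_algebra "space N" "lin_span M"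
  proof
    fix f assume "f \<in> lin_span M"
    then show "\<exists>K. \<forall>x\<in>space N. \<bar>f x\<bar> \<le> K"
    proof induction
      case (gen g) then show ?case using M(3) by (intro exI[of _ 1]) auto
    next
      case (scale f c)
      then obtain K where "\<forall>x\<in>space N. \<bar>f x\<bar> \<le> K" by blast
      then show ?case by (intro exI[of _ "\<bar>c\<bar> * K"]) (auto simp: abs_mult intro!: mult_left_mono)
    next
      case (add f g)
      then obtain K L where "\<forall>x\<in>space N. \<bar>f x\<bar> \<le> K" "\<forall>x\<in>space N. \<bar>g x\<bar> \<le> L" by blast
      then show ?case by (intro exI[of _ "K + L"]) fastforce
    qed
  qed (auto intro: lin_span.intros M lin_span_mult)
  have "f \<in> bounded_closure (space N) (lin_span M)"
  proof -
    obtain K where K: "\<forall>x\<in>space N. \<bar>f x\<bar> \<le> K" using f by blast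
    show ?thesis
    proof (rule closure_borel[OF _ _ N])
      fix T assume "T \<in> {g -` {a} \<inter> space N |g a. g \<in> M \<and> a \<in> {0..1}}"
      then show "indicator T \<in> bounded_closure (space N) (lin_span M)"
        by (auto intro!: closure_level_set lin_span.gen dest: M(3))
    qed (use f K in auto)
  qed
  then show ?thesis
  proof induction
    case (base f)
    from lin_span_repr[OF this] show ?case using span by auto
  next
    case (lim F K f) show ?case by (rule assms(7)[OF lim.IH lim.hyps(2,3)])
  qed
qed

subsection \<open>Configurations and difference operators\<close>

lemma config_space_cong: "sets M = sets N \<Longrightarrow> config_space M = config_space N"
  unfolding config_space_def configs_def by simp

lemma measurable_emeasure_config_space[measurable]:
  "B \<in> sets X \<Longrightarrow> (\<lambda>\<phi>. emeasure \<phi> B) \<in> borel_measurable (config_space X)"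
  by (auto intro!: measurable_Sup1 measurable_vimage_algebra1 simp: config_space_def)

lemma measurable_config_space:
  assumes "\<And>a. a \<in> space M \<Longrightarrow> K a \<in> configs X"
    "\<And>A. A \<in> sets X \<Longrightarrow> (\<lambda>a. emeasure (K a) A) \<in> borel_measurable M"
  shows "K \<in> measurable M (config_space X)"
  using assms by (auto intro!: measurable_Sup2 measurable_vimage_algebra2 simp: config_space_def)

lemma configsD:
  assumes "\<phi> \<in> configs X"
  shows "sets \<phi> = sets X" "space \<phi> = space X" "sigma_finite_measure \<phi>"
    "B \<in> sets X \<Longrightarrow> emeasure \<phi> B \<in> range ennreal_of_enat"
  using assms sets_eq_imp_space_eq[of \<phi> X] by (auto simp: configs_def)

lemma ennreal_of_enat_add_mem:
  assumes "a \<in> range ennreal_of_enat" "b \<in> range ennreal_of_enat"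
  shows "a + b \<in> range ennreal_of_enat"
proof -
  obtain m n where "a = ennreal_of_enat m" "b = ennreal_of_enat n" using assms by auto
  then have "a + b = ennreal_of_enat (m + n)"
    by (cases m; cases n) (auto simp: ennreal_of_enat_def)
  then show ?thesis by (metis rangeI)
qed

lemma indicator_mem_range_enat: "(indicator B x :: ennreal) \<in> range ennreal_of_enat"
  using rangeI[of ennreal_of_enat 0] rangeI[of ennreal_of_enat 1]
  by (auto simp: indicator_def ennreal_of_enat_def zero_enat_def one_enat_def)

lemma sum_mem_range_enat:
  "finite J \<Longrightarrow> (\<And>j. j \<in> J \<Longrightarrow> f j \<in> range ennreal_of_enat) \<Longrightarrow> sum f J \<in> range ennreal_of_enat"
proof (induction J rule: finite_induct)
  case empty
  show ?case using rangeI[of ennreal_of_enat 0] by (simp add: ennreal_of_enat_def zero_enat_def)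
qed (auto intro!: ennreal_of_enat_add_mem)

lemma add_points_mem_configs:
  assumes \<phi>: "\<phi> \<in> configs X" and J: "finite J"
  shows "add_points \<phi> J x \<in> configs X"
proof -
  note d = configsD[OF \<phi>]
  interpret sigma_finite_measure \<phi> by (rule d)
  obtain A where A: "countable A" "A \<subseteq> sets \<phi>" "\<Union>A = space \<phi>" "\<forall>a\<in>A. emeasure \<phi> a \<noteq> \<infinity>"
    using sigma_finite_countable by blast
  have "sigma_finite_measure (add_points \<phi> J x)"
  proof
    have "emeasure (add_points \<phi> J x) a \<noteq> \<infinity>" if "a \<in> A" for a
    proof -
      have "a \<in> sets \<phi>" using A that by auto
      moreover have "(\<Sum>j\<in>J. indicator a (x j) :: ennreal) \<noteq> \<infinity>"
        using J by (simp add: indicator_def)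
      ultimately show ?thesis using A(4) that by (simp add: emeasure_add_points)
    qed
    then show "\<exists>A. countable A \<and> A \<subseteq> sets (add_points \<phi> J x) \<and>
        \<Union> A = space (add_points \<phi> J x) \<and> (\<forall>a\<in>A. emeasure (add_points \<phi> J x) a \<noteq> \<infinity>)"
      using A by (intro exI[of _ A]) auto
  qed
  moreover have "emeasure (add_points \<phi> J x) B \<in> range ennreal_of_enat" if "B \<in> sets X" for B
    unfolding emeasure_add_points[of B \<phi> J x, unfolded d(1), OF that]
    by (intro ennreal_of_enat_add_mem sum_mem_range_enat J indicator_mem_range_enat d(4) that)
  ultimately show ?thesis by (simp add: configs_def d)
qed

lemma measurable_add_points:
  assumes M: "sets M = sets X" and J: "J \<subseteq> I" "finite J"
  shows "(\<lambda>z. add_points (snd z) J (fst z)) \<in> measurable (PiM I (\<lambda>_. M) \<Otimes>\<^sub>M config_space X) (config_space X)"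
proof (rule measurable_config_space)
  fix z assume "z \<in> space (PiM I (\<lambda>_. M) \<Otimes>\<^sub>M config_space X)"
  then show "add_points (snd z) J (fst z) \<in> configs X"
    using J by (intro add_points_mem_configs) (auto simp: space_pair_measure space_config_space)
next
  fix A assume A[measurable]: "A \<in> sets X"
  then have AM[measurable]: "A \<in> sets M" using M by simp
  have [measurable]: "(\<lambda>z. fst z j) \<in> measurable (PiM I (\<lambda>_. M) \<Otimes>\<^sub>M config_space X) M" if "j \<in> J" for j
    using J(1) that by (intro measurable_compose[OF measurable_fst measurable_component_singleton]) auto
  have "(\<lambda>z. emeasure (snd z) A + (\<Sum>j\<in>J. indicator A (fst z j)))
      \<in> borel_measurable (PiM I (\<lambda>_. M) \<Otimes>\<^sub>M config_space X)"
    by measurable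
  also have "?this \<longleftrightarrow> (\<lambda>z. emeasure (add_points (snd z) J (fst z)) A)
      \<in> borel_measurable (PiM I (\<lambda>_. M) \<Otimes>\<^sub>M config_space X)"
    by (intro measurable_cong)
       (auto simp: space_pair_measure space_config_space emeasure_add_points A configsD(1))
  finally show "(\<lambda>z. emeasure (add_points (snd z) J (fst z)) A)
      \<in> borel_measurable (PiM I (\<lambda>_. M) \<Otimes>\<^sub>M config_space X)" .
qed

text \<open>A general index set allows \<open>{1..n+k}\<close> to be split into
  \<open>{1..n}\<close> and \<open>{n+1..n+k}\<close>, which the inversion of the expansion relies
  on.\<close>

definition diff_on :: "nat set \<Rightarrow> (nat \<Rightarrow> 'a) \<Rightarrow> ('a measure \<Rightarrow> real) \<Rightarrow> 'a measure \<Rightarrow> real" where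
  "diff_on I x f \<phi> = (\<Sum>J\<in>Pow I. (- 1) ^ (card I - card J) * f (add_points \<phi> J x))"

lemma diff_op_eq_diff_on: "diff_op n = diff_on {1..n}"
  by (simp add: diff_op_def diff_on_def fun_eq_iff)

lemma measurable_diff_on:
  assumes M: "sets M = sets X" and I: "finite I" and f: "f \<in> borel_measurable (config_space X)"
  shows "(\<lambda>z. diff_on I (fst z) f (snd z)) \<in> borel_measurable (PiM I (\<lambda>_. M) \<Otimes>\<^sub>M config_space X)"
  unfolding diff_on_def
  by (intro borel_measurable_sum borel_measurable_times borel_measurable_const
      measurable_compose[OF measurable_add_points[OF M] f]) (use I in \<open>auto intro: finite_subset\<close>)

lemma abs_diff_on_le:
  assumes I: "finite I" and \<phi>: "\<phi> \<in> configs X" and K: "\<And>\<phi>. \<phi> \<in> configs X \<Longrightarrow> \<bar>f \<phi>\<bar> \<le> K"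
  shows "\<bar>diff_on I x f \<phi>\<bar> \<le> 2 ^ card I * K"
proof -
  have "\<bar>diff_on I x f \<phi>\<bar> \<le> (\<Sum>J\<in>Pow I. K)"
    unfolding diff_on_def
  proof (rule order_trans[OF sum_abs sum_mono])
    fix J assume "J \<in> Pow I"
    then show "\<bar>(- 1) ^ (card I - card J) * f (add_points \<phi> J x)\<bar> \<le> K"
      using I by (auto simp: abs_mult power_abs intro!: K add_points_mem_configs \<phi> intro: finite_subset)
  qed
  then show ?thesis using I by (simp add: card_Pow)
qed

lemma add_points_cong:
  assumes "\<And>j. j \<in> J \<Longrightarrow> x j = y j"
  shows "add_points \<phi> J x = add_points \<phi> J y"
  unfolding add_points_def using assms by (intro arg_cong[where f="measure_of _ _"] ext) simp

lemma diff_on_cong: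
  assumes "\<And>j. j \<in> I \<Longrightarrow> x j = y j"
  shows "diff_on I x f \<phi> = diff_on I y f \<phi>"
  unfolding diff_on_def using assms
  by (intro sum.cong refl arg_cong2[where f="(*)"] arg_cong[where f=f] add_points_cong) auto

lemma diff_on_empty[simp]: "diff_on {} x f \<phi> = f \<phi>"
  by (simp add: diff_on_def add_points_def measure_of_of_measure)

lemma add_points_add_points:
  assumes "J \<inter> K = {}" "finite J" "finite K"
  shows "add_points (add_points \<phi> J x) K x = add_points \<phi> (J \<union> K) x"
  by (rule measure_eqI) (use assms in \<open>auto simp: emeasure_add_points sum.union_disjoint add.assoc\<close>)

text \<open>Difference operators compose because every subset of a disjoint union splits uniquely
  into its two traces, and cardinalities, hence signs, add up accordingly.\<close>

lemma diff_on_Un: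
  assumes IJ: "I \<inter> J = {}" "finite I" "finite J"
  shows "diff_on (I \<union> J) x f \<phi> = diff_on J x (diff_on I x f) \<phi>"
proof -
  let ?g = "\<lambda>A B. (- 1 :: real) ^ (card I - card A) * ((- 1) ^ (card J - card B) * f (add_points \<phi> (A \<union> B) x))"
  have "diff_on J x (diff_on I x f) \<phi> = (\<Sum>B\<in>Pow J. \<Sum>A\<in>Pow I. ?g A B)"
    unfolding diff_on_def sum_distrib_left
  proof (intro sum.cong refl)
    fix A B assume AB: "B \<in> Pow J" "A \<in> Pow I"
    have "add_points (add_points \<phi> B x) A x = add_points \<phi> (A \<union> B) x"
      using AB IJ by (subst add_points_add_points) (auto intro: finite_subset simp: Un_commute)
    then show "(- 1) ^ (card J - card B) * ((- 1) ^ (card I - card A) * f (add_points (add_points \<phi> B x) A x)) = ?g A B"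
      by simp
  qed
  also have "\<dots> = (\<Sum>(A, B)\<in>Pow I \<times> Pow J. ?g A B)"
    by (subst sum.swap) (simp add: sum.cartesian_product)
  also have "\<dots> = diff_on (I \<union> J) x f \<phi>"
    unfolding diff_on_def
  proof (rule sum.reindex_bij_witness[of _ "\<lambda>K. (K \<inter> I, K \<inter> J)" "\<lambda>(A, B). A \<union> B"])
    fix p assume p: "p \<in> Pow I \<times> Pow J"
    obtain A B where [simp]: "p = (A, B)" by force
    have AB: "A \<subseteq> I" "B \<subseteq> J" using p by auto
    then have fin: "finite A" "finite B" using IJ by (auto intro: finite_subset)
    have c: "card (I \<union> J) = card I + card J" "card (A \<union> B) = card A + card B"
      using AB IJ fin by (auto intro!: card_Un_disjoint)
    have "card A \<le> card I" "card B \<le> card J" using AB IJ by (auto intro: card_mono)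
    then have "card (I \<union> J) - card (A \<union> B) = (card I - card A) + (card J - card B)" using c by simp
    then show "(- 1) ^ (card (I \<union> J) - card (case p of (A, B) \<Rightarrow> A \<union> B)) * f (add_points \<phi> (case p of (A, B) \<Rightarrow> A \<union> B) x)
       = (case p of (A, B) \<Rightarrow> ?g A B)"
      by (simp add: power_add)
  qed (use IJ in auto)
  finally show ?thesis ..
qed

section \<open>Exponential functionals of simple functions\<close>

definition expneg :: "ennreal \<Rightarrow> real" where
  "expneg t = (if t = \<infinity> then 0 else exp (- enn2real t))"

lemma expneg_measurable[measurable]: "expneg \<in> borel_measurable borel"
  unfolding expneg_def by measurable

lemma expneg_simps[simp]: "expneg 0 = 1" "0 \<le> c \<Longrightarrow> expneg (ennreal c) = exp (- c)" "expneg \<top> = 0"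
  by (auto simp: expneg_def)

lemma expneg_range: "0 \<le> expneg t" "expneg t \<le> 1"
  by (auto simp: expneg_def)

text \<open>The value 0 at infinity is the one that keeps exp (- t) multiplicative when a
  configuration has infinite mass.\<close>

lemma expneg_add: "expneg (s + t) = expneg s * expneg t"
  by (cases s; cases t) (auto simp: mult_exp_exp simp flip: ennreal_plus)

lemma expneg_sum: "finite J \<Longrightarrow> expneg (sum f J) = (\<Prod>j\<in>J. expneg (f j))"
  by (induction J rule: finite_induct) (auto simp: expneg_add)

definition expfun :: "('a \<Rightarrow> real) \<Rightarrow> 'a measure \<Rightarrow> real" where
  "expfun u \<phi> = expneg (\<integral>\<^sup>+x. ennreal (u x) \<partial>\<phi>)"

text \<open>Simplicity and finite support turn \<phi>(u) into a finite combination of counts of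
  disjoint sets of finite intensity, to which the defining properties of a Poisson process apply
  directly. Stability under addition makes the functionals \<open>expfun u\<close> a multiplicative
  family.\<close>

definition test_funs :: "'a measure \<Rightarrow> ('a \<Rightarrow> real) set" where
  "test_funs \<rho> = {u. simple_function \<rho> u \<and> (\<forall>x\<in>space \<rho>. 0 \<le> u x) \<and> emeasure \<rho> {x\<in>space \<rho>. u x \<noteq> 0} < \<infinity>}"

lemma test_funsD:
  assumes "u \<in> test_funs \<rho>"
  shows "simple_function \<rho> u" "u \<in> borel_measurable \<rho>" "x \<in> space \<rho> \<Longrightarrow> 0 \<le> u x"
    "emeasure \<rho> {x\<in>space \<rho>. u x \<noteq> 0} < \<infinity>" "finite (u ` space \<rho>)"
    "{x\<in>space \<rho>. u x = c} \<in> sets \<rho>"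
proof -
  show u: "simple_function \<rho> u" using assms by (simp add: test_funs_def)
  show [measurable]: "u \<in> borel_measurable \<rho>" by (rule borel_measurable_simple_function[OF u])
  show "finite (u ` space \<rho>)" using u by (simp add: simple_function_def)
  show "{x\<in>space \<rho>. u x = c} \<in> sets \<rho>" by measurable
qed (use assms in \<open>auto simp: test_funs_def\<close>)

lemma test_funs_zero: "(\<lambda>_. 0) \<in> test_funs \<rho>"
  by (simp add: test_funs_def)

lemma test_funs_add:
  assumes u: "u \<in> test_funs \<rho>" and w: "w \<in> test_funs \<rho>"
  shows "(\<lambda>x. u x + w x) \<in> test_funs \<rho>"
proof -
  note [measurable] = test_funsD(2)[OF u] test_funsD(2)[OF w]
  have "emeasure \<rho> {x\<in>space \<rho>. u x + w x \<noteq> 0} \<le> emeasure \<rho> ({x\<in>space \<rho>. u x \<noteq> 0} \<union> {x\<in>space \<rho>. w x \<noteq> 0})"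
    by (intro emeasure_mono) auto
  also have "\<dots> \<le> emeasure \<rho> {x\<in>space \<rho>. u x \<noteq> 0} + emeasure \<rho> {x\<in>space \<rho>. w x \<noteq> 0}"
    by (intro emeasure_subadditive) auto
  also have "\<dots> < \<infinity>" using test_funsD(4)[OF u] test_funsD(4)[OF w] by simp
  finally show ?thesis
    using u w by (auto simp: test_funs_def intro!: simple_function_add)
qed

text \<open>The level 0 is left out because its preimage may have infinite measure;
  \<open>F 0 = 0\<close> is what makes this harmless.\<close>

lemma test_fun_apply:
  fixes F :: "real \<Rightarrow> real"
  assumes u: "u \<in> test_funs \<rho>" and F: "F 0 = 0" and x: "x \<in> space \<rho>"
  shows "F (u x) = (\<Sum>c\<in>u ` space \<rho> - {0}. F c * indicator {x\<in>space \<rho>. u x = c} x)"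
proof -
  have "(\<Sum>c\<in>u ` space \<rho> - {0}. F c * indicator {x\<in>space \<rho>. u x = c} x)
      = (\<Sum>c\<in>u ` space \<rho> - {0}. if u x = c then F c else 0)"
    using x by (intro sum.cong) auto
  then show ?thesis using test_funsD(5)[OF u] x F by auto
qed

lemma nn_integral_test_fun:
  assumes u: "u \<in> test_funs \<rho>" and \<phi>: "sets \<phi> = sets \<rho>"
  shows "(\<integral>\<^sup>+x. ennreal (u x) \<partial>\<phi>)
    = (\<Sum>c\<in>u ` space \<rho> - {0}. ennreal c * emeasure \<phi> {x\<in>space \<rho>. u x = c})"
proof -
  have sp: "space \<phi> = space \<rho>" using \<phi> by (rule sets_eq_imp_space_eq)
  have "(\<integral>\<^sup>+x. ennreal (u x) \<partial>\<phi>)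
      = (\<integral>\<^sup>+x. (\<Sum>c\<in>u ` space \<rho> - {0}. ennreal c * indicator {x\<in>space \<rho>. u x = c} x) \<partial>\<phi>)"
  proof (rule nn_integral_cong)
    fix x assume "x \<in> space \<phi>"
    then have x: "x \<in> space \<rho>" using sp by simp
    have "ennreal (u x) = ennreal (\<Sum>c\<in>u ` space \<rho> - {0}. c * indicator {x\<in>space \<rho>. u x = c} x)"
      by (rule arg_cong[where f=ennreal, OF test_fun_apply[where F="\<lambda>c. c", OF u refl x]])
    also have "\<dots> = (\<Sum>c\<in>u ` space \<rho> - {0}. ennreal (c * indicator {x\<in>space \<rho>. u x = c} x))"
      by (rule sum_ennreal[symmetric]) (use test_funsD(3)[OF u] in \<open>auto simp: indicator_def\<close>)
    also have "\<dots> = (\<Sum>c\<in>u ` space \<rho> - {0}. ennreal c * indicator {x\<in>space \<rho>. u x = c} x)"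
      by (intro sum.cong) (auto simp: indicator_def)
    finally show "ennreal (u x) = (\<Sum>c\<in>u ` space \<rho> - {0}. ennreal c * indicator {x\<in>space \<rho>. u x = c} x)" .
  qed
  also have "\<dots> = (\<Sum>c\<in>u ` space \<rho> - {0}. ennreal c * emeasure \<phi> {x\<in>space \<rho>. u x = c})"
    using test_funsD(6)[OF u] \<phi>
    by (subst nn_integral_sum) (auto intro!: sum.cong nn_integral_cmult_indicator borel_measurable_times_ennreal)
  finally show ?thesis .
qed

lemma measurable_nn_integral_test_fun:
  assumes u: "u \<in> test_funs \<rho>"
  shows "(\<lambda>\<phi>. \<integral>\<^sup>+x. ennreal (u x) \<partial>\<phi>) \<in> borel_measurable (config_space \<rho>)"
proof -
  note [measurable] = test_funsD(6)[OF u]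
  have "(\<lambda>\<phi>. \<Sum>c\<in>u ` space \<rho> - {0}. ennreal c * emeasure \<phi> {x\<in>space \<rho>. u x = c})
      \<in> borel_measurable (config_space \<rho>)" by measurable
  also have "?this \<longleftrightarrow> ?thesis"
    by (intro measurable_cong) (auto simp: nn_integral_test_fun[OF u] space_config_space configsD)
  finally show ?thesis .
qed

lemma measurable_expfun:
  "u \<in> test_funs \<rho> \<Longrightarrow> expfun u \<in> borel_measurable (config_space \<rho>)"
  unfolding expfun_def
  by (rule measurable_compose[OF measurable_nn_integral_test_fun expneg_measurable])

lemma expfun_range: "expfun u \<phi> \<in> {0..1}"
  by (simp add: expfun_def expneg_range)

lemma expfun_add:
  assumes "u \<in> test_funs \<rho>" "w \<in> test_funs \<rho>" "sets \<phi> = sets \<rho>"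
  shows "expfun (\<lambda>x. u x + w x) \<phi> = expfun u \<phi> * expfun w \<phi>"
proof -
  have [measurable]: "u \<in> borel_measurable \<phi>" "w \<in> borel_measurable \<phi>"
    using assms test_funsD(2) by (auto cong: measurable_cong_sets)
  have sp: "space \<phi> = space \<rho>" using assms(3) by (rule sets_eq_imp_space_eq)
  have "(\<integral>\<^sup>+x. ennreal (u x + w x) \<partial>\<phi>) = (\<integral>\<^sup>+x. ennreal (u x) + ennreal (w x) \<partial>\<phi>)"
    using assms sp by (intro nn_integral_cong) (auto dest: test_funsD(3) intro!: ennreal_plus)
  then show ?thesis
    by (simp add: expfun_def nn_integral_add expneg_add)
qed

lemma nn_integral_add_points:
  assumes u: "u \<in> test_funs \<rho>" and \<phi>: "sets \<phi> = sets \<rho>" and x: "\<And>j. j \<in> J \<Longrightarrow> x j \<in> space \<rho>"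
  shows "(\<integral>\<^sup>+y. ennreal (u y) \<partial>add_points \<phi> J x) = (\<integral>\<^sup>+y. ennreal (u y) \<partial>\<phi>) + (\<Sum>j\<in>J. ennreal (u (x j)))"
proof -
  let ?C = "u ` space \<rho> - {0}" and ?B = "\<lambda>c. {x\<in>space \<rho>. u x = c}"
  have "(\<integral>\<^sup>+y. ennreal (u y) \<partial>add_points \<phi> J x)
      = (\<Sum>c\<in>?C. ennreal c * (emeasure \<phi> (?B c) + (\<Sum>j\<in>J. indicator (?B c) (x j))))"
    by (subst nn_integral_test_fun[OF u])
       (auto simp: \<phi> emeasure_add_points test_funsD(6)[OF u] intro!: sum.cong)
  also have "\<dots> = (\<integral>\<^sup>+y. ennreal (u y) \<partial>\<phi>) + (\<Sum>j\<in>J. \<Sum>c\<in>?C. ennreal c * indicator (?B c) (x j))"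
    by (subst sum.swap) (simp add: nn_integral_test_fun[OF u \<phi>] distrib_left sum.distrib sum_distrib_left)
  also have "(\<Sum>j\<in>J. \<Sum>c\<in>?C. ennreal c * indicator (?B c) (x j)) = (\<Sum>j\<in>J. ennreal (u (x j)))"
  proof (rule sum.cong[OF refl])
    fix j assume j: "j \<in> J"
    have "(\<Sum>c\<in>?C. ennreal c * indicator (?B c) (x j)) = (\<Sum>c\<in>?C. if u (x j) = c then ennreal c else 0)"
      using x[OF j] by (intro sum.cong) auto
    then show "(\<Sum>c\<in>?C. ennreal c * indicator (?B c) (x j)) = ennreal (u (x j))"
      using test_funsD(5)[OF u] x[OF j] by auto
  qed
  finally show ?thesis .
qed

text \<open>A point added at y multiplies \<open>expfun u\<close> by exp (- u y). The alternating
  sum over subsets is then the expanded product of the factors exp (- u (x j)) - 1, so exponentials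
  are eigenfunctions of the difference operators.\<close>

lemma diff_on_expfun:
  assumes u: "u \<in> test_funs \<rho>" and \<phi>: "sets \<phi> = sets \<rho>" and I: "finite I"
    and x: "\<And>j. j \<in> I \<Longrightarrow> x j \<in> space \<rho>"
  shows "diff_on I x (expfun u) \<phi> = expfun u \<phi> * (\<Prod>j\<in>I. exp (- u (x j)) - 1)"
proof -
  have "diff_on I x (expfun u) \<phi> =
      (\<Sum>J\<in>Pow I. expfun u \<phi> * ((\<Prod>j\<in>J. exp (- u (x j))) * (\<Prod>j\<in>I - J. - 1)))"
    unfolding diff_on_def
  proof (rule sum.cong[OF refl])
    fix J assume J: "J \<in> Pow I"
    then have fin: "finite J" using I by (auto intro: finite_subset)
    have "expfun u (add_points \<phi> J x) = expfun u \<phi> * (\<Prod>j\<in>J. exp (- u (x j)))"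
      unfolding expfun_def using J x
      by (subst nn_integral_add_points[OF u \<phi>])
         (auto simp: expneg_add expneg_sum[OF fin] test_funsD(3)[OF u] intro!: prod.cong)
    moreover have "(\<Prod>j\<in>I - J. - 1 :: real) = (- 1) ^ (card I - card J)"
      using J fin by (simp add: card_Diff_subset)
    ultimately show "(- 1) ^ (card I - card J) * expfun u (add_points \<phi> J x)
        = expfun u \<phi> * ((\<Prod>j\<in>J. exp (- u (x j))) * (\<Prod>j\<in>I - J. - 1))"
      by simp
  qed
  also have "\<dots> = expfun u \<phi> * (\<Prod>j\<in>I. exp (- u (x j)) + - 1)"
    unfolding prod_add[OF I] sum_distrib_left ..
  finally show ?thesis by simp
qed

subsection \<open>Functionals of a Poisson process\<close>

text \<open>For B of finite intensity, \<open>expfun (indicator B)\<close> is exp (- \<phi>(B)): its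
  levels exp (- k) and 0 single out the counts k and infinity, and a map with countably many values
  is measurable as soon as its levels are. Other sets B are exhausted by sets of finite
  intensity.\<close>

lemma config_space_generated:
  assumes \<rho>: "sigma_finite_measure \<rho>"
  shows "sets (config_space \<rho>) \<subseteq> sigma_sets (space (config_space \<rho>))
    {g -` {a} \<inter> space (config_space \<rho>) |g a. g \<in> expfun ` test_funs \<rho> \<and> a \<in> {0..1}}"
    (is "_ \<subseteq> sigma_sets ?S ?G")
proof -
  interpret sigma_finite_measure \<rho> by fact
  define N where "N = sigma ?S ?G"
  have G: "?G \<subseteq> Pow ?S" by auto
  have N: "space N = ?S" "sets N = sigma_sets ?S ?G"
    using G by (simp_all add: N_def space_measure_of sets_measure_of)
  have fin: "(\<lambda>\<phi>. emeasure \<phi> B) \<in> borel_measurable N" if B: "B \<in> sets \<rho>" "emeasure \<rho> B < \<infinity>" for B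
  proof -
    have "B \<subseteq> space \<rho>" using B(1) by (rule sets.sets_into_space)
    then have "{x \<in> space \<rho>. indicator B x \<noteq> (0::real)} = B" by (auto simp: indicator_def)
    then have u: "indicator B \<in> test_funs \<rho>"
      using B by (simp add: test_funs_def)
    have e: "expfun (indicator B) \<phi> = expneg (emeasure \<phi> B)" if "\<phi> \<in> ?S" for \<phi>
    proof -
      have "(\<integral>\<^sup>+x. ennreal (indicator B x) \<partial>\<phi>) = emeasure \<phi> B"
        using that B by (simp add: space_config_space configsD ennreal_indicator)
      then show ?thesis by (simp add: expfun_def)
    qed
    have ex: "\<exists>k. emeasure \<phi> B = of_nat k" if "\<phi> \<in> ?S" "emeasure \<phi> B \<noteq> \<infinity>" for \<phi>
    proof -
      have "emeasure \<phi> B \<in> range ennreal_of_enat"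
        using that B by (intro configsD) (auto simp: space_config_space)
      then obtain n where "emeasure \<phi> B = ennreal_of_enat n" by auto
      then show ?thesis using that(2) by (cases n) (auto simp: ennreal_of_enat_def)
    qed
    have lev: "{\<phi>\<in>?S. expfun (indicator B) \<phi> = a} \<in> sets N" if "a \<in> {0..1}" for a
    proof -
      have "{\<phi>\<in>?S. expfun (indicator B) \<phi> = a} = expfun (indicator B) -` {a} \<inter> ?S" by auto
      then show ?thesis unfolding N using u that by (intro sigma_sets.Basic) blast
    qed
    have 1: "{\<phi>\<in>?S. emeasure \<phi> B = of_nat k} \<in> sets N" for k
    proof -
      have "{\<phi>\<in>?S. emeasure \<phi> B = of_nat k} = {\<phi>\<in>?S. expfun (indicator B) \<phi> = exp (- real k)}"
      proof (intro Collect_cong conj_cong refl)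
        fix \<phi> assume \<phi>: "\<phi> \<in> ?S"
        show "emeasure \<phi> B = of_nat k \<longleftrightarrow> expfun (indicator B) \<phi> = exp (- real k)"
        proof (cases "emeasure \<phi> B = \<infinity>")
          case False
          with ex[OF \<phi>] obtain j where "emeasure \<phi> B = of_nat j" by auto
          then show ?thesis by (simp add: e[OF \<phi>] expneg_def)
        qed (simp add: e[OF \<phi>])
      qed
      then show ?thesis using lev[of "exp (- real k)"] by simp
    qed
    have 2: "{\<phi>\<in>?S. emeasure \<phi> B = \<infinity>} \<in> sets N"
    proof -
      have "{\<phi>\<in>?S. emeasure \<phi> B = \<infinity>} = {\<phi>\<in>?S. expfun (indicator B) \<phi> = 0}"
        by (auto simp: e expneg_def split: if_splits)
      then show ?thesis using lev[of 0] by simp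
    qed
    show ?thesis
    proof (rule measurableI)
      fix A :: "ennreal set"
      have "(\<lambda>\<phi>. emeasure \<phi> B) -` A \<inter> space N =
        (\<Union>k\<in>{k::nat. of_nat k \<in> A}. {\<phi>\<in>?S. emeasure \<phi> B = of_nat k}) \<union>
        (if \<infinity> \<in> A then {\<phi>\<in>?S. emeasure \<phi> B = \<infinity>} else {})"
        using ex by (fastforce simp: N split: if_splits)
      also have "\<dots> \<in> sets N" using 1 2 by auto
      finally show "(\<lambda>\<phi>. emeasure \<phi> B) -` A \<inter> space N \<in> sets N" .
    qed simp
  qed
  obtain D :: "nat \<Rightarrow> _" where D: "range D \<subseteq> sets \<rho>" "(\<Union>i. D i) = space \<rho>" "\<And>i. emeasure \<rho> (D i) \<noteq> \<infinity>" "incseq D"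
    using sigma_finite_incseq by blast
  \<comment> \<open>Measurability of the identity map is the claimed inclusion of sigma-algebras,
    and it needs checking only on evaluations at sets B.\<close>
  have "(\<lambda>\<phi>. \<phi>) \<in> measurable N (config_space \<rho>)"
  proof (rule measurable_config_space)
    fix B assume B: "B \<in> sets \<rho>"
    have DB: "D i \<inter> B \<in> sets \<rho>" for i using D(1) B by auto
    have "(\<lambda>\<phi>. SUP i. emeasure \<phi> (D i \<inter> B)) \<in> borel_measurable N"
    proof (intro borel_measurable_SUP fin DB)
      show "emeasure \<rho> (D i \<inter> B) < \<infinity>" for i
        using D(1) D(3)[of i] B emeasure_mono[of "D i \<inter> B" "D i" \<rho>] by (auto simp: less_top top_unique)
    qed auto
    also have "?this \<longleftrightarrow> (\<lambda>\<phi>. emeasure \<phi> B) \<in> borel_measurable N"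
    proof (rule measurable_cong)
      fix \<phi> assume "\<phi> \<in> space N"
      then have s: "sets \<phi> = sets \<rho>" by (simp add: N space_config_space configsD)
      have "(SUP i. emeasure \<phi> (D i \<inter> B)) = emeasure \<phi> (\<Union>i. D i \<inter> B)"
      proof (rule SUP_emeasure_incseq)
        show "incseq (\<lambda>i. D i \<inter> B)" using D(4) unfolding incseq_def by blast
      qed (use DB s in auto)
      also have "(\<Union>i. D i \<inter> B) = B" using D(2) sets.sets_into_space[OF B] by auto
      finally show "(SUP i. emeasure \<phi> (D i \<inter> B)) = emeasure \<phi> B" .
    qed
    finally show "(\<lambda>\<phi>. emeasure \<phi> B) \<in> borel_measurable N" .
  qed (simp add: N space_config_space)
  from measurable_sets[OF this] show ?thesis
    using sets.sets_into_space[of _ "config_space \<rho>"] by (auto simp: N Int_absorb2)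
qed

text \<open>Products of exponentials are exponentials only on configurations, where measurability of
  u and w is guaranteed. The multiplicative class therefore consists of the functions that agree on
  configurations with some \<open>expfun u\<close>.\<close>

lemma expfun_multiplicative:
  assumes \<rho>: "sigma_finite_measure \<rho>"
  assumes f: "f \<in> borel_measurable (config_space \<rho>)" "\<exists>K. \<forall>\<phi>\<in>space (config_space \<rho>). \<bar>f \<phi>\<bar> \<le> K"
    and span: "\<And>n c u. (\<And>i. i < (n::nat) \<Longrightarrow> u i \<in> test_funs \<rho>) \<Longrightarrow> P (\<lambda>\<phi>. \<Sum>i<n. c i * expfun (u i) \<phi>)"
    and lim: "\<And>F K f. (\<And>k::nat. P (F k)) \<Longrightarrow> (\<And>k x. x \<in> space (config_space \<rho>) \<Longrightarrow> \<bar>F k x\<bar> \<le> K)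
      \<Longrightarrow> (\<And>x. x \<in> space (config_space \<rho>) \<Longrightarrow> (\<lambda>k. F k x) \<longlonglongrightarrow> f x) \<Longrightarrow> P f"
  shows "P f"
proof -
  let ?S = "space (config_space \<rho>)"
  define M where "M = {g. \<exists>u\<in>test_funs \<rho>. \<forall>\<phi>\<in>?S. g \<phi> = expfun u \<phi>}"
  have s: "sets \<phi> = sets \<rho>" if "\<phi> \<in> ?S" for \<phi> using that by (simp add: space_config_space configsD)
  show ?thesis
  proof (rule multiplicative_class[of M "config_space \<rho>"])
    show "(\<lambda>_. 1) \<in> M"
      unfolding M_def by (auto intro!: bexI[OF _ test_funs_zero] simp: expfun_def)
    show "(\<lambda>x. f x * g x) \<in> M" if "f \<in> M" "g \<in> M" for f g
    proof -
      obtain u w where "u \<in> test_funs \<rho>" "\<forall>\<phi>\<in>?S. f \<phi> = expfun u \<phi>" "w \<in> test_funs \<rho>" "\<forall>\<phi>\<in>?S. g \<phi> = expfun w \<phi>"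
        using \<open>f \<in> M\<close> \<open>g \<in> M\<close> by (auto simp: M_def)
      then show ?thesis unfolding M_def
        by (auto intro!: bexI[of _ "\<lambda>x. u x + w x"] test_funs_add simp: expfun_add s)
    qed
    show "f x \<in> {0..1}" if "f \<in> M" "x \<in> ?S" for f x
    proof -
      obtain u where "\<forall>\<phi>\<in>?S. f \<phi> = expfun u \<phi>" using \<open>f \<in> M\<close> unfolding M_def by blast
      then have "f x = expfun u x" using that by blast
      then show ?thesis using expfun_range[of u x] by simp
    qed
    have "expfun ` test_funs \<rho> \<subseteq> M" unfolding M_def by auto
    then have "{g -` {a} \<inter> ?S |g a. g \<in> expfun ` test_funs \<rho> \<and> a \<in> {0..1}}
        \<subseteq> {g -` {a} \<inter> ?S |g a. g \<in> M \<and> a \<in> {0..1::real}}" by blast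
    then show "sets (config_space \<rho>) \<subseteq> sigma_sets ?S {g -` {a} \<inter> ?S |g a. g \<in> M \<and> a \<in> {0..1}}"
      by (rule order_trans[OF config_space_generated[OF \<rho>] sigma_sets_mono'])
    show "f \<in> borel_measurable (config_space \<rho>) \<and> (\<exists>K. \<forall>\<phi>\<in>?S. \<bar>f \<phi>\<bar> \<le> K)" using f by simp
    show "P (\<lambda>x. \<Sum>i<n. c i * g i x)" if "\<And>i. i < n \<Longrightarrow> g i \<in> M" for n :: nat and c g
    proof -
      have "\<forall>i\<in>{..<n}. \<exists>u. u \<in> test_funs \<rho> \<and> (\<forall>\<phi>\<in>?S. g i \<phi> = expfun u \<phi>)"
        using that unfolding M_def by blast
      from bchoice[OF this]
      obtain u where u: "\<And>i. i < n \<Longrightarrow> u i \<in> test_funs \<rho>" "\<And>i \<phi>. i < n \<Longrightarrow> \<phi> \<in> ?S \<Longrightarrow> g i \<phi> = expfun (u i) \<phi>"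
        by blast
      show ?thesis
      \<comment> \<open>A limit along a constant sequence again: the members \<open>g i\<close> of
        the class are exchanged for the exponentials that they equal on configurations.\<close>
      proof (rule lim[of "\<lambda>_ \<phi>. \<Sum>i<n. c i * expfun (u i) \<phi>" "\<Sum>i<n. \<bar>c i\<bar>"])
        fix \<phi> assume \<phi>: "\<phi> \<in> ?S"
        have "\<bar>\<Sum>i<n. c i * expfun (u i) \<phi>\<bar> \<le> (\<Sum>i<n. \<bar>c i * expfun (u i) \<phi>\<bar>)" by (rule sum_abs)
        also have "\<dots> \<le> (\<Sum>i<n. \<bar>c i\<bar>)"
        proof (rule sum_mono)
          fix i
          have "\<bar>expfun (u i) \<phi>\<bar> \<le> 1" using expfun_range[of "u i" \<phi>] by auto
          then show "\<bar>c i * expfun (u i) \<phi>\<bar> \<le> \<bar>c i\<bar>" by (simp add: abs_mult mult_left_le)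
        qed
        finally show "\<bar>\<Sum>i<n. c i * expfun (u i) \<phi>\<bar> \<le> (\<Sum>i<n. \<bar>c i\<bar>)" .
      qed (use u in \<open>auto intro!: span\<close>)
    qed
  qed (fact lim)
qed

section \<open>Poisson counts: exponential moments, variance, independence\<close>

definition poisson_weight :: "real \<Rightarrow> nat \<Rightarrow> real" where
  "poisson_weight L k = L ^ k / fact k * exp (- L)"

lemma poisson_weight_nonneg: "0 \<le> L \<Longrightarrow> 0 \<le> poisson_weight L k"
  by (simp add: poisson_weight_def)

lemma poisson_weight_exp_sums:
  "(\<lambda>k. exp (- c * real k) * poisson_weight L k) sums exp (- (L * (1 - exp (- c))))"
proof -
  have "(\<lambda>k. exp (- L) * ((L * exp (- c)) ^ k /\<^sub>R fact k)) sums (exp (- L) * exp (L * exp (- c)))"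
    by (intro sums_mult exp_converges)
  moreover have "exp (- L) * ((L * exp (- c)) ^ k /\<^sub>R fact k) = exp (- c * real k) * poisson_weight L k" for k
    using exp_of_nat_mult[of k "- c"]
    by (simp add: poisson_weight_def power_mult_distrib divide_inverse mult_ac)
  moreover have "exp (- L) * exp (L * exp (- c)) = exp (- (L * (1 - exp (- c))))"
    by (simp add: mult_exp_exp algebra_simps)
  ultimately show ?thesis by simp
qed

lemma poisson_weight_sums: "poisson_weight L sums 1"
  using poisson_weight_exp_sums[of 0 L] by simp

text \<open>This index shift lowers the degree of a moment by one; applied once it gives the mean,
  applied to k^2 it gives L (L + 1).\<close>

lemma poisson_weight_Suc: "real (Suc k) * poisson_weight L (Suc k) = L * poisson_weight L k"
  by (simp add: poisson_weight_def field_simps del: of_nat_Suc)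

lemma poisson_weight_mean_sums: "(\<lambda>k. real k * poisson_weight L k) sums L"
proof -
  have "(\<lambda>k. real (Suc k) * poisson_weight L (Suc k)) sums (L * 1)"
    unfolding poisson_weight_Suc by (intro sums_mult poisson_weight_sums)
  then show ?thesis by (subst (asm) sums_Suc_iff) simp
qed

lemma poisson_weight_variance_sums: "(\<lambda>k. (real k - L)\<^sup>2 * poisson_weight L k) sums L"
proof -
  have "(\<lambda>k. real (Suc k) * (real (Suc k) * poisson_weight L (Suc k))) sums (L * (L + 1))"
  proof -
    have "(\<lambda>k. L * (real k * poisson_weight L k + poisson_weight L k)) sums (L * (L + 1))"
      by (intro sums_mult sums_add poisson_weight_mean_sums poisson_weight_sums)
    then show ?thesis unfolding poisson_weight_Suc by (simp add: algebra_simps)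
  qed
  then have 1: "(\<lambda>k. real k * (real k * poisson_weight L k)) sums (L * (L + 1))"
    by (subst (asm) sums_Suc_iff) simp
  have "(\<lambda>k. real k * (real k * poisson_weight L k) - 2 * L * (real k * poisson_weight L k)
      + L\<^sup>2 * poisson_weight L k) sums (L * (L + 1) - 2 * L * L + L\<^sup>2 * 1)"
    by (intro sums_add sums_diff sums_mult 1 poisson_weight_mean_sums poisson_weight_sums)
  then show ?thesis by (simp add: algebra_simps power2_eq_square)
qed

lemma test_fun_level_finite:
  assumes u: "u \<in> test_funs \<kappa>" and c: "c \<noteq> 0"
  shows "emeasure \<kappa> {x\<in>space \<kappa>. u x = c} < \<infinity>"
proof -
  note [measurable] = test_funsD(2)[OF u]
  have "emeasure \<kappa> {x\<in>space \<kappa>. u x = c} \<le> emeasure \<kappa> {x\<in>space \<kappa>. u x \<noteq> 0}"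
    using c by (intro emeasure_mono) auto
  then show ?thesis using test_funsD(4)[OF u] by (rule le_less_trans)
qed

lemma test_fun_integral:
  fixes F :: "real \<Rightarrow> real"
  assumes u: "u \<in> test_funs \<kappa>" and F: "F 0 = 0"
  shows "(\<integral>x. F (u x) \<partial>\<kappa>) = (\<Sum>c\<in>u ` space \<kappa> - {0}. F c * measure \<kappa> {x\<in>space \<kappa>. u x = c})"
    and "integrable \<kappa> (\<lambda>x. F (u x))"
proof -
  let ?C = "u ` space \<kappa> - {0}" and ?B = "\<lambda>c. {x\<in>space \<kappa>. u x = c}"
  note 1 = test_fun_apply[where F=F, OF u F]
  have int: "integrable \<kappa> (\<lambda>x. F c * indicator (?B c) x)" if "c \<in> ?C" for c
    using that test_funsD(6)[OF u] test_fun_level_finite[OF u]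
    by (intro integrable_mult_right) auto
  have "integrable \<kappa> (\<lambda>x. \<Sum>c\<in>?C. F c * indicator (?B c) x)"
    using int by (rule Bochner_Integration.integrable_sum)
  also have "?this \<longleftrightarrow> integrable \<kappa> (\<lambda>x. F (u x))"
    by (intro Bochner_Integration.integrable_cong refl) (rule 1[symmetric])
  finally show "integrable \<kappa> (\<lambda>x. F (u x))" .
  have "(\<integral>x. F (u x) \<partial>\<kappa>) = (\<integral>x. (\<Sum>c\<in>?C. F c * indicator (?B c) x) \<partial>\<kappa>)"
    by (intro Bochner_Integration.integral_cong refl) (rule 1)
  also have "\<dots> = (\<Sum>c\<in>?C. \<integral>x. F c * indicator (?B c) x \<partial>\<kappa>)"
    using int by (rule Bochner_Integration.integral_sum)
  also have "\<dots> = (\<Sum>c\<in>?C. F c * measure \<kappa> (?B c))"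
  proof (rule sum.cong[OF refl])
    fix c
    have "?B c \<inter> space \<kappa> = ?B c" by auto
    then show "(\<integral>x. F c * indicator (?B c) x \<partial>\<kappa>) = F c * measure \<kappa> (?B c)" by simp
  qed
  finally show "(\<integral>x. F (u x) \<partial>\<kappa>) = (\<Sum>c\<in>?C. F c * measure \<kappa> (?B c))" .
qed

lemma disjoint_levels: "disjoint_family_on (\<lambda>c. {x\<in>space \<kappa>. u x = c}) C"
  by (auto simp: disjoint_family_on_def)

context
  fixes \<kappa> :: "'a measure" and Q
  assumes law: "poisson_process_law \<kappa> Q"
begin

interpretation Q: prob_space Q
  using law by (simp add: poisson_process_law_def)

lemma law_sets: "sets Q = sets (config_space \<kappa>)" and law_space: "space Q = configs \<kappa>"
proof -
  show "sets Q = sets (config_space \<kappa>)" using law by (simp add: poisson_process_law_def)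
  then show "space Q = configs \<kappa>" using sets_eq_imp_space_eq space_config_space by metis
qed

lemma measurable_law_emeasure[measurable]: "B \<in> sets \<kappa> \<Longrightarrow> (\<lambda>\<phi>. emeasure \<phi> B) \<in> borel_measurable Q"
  using measurable_emeasure_config_space[of B \<kappa>] by (simp add: measurable_cong_sets[OF law_sets refl])

text \<open>The finite counts already carry total probability 1. So infinite counts, which do occur
  among the configurations, form a null event.\<close>

lemma law_count:
  assumes B: "B \<in> sets \<kappa>" "emeasure \<kappa> B < \<infinity>"
  shows "emeasure Q {\<phi>\<in>space Q. emeasure \<phi> B = of_nat k} = ennreal (poisson_weight (measure \<kappa> B) k)"
    and "AE \<phi> in Q. \<exists>k::nat. emeasure \<phi> B = of_nat k"
proof -
  note [measurable] = B(1)
  let ?p = "poisson_weight (measure \<kappa> B)"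
  define E where "E k = {\<phi>\<in>space Q. emeasure \<phi> B = of_nat k}" for k :: nat
  have E[measurable]: "E k \<in> sets Q" for k unfolding E_def by measurable
  have m: "measure Q (E k) = ?p k" for k
    using law B unfolding poisson_process_law_def E_def poisson_weight_def by blast
  have em: "emeasure Q (E k) = ennreal (?p k)" for k
    by (simp add: Q.emeasure_eq_measure m)
  then show "emeasure Q {\<phi>\<in>space Q. emeasure \<phi> B = of_nat k} = ennreal (?p k)"
    by (simp add: E_def)
  have disj: "disjoint_family E" by (auto simp: disjoint_family_on_def E_def)
  have "emeasure Q (\<Union>k. E k) = (\<Sum>k. emeasure Q (E k))"
    using disj by (intro suminf_emeasure[symmetric]) auto
  also have "\<dots> = 1"
    unfolding em by (subst suminf_ennreal_eq[OF _ poisson_weight_sums]) (auto intro: poisson_weight_nonneg)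
  finally have "AE \<phi> in Q. \<phi> \<in> (\<Union>k. E k)"
    by (intro Q.AE_prob_1) (simp add: Q.emeasure_eq_measure)
  then show "AE \<phi> in Q. \<exists>k::nat. emeasure \<phi> B = of_nat k" by eventually_elim (auto simp: E_def)
qed

lemma law_count_AE_finite:
  assumes B: "B \<in> sets \<kappa>" "emeasure \<kappa> B < \<infinity>"
  shows "AE \<phi> in Q. emeasure \<phi> B < \<infinity>"
  using law_count(2)[OF B] by eventually_elim (auto simp: of_nat_less_top)

lemma nn_integral_law_count:
  assumes B: "B \<in> sets \<kappa>" "emeasure \<kappa> B < \<infinity>" and g[measurable]: "g \<in> borel_measurable borel"
  shows "(\<integral>\<^sup>+\<phi>. g (emeasure \<phi> B) \<partial>Q) = (\<Sum>k. g (of_nat k) * ennreal (poisson_weight (measure \<kappa> B) k))"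
proof -
  note [measurable] = B(1)
  define E where "E k = {\<phi>\<in>space Q. emeasure \<phi> B = of_nat k}" for k :: nat
  have E[measurable]: "E k \<in> sets Q" for k unfolding E_def by measurable
  have "(\<integral>\<^sup>+\<phi>. g (emeasure \<phi> B) \<partial>Q) = (\<integral>\<^sup>+\<phi>. (\<Sum>k. g (of_nat k) * indicator (E k) \<phi>) \<partial>Q)"
  proof (rule nn_integral_cong_AE)
    show "AE \<phi> in Q. g (emeasure \<phi> B) = (\<Sum>k. g (of_nat k) * indicator (E k) \<phi>)"
      using law_count(2)[OF B] AE_space
    proof eventually_elim
      case (elim \<phi>)
      then obtain k where k: "emeasure \<phi> B = of_nat k" by blast
      have "(\<Sum>j. g (of_nat j) * indicator (E j) \<phi>) = (\<Sum>j\<in>{k}. g (of_nat j) * indicator (E j) \<phi>)"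
        using k elim by (intro suminf_finite) (auto simp: E_def indicator_def)
      then show ?case using k elim by (simp add: E_def)
    qed
  qed
  also have "\<dots> = (\<Sum>k. g (of_nat k) * emeasure Q (E k))"
    by (subst nn_integral_suminf) (auto simp: nn_integral_cmult_indicator)
  finally show ?thesis
    by (simp add: E_def law_count(1)[OF B])
qed

lemma law_exp:
  assumes B: "B \<in> sets \<kappa>" "emeasure \<kappa> B < \<infinity>" and c: "0 \<le> c"
  shows "(\<integral>\<phi>. expneg (ennreal c * emeasure \<phi> B) \<partial>Q) = exp (- (measure \<kappa> B * (1 - exp (- c))))"
proof -
  note [measurable] = B(1)
  let ?p = "poisson_weight (measure \<kappa> B)"
  have "(\<integral>\<^sup>+\<phi>. ennreal (expneg (ennreal c * emeasure \<phi> B)) \<partial>Q)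
      = (\<Sum>k. ennreal (expneg (ennreal c * of_nat k)) * ennreal (?p k))"
    by (rule nn_integral_law_count[OF B]) measurable
  also have "\<dots> = (\<Sum>k. ennreal (exp (- c * real k) * ?p k))"
  proof (rule suminf_cong)
    fix k :: nat
    have *: "ennreal c * of_nat k = ennreal (c * real k)"
      using c by (simp add: ennreal_mult ennreal_of_nat_eq_real_of_nat)
    have e: "expneg (ennreal c * of_nat k) = exp (- c * real k)"
      unfolding * using c by (subst expneg_simps(2)) auto
    show "ennreal (expneg (ennreal c * of_nat k)) * ennreal (?p k) = ennreal (exp (- c * real k) * ?p k)"
      unfolding e by (rule ennreal_mult'[symmetric]) simp
  qed
  also have "\<dots> = ennreal (exp (- (measure \<kappa> B * (1 - exp (- c)))))"
    by (rule suminf_ennreal_eq[OF _ poisson_weight_exp_sums]) (simp add: poisson_weight_nonneg)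
  finally show ?thesis
    by (intro integral_eq_nn_integral[THEN trans]) (auto simp: expneg_range)
qed

lemma law_moments:
  assumes B: "B \<in> sets \<kappa>" "emeasure \<kappa> B < \<infinity>"
  defines "Z \<equiv> \<lambda>\<phi>. enn2real (emeasure \<phi> B) - measure \<kappa> B"
  shows "integrable Q Z" "(\<integral>\<phi>. Z \<phi> \<partial>Q) = 0"
    "integrable Q (\<lambda>\<phi>. (Z \<phi>)\<^sup>2)" "(\<integral>\<phi>. (Z \<phi>)\<^sup>2 \<partial>Q) = measure \<kappa> B"
proof -
  note [measurable] = B(1)
  let ?p = "poisson_weight (measure \<kappa> B)"
  have "(\<integral>\<^sup>+\<phi>. ennreal (enn2real (emeasure \<phi> B)) \<partial>Q) = (\<Sum>k. ennreal (enn2real (of_nat k)) * ennreal (?p k))"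
    by (rule nn_integral_law_count[OF B]) measurable
  also have "\<dots> = (\<Sum>k. ennreal (real k * ?p k))"
    by (intro suminf_cong) (simp add: ennreal_mult poisson_weight_nonneg)
  also have "\<dots> = ennreal (measure \<kappa> B)"
    by (rule suminf_ennreal_eq[OF _ poisson_weight_mean_sums]) (simp add: poisson_weight_nonneg)
  finally have 1: "(\<integral>\<^sup>+\<phi>. ennreal (enn2real (emeasure \<phi> B)) \<partial>Q) = ennreal (measure \<kappa> B)" .
  have int: "integrable Q (\<lambda>\<phi>. enn2real (emeasure \<phi> B))"
    by (rule integrableI_nonneg) (auto simp: 1)
  then show "integrable Q Z" unfolding Z_def by simp
  have "(\<integral>\<phi>. enn2real (emeasure \<phi> B) \<partial>Q) = measure \<kappa> B"
    by (subst integral_eq_nn_integral) (auto simp: 1)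
  then show "(\<integral>\<phi>. Z \<phi> \<partial>Q) = 0" unfolding Z_def using int by (simp add: Q.prob_space)
  have "(\<integral>\<^sup>+\<phi>. ennreal ((Z \<phi>)\<^sup>2) \<partial>Q) = (\<Sum>k. ennreal ((enn2real (of_nat k) - measure \<kappa> B)\<^sup>2) * ennreal (?p k))"
    unfolding Z_def by (rule nn_integral_law_count[OF B]) measurable
  also have "\<dots> = (\<Sum>k. ennreal ((real k - measure \<kappa> B)\<^sup>2 * ?p k))"
    by (intro suminf_cong) (simp add: ennreal_mult poisson_weight_nonneg)
  also have "\<dots> = ennreal (measure \<kappa> B)"
    by (rule suminf_ennreal_eq[OF _ poisson_weight_variance_sums]) (simp add: poisson_weight_nonneg)
  finally have 2: "(\<integral>\<^sup>+\<phi>. ennreal ((Z \<phi>)\<^sup>2) \<partial>Q) = ennreal (measure \<kappa> B)" .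
  have [measurable]: "Z \<in> borel_measurable Q" unfolding Z_def by measurable
  show "integrable Q (\<lambda>\<phi>. (Z \<phi>)\<^sup>2)"
    by (rule integrableI_nonneg) (auto simp: 2)
  show "(\<integral>\<phi>. (Z \<phi>)\<^sup>2 \<partial>Q) = measure \<kappa> B"
    by (subst integral_eq_nn_integral) (auto simp: 2)
qed

lemma law_indep_prod:
  fixes g :: "'c \<Rightarrow> ennreal \<Rightarrow> real"
  assumes C: "finite C" and B: "\<And>c. c \<in> C \<Longrightarrow> B c \<in> sets \<kappa>" "disjoint_family_on B C"
    and g: "\<And>c. c \<in> C \<Longrightarrow> g c \<in> borel_measurable borel"
      "\<And>c. c \<in> C \<Longrightarrow> integrable Q (\<lambda>\<phi>. g c (emeasure \<phi> (B c)))"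
  shows "(\<integral>\<phi>. (\<Prod>c\<in>C. g c (emeasure \<phi> (B c))) \<partial>Q) = (\<Prod>c\<in>C. \<integral>\<phi>. g c (emeasure \<phi> (B c)) \<partial>Q)"
    and "integrable Q (\<lambda>\<phi>. \<Prod>c\<in>C. g c (emeasure \<phi> (B c)))"
proof -
  \<comment> \<open>Independence in the definition of the law concerns families indexed by
    \<open>{1..m}\<close>, so C is enumerated.\<close>
  obtain h where h: "bij_betw h {1..card C} C"
    using ex_bij_betw_nat_finite_1[OF C] by blast
  have hC: "h i \<in> C" if "i \<in> {1..card C}" for i
    using h that by (auto simp: bij_betw_def)
  have "Q.indep_vars (\<lambda>_. borel) (\<lambda>i \<phi>. emeasure \<phi> ((B \<circ> h) i)) {1..card C}"
  proof -
    have "(B \<circ> h) ` {1..card C} \<subseteq> sets \<kappa>" using hC B(1) by auto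
    moreover have "disjoint_family_on (B \<circ> h) {1..card C}"
      using B(2) h unfolding disjoint_family_on_def bij_betw_def inj_on_def by (metis comp_apply imageI)
    ultimately show ?thesis
      using law unfolding poisson_process_law_def by blast
  qed
  then have ind: "Q.indep_vars (\<lambda>_. borel) (\<lambda>i \<phi>. g (h i) (emeasure \<phi> (B (h i)))) {1..card C}"
    unfolding comp_apply by (rule Q.indep_vars_compose2) (use g(1) hC in auto)
  have int: "integrable Q (\<lambda>\<phi>. g (h i) (emeasure \<phi> (B (h i))))" if "i \<in> {1..card C}" for i
    by (rule g(2)[OF hC[OF that]])
  have re: "(\<Prod>c\<in>C. F c) = (\<Prod>i\<in>{1..card C}. F (h i))" for F :: "'c \<Rightarrow> real"
    by (rule prod.reindex_bij_betw[OF h, symmetric])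
  show "(\<integral>\<phi>. (\<Prod>c\<in>C. g c (emeasure \<phi> (B c))) \<partial>Q) = (\<Prod>c\<in>C. \<integral>\<phi>. g c (emeasure \<phi> (B c)) \<partial>Q)"
    unfolding re by (rule Q.indep_vars_lebesgue_integral[OF _ ind int]) auto
  show "integrable Q (\<lambda>\<phi>. \<Prod>c\<in>C. g c (emeasure \<phi> (B c)))"
    unfolding re by (rule Q.indep_vars_integrable[OF _ ind int]) auto
qed

lemma integrable_bounded_law:
  fixes f :: "'a measure \<Rightarrow> real"
  assumes "f \<in> borel_measurable (config_space \<kappa>)" "\<And>\<phi>. \<phi> \<in> configs \<kappa> \<Longrightarrow> \<bar>f \<phi>\<bar> \<le> K"
  shows "integrable Q f"
proof (rule Q.integrable_const_bound[of _ K])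
  show "AE \<phi> in Q. norm (f \<phi>) \<le> K" using assms(2) by (auto simp: law_space)
  show "f \<in> borel_measurable Q" using assms(1) by (simp add: measurable_cong_sets[OF law_sets refl])
qed

text \<open>Over the distinct non-zero values c of u, the counts of the level sets are independent
  Poisson variables. The expectation factors, and the exponents add up to an integral over the
  intensity.\<close>

lemma law_laplace:
  assumes u: "u \<in> test_funs \<kappa>"
  shows "(\<integral>\<phi>. expfun u \<phi> \<partial>Q) = exp (- (\<integral>x. 1 - exp (- u x) \<partial>\<kappa>))"
proof -
  let ?C = "u ` space \<kappa> - {0}" and ?B = "\<lambda>c. {x\<in>space \<kappa>. u x = c}"
  note [measurable] = test_funsD(6)[OF u]
  have C: "finite ?C" using test_funsD(5)[OF u] by simp
  have pos: "0 \<le> c" if "c \<in> ?C" for c using that test_funsD(3)[OF u] by auto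
  have "(\<integral>\<phi>. expfun u \<phi> \<partial>Q) = (\<integral>\<phi>. (\<Prod>c\<in>?C. expneg (ennreal c * emeasure \<phi> (?B c))) \<partial>Q)"
    by (intro Bochner_Integration.integral_cong refl)
       (simp add: law_space configsD expfun_def nn_integral_test_fun[OF u] expneg_sum[OF C])
  also have "\<dots> = (\<Prod>c\<in>?C. \<integral>\<phi>. expneg (ennreal c * emeasure \<phi> (?B c)) \<partial>Q)"
    by (rule law_indep_prod(1)[OF C, where g="\<lambda>c t. expneg (ennreal c * t)"])
       (auto simp: disjoint_levels expneg_range intro!: Q.integrable_const_bound[of _ 1])
  also have "\<dots> = (\<Prod>c\<in>?C. exp (- (measure \<kappa> (?B c) * (1 - exp (- c)))))"
    using test_fun_level_finite[OF u] pos by (intro prod.cong refl law_exp) auto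
  also have "\<dots> = exp (- (\<Sum>c\<in>?C. (1 - exp (- c)) * measure \<kappa> (?B c)))"
    by (simp add: exp_sum[OF C, symmetric] sum_negf mult.commute)
  also have "(\<Sum>c\<in>?C. (1 - exp (- c)) * measure \<kappa> (?B c)) = (\<integral>x. 1 - exp (- u x) \<partial>\<kappa>)"
    by (subst test_fun_integral(1)[OF u, where F="\<lambda>c. 1 - exp (- c)"]) auto
  finally show ?thesis .
qed

text \<open>The centred functional is a combination of centred independent counts. In its square the
  mixed terms have mean 0 and each diagonal term contributes a Poisson variance, which equals the
  mean.\<close>

lemma law_test_fun_variance:
  assumes u: "u \<in> test_funs \<kappa>"
  shows "AE \<phi> in Q. (\<integral>\<^sup>+x. ennreal (u x) \<partial>\<phi>) < \<infinity>"
    and "(\<integral>\<^sup>+\<phi>. ennreal ((enn2real (\<integral>\<^sup>+x. ennreal (u x) \<partial>\<phi>) - (\<integral>x. u x \<partial>\<kappa>))\<^sup>2) \<partial>Q)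
       = ennreal (\<integral>x. (u x)\<^sup>2 \<partial>\<kappa>)"
proof -
  let ?C = "u ` space \<kappa> - {0}" and ?B = "\<lambda>c. {x\<in>space \<kappa>. u x = c}"
  let ?Z = "\<lambda>c \<phi>. enn2real (emeasure \<phi> (?B c)) - measure \<kappa> (?B c)"
  note [measurable] = test_funsD(6)[OF u]
  have C: "finite ?C" using test_funsD(5)[OF u] by simp
  have pos: "0 \<le> c" if "c \<in> ?C" for c using that test_funsD(3)[OF u] by auto
  have Bf: "?B c \<in> sets \<kappa>" "emeasure \<kappa> (?B c) < \<infinity>" if "c \<in> ?C" for c
    using that test_funsD(6)[OF u] test_fun_level_finite[OF u] by auto
  have "AE \<phi> in Q. \<forall>c\<in>?C. emeasure \<phi> (?B c) < \<infinity>"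
    using C law_count_AE_finite[OF Bf] by (intro AE_finite_allI) auto
  then have fin: "AE \<phi> in Q. (\<forall>c\<in>?C. emeasure \<phi> (?B c) < \<infinity>) \<and>
      (\<integral>\<^sup>+x. ennreal (u x) \<partial>\<phi>) = (\<Sum>c\<in>?C. ennreal c * emeasure \<phi> (?B c))"
    using AE_space
    by eventually_elim (auto simp: law_space configsD nn_integral_test_fun[OF u])
  then show "AE \<phi> in Q. (\<integral>\<^sup>+x. ennreal (u x) \<partial>\<phi>) < \<infinity>"
    by eventually_elim (use C in \<open>auto simp: ennreal_mult_less_top less_top\<close>)
  have mean: "(\<integral>x. u x \<partial>\<kappa>) = (\<Sum>c\<in>?C. c * measure \<kappa> (?B c))"
    by (rule test_fun_integral(1)[OF u]) simp
  have ae: "AE \<phi> in Q. (enn2real (\<integral>\<^sup>+x. ennreal (u x) \<partial>\<phi>) - (\<integral>x. u x \<partial>\<kappa>))\<^sup>2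
      = (\<Sum>c\<in>?C. \<Sum>d\<in>?C. c * d * (?Z c \<phi> * ?Z d \<phi>))"
    using fin
  proof eventually_elim
    case (elim \<phi>)
    have "enn2real (\<integral>\<^sup>+x. ennreal (u x) \<partial>\<phi>) = (\<Sum>c\<in>?C. enn2real (ennreal c * emeasure \<phi> (?B c)))"
      unfolding conjunct2[OF elim] by (subst enn2real_sum) (use elim in \<open>auto simp: ennreal_mult_less_top\<close>)
    also have "\<dots> = (\<Sum>c\<in>?C. c * enn2real (emeasure \<phi> (?B c)))"
      using pos by (intro sum.cong) (auto simp: enn2real_mult)
    finally have "enn2real (\<integral>\<^sup>+x. ennreal (u x) \<partial>\<phi>) - (\<integral>x. u x \<partial>\<kappa>) = (\<Sum>c\<in>?C. c * ?Z c \<phi>)"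
      by (simp add: mean right_diff_distrib sum_subtractf)
    then show ?case
      by (simp add: power2_eq_square sum_product mult_ac)
  qed
  have cross: "integrable Q (\<lambda>\<phi>. ?Z c \<phi> * ?Z d \<phi>) \<and>
      (\<integral>\<phi>. ?Z c \<phi> * ?Z d \<phi> \<partial>Q) = (if c = d then measure \<kappa> (?B c) else 0)"
    if cd: "c \<in> ?C" "d \<in> ?C" for c d
  proof (cases "c = d")
    case True
    then show ?thesis
      using law_moments(3,4)[OF Bf[OF cd(1)]] by (simp add: power2_eq_square)
  next
    case False
    have *: "finite {c, d}" "\<And>e. e \<in> {c, d} \<Longrightarrow> ?B e \<in> sets \<kappa>" "disjoint_family_on ?B {c, d}"
      "\<And>e. e \<in> {c, d} \<Longrightarrow> (\<lambda>t. enn2real t - measure \<kappa> (?B e)) \<in> borel_measurable borel"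
      "\<And>e. e \<in> {c, d} \<Longrightarrow> integrable Q (?Z e)"
      using cd Bf law_moments(1) disjoint_levels by auto
    show ?thesis
      using law_indep_prod[of "{c, d}" ?B "\<lambda>c t. enn2real t - measure \<kappa> (?B c)", OF *] False
        law_moments(2)[OF Bf[OF cd(1)]]
      by simp
  qed
  have int: "integrable Q (\<lambda>\<phi>. \<Sum>c\<in>?C. \<Sum>d\<in>?C. c * d * (?Z c \<phi> * ?Z d \<phi>))"
    using cross by (intro Bochner_Integration.integrable_sum integrable_mult_right) blast
  have "(\<integral>\<^sup>+\<phi>. ennreal ((enn2real (\<integral>\<^sup>+x. ennreal (u x) \<partial>\<phi>) - (\<integral>x. u x \<partial>\<kappa>))\<^sup>2) \<partial>Q)
      = (\<integral>\<^sup>+\<phi>. ennreal (\<Sum>c\<in>?C. \<Sum>d\<in>?C. c * d * (?Z c \<phi> * ?Z d \<phi>)) \<partial>Q)"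
    using ae by (intro nn_integral_cong_AE) auto
  also have "\<dots> = ennreal (\<integral>\<phi>. (\<Sum>c\<in>?C. \<Sum>d\<in>?C. c * d * (?Z c \<phi> * ?Z d \<phi>)) \<partial>Q)"
    by (rule nn_integral_eq_integral[OF int]) (use ae in eventually_elim, metis zero_le_power2)
  also have "(\<integral>\<phi>. (\<Sum>c\<in>?C. \<Sum>d\<in>?C. c * d * (?Z c \<phi> * ?Z d \<phi>)) \<partial>Q)
      = (\<Sum>c\<in>?C. \<Sum>d\<in>?C. c * d * (\<integral>\<phi>. ?Z c \<phi> * ?Z d \<phi> \<partial>Q))"
  proof -
    have i: "integrable Q (\<lambda>\<phi>. c * d * (?Z c \<phi> * ?Z d \<phi>))" if "c \<in> ?C" "d \<in> ?C" for c d
      using cross[OF that] by (intro integrable_mult_right) blast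
    have "(\<integral>\<phi>. (\<Sum>c\<in>?C. \<Sum>d\<in>?C. c * d * (?Z c \<phi> * ?Z d \<phi>)) \<partial>Q)
        = (\<Sum>c\<in>?C. \<integral>\<phi>. (\<Sum>d\<in>?C. c * d * (?Z c \<phi> * ?Z d \<phi>)) \<partial>Q)"
      by (intro Bochner_Integration.integral_sum Bochner_Integration.integrable_sum i)
    also have "\<dots> = (\<Sum>c\<in>?C. \<Sum>d\<in>?C. \<integral>\<phi>. c * d * (?Z c \<phi> * ?Z d \<phi>) \<partial>Q)"
      by (intro sum.cong refl Bochner_Integration.integral_sum i)
    finally show ?thesis by simp
  qed
  also have "\<dots> = (\<Sum>c\<in>?C. \<Sum>d\<in>?C. if c = d then c * d * measure \<kappa> (?B c) else 0)"
    using cross by (intro sum.cong refl) auto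
  also have "\<dots> = (\<Sum>c\<in>?C. c\<^sup>2 * measure \<kappa> (?B c))"
    using C by (intro sum.cong refl) (simp add: power2_eq_square)
  also have "\<dots> = (\<integral>x. (u x)\<^sup>2 \<partial>\<kappa>)"
    by (rule test_fun_integral(1)[OF u, symmetric]) simp
  finally show "(\<integral>\<^sup>+\<phi>. ennreal ((enn2real (\<integral>\<^sup>+x. ennreal (u x) \<partial>\<phi>) - (\<integral>x. u x \<partial>\<kappa>))\<^sup>2) \<partial>Q)
       = ennreal (\<integral>x. (u x)\<^sup>2 \<partial>\<kappa>)" .
qed

end

subsection \<open>The Bessel inequality\<close>

lemma product_sigma_finite_const: "sigma_finite_measure M \<Longrightarrow> product_sigma_finite (\<lambda>_. M)"
  by (simp add: product_sigma_finite_def)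

lemma L2_product_bound:
  fixes f g :: "'b \<Rightarrow> real"
  assumes [measurable]: "f \<in> borel_measurable M" "g \<in> borel_measurable M"
    and f: "(\<integral>\<^sup>+x. ennreal ((f x)\<^sup>2) \<partial>M) \<le> ennreal A" and g: "(\<integral>\<^sup>+x. ennreal ((g x)\<^sup>2) \<partial>M) \<le> ennreal B"
    and AB: "0 \<le> A" "0 \<le> B"
  shows "(\<integral>\<^sup>+x. ennreal \<bar>f x * g x\<bar> \<partial>M) \<le> ennreal (sqrt (A * B))"
    and "integrable M (\<lambda>x. f x * g x)"
    and "\<bar>\<integral>x. f x * g x \<partial>M\<bar> \<le> sqrt (A * B)"
proof -
  let ?I = "\<integral>\<^sup>+x. ennreal \<bar>f x * g x\<bar> \<partial>M"
  have "?I\<^sup>2 = (\<integral>\<^sup>+x. ennreal \<bar>f x\<bar> * ennreal \<bar>g x\<bar> \<partial>M)\<^sup>2"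
    by (simp add: abs_mult ennreal_mult)
  also have "\<dots> \<le> (\<integral>\<^sup>+x. ennreal \<bar>f x\<bar> ^ 2 \<partial>M) * (\<integral>\<^sup>+x. ennreal \<bar>g x\<bar> ^ 2 \<partial>M)"
    by (rule Cauchy_Schwarz_nn_integral) auto
  also have "\<dots> \<le> ennreal A * ennreal B"
    using f g by (intro mult_mono) (auto simp: ennreal_power)
  also have "\<dots> = ennreal (A * B)" using AB by (simp add: ennreal_mult)
  finally have 1: "?I\<^sup>2 \<le> ennreal (A * B)" .
  show 2: "?I \<le> ennreal (sqrt (A * B))"
  proof (cases ?I)
    case (real r)
    then have "r\<^sup>2 \<le> A * B" using 1 AB by (simp add: ennreal_power)
    then show ?thesis using real by (auto intro!: ennreal_leI real_le_rsqrt)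
  next
    case top
    then show ?thesis using 1 by (simp add: power2_eq_square ennreal_top_mult top_unique)
  qed
  then show int: "integrable M (\<lambda>x. f x * g x)"
    by (intro integrableI_bounded) (auto simp: le_less_trans)
  have "\<bar>\<integral>x. f x * g x \<partial>M\<bar> \<le> (\<integral>x. \<bar>f x * g x\<bar> \<partial>M)"
    using integral_norm_bound[of M "\<lambda>x. f x * g x"] by simp
  also have "ennreal (\<integral>x. \<bar>f x * g x\<bar> \<partial>M) \<le> ennreal (sqrt (A * B))"
    using 2 nn_integral_eq_integral[of M "\<lambda>x. \<bar>f x * g x\<bar>"] int by simp
  then have "(\<integral>x. \<bar>f x * g x\<bar> \<partial>M) \<le> sqrt (A * B)" using AB by (simp add: ennreal_le_iff)
  finally show "\<bar>\<integral>x. f x * g x \<partial>M\<bar> \<le> sqrt (A * B)" .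
qed

text \<open>The function \<open>T\<^sub>n f\<close> of the overview, with the points labelled by a
  general index set.\<close>

definition mean_diff :: "'a measure measure \<Rightarrow> nat set \<Rightarrow> ('a measure \<Rightarrow> real) \<Rightarrow> (nat \<Rightarrow> 'a) \<Rightarrow> real" where
  "mean_diff Q I f x = (\<integral>\<phi>. diff_on I x f \<phi> \<partial>Q)"

definition bdd_measurable :: "'a measure \<Rightarrow> ('a measure \<Rightarrow> real) set" where
  "bdd_measurable X = {f \<in> borel_measurable (config_space X). \<exists>K. \<forall>\<phi>\<in>configs X. \<bar>f \<phi>\<bar> \<le> K}"

lemma bdd_measurable_iff:
  "f \<in> bdd_measurable X \<longleftrightarrow> f \<in> borel_measurable (config_space X) \<and> bounded (f ` space (config_space X))"
  by (auto simp: bdd_measurable_def space_config_space bounded_iff)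

locale poisson_process =
  fixes \<rho> :: "'a measure" and Q :: "'a measure measure"
  assumes sigma_finite_intensity: "sigma_finite_measure \<rho>" and law: "poisson_process_law \<rho> Q"
begin

sublocale Q: prob_space Q
  using law by (simp add: poisson_process_law_def)

abbreviation "pow I \<equiv> PiM I (\<lambda>_. \<rho>)"

sublocale product_sigma_finite "\<lambda>_. \<rho>"
  by (rule product_sigma_finite_const[OF sigma_finite_intensity])

lemmas sets_Q = law_sets[OF law] and space_Q = law_space[OF law]

lemma diff_on_measurable:
  assumes "finite I" "f \<in> borel_measurable (config_space \<rho>)" "x \<in> space (pow I)"
  shows "diff_on I x f \<in> borel_measurable (config_space \<rho>)"
  using measurable_compose[OF measurable_Pair1'[OF assms(3)] measurable_diff_on[OF refl assms(1,2)]]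
  by simp

lemma diff_on_integrable:
  assumes "finite I" "f \<in> bdd_measurable \<rho>" "x \<in> space (pow I)"
  shows "integrable Q (diff_on I x f)"
proof -
  obtain K where "\<And>\<phi>. \<phi> \<in> configs \<rho> \<Longrightarrow> \<bar>f \<phi>\<bar> \<le> K" using assms(2) by (auto simp: bdd_measurable_def)
  then show ?thesis
    using assms by (intro integrable_bounded_law[OF law, of _ "2 ^ card I * K"] abs_diff_on_le diff_on_measurable)
      (auto simp: bdd_measurable_def)
qed

lemma diff_on_bdd_measurable:
  assumes "finite I" "f \<in> bdd_measurable \<rho>" "x \<in> space (pow I)"
  shows "diff_on I x f \<in> bdd_measurable \<rho>"
proof -
  obtain K where K: "\<And>\<phi>. \<phi> \<in> configs \<rho> \<Longrightarrow> \<bar>f \<phi>\<bar> \<le> K" using assms(2) by (auto simp: bdd_measurable_def)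
  have "\<bar>diff_on I x f \<phi>\<bar> \<le> 2 ^ card I * K" if "\<phi> \<in> configs \<rho>" for \<phi>
    by (rule abs_diff_on_le[OF assms(1) that K])
  then show ?thesis
    using assms diff_on_measurable[OF assms(1) _ assms(3)] by (auto simp: bdd_measurable_def)
qed

lemma integrable_Q: "f \<in> bdd_measurable \<rho> \<Longrightarrow> integrable Q f"
proof -
  assume f: "f \<in> bdd_measurable \<rho>"
  then obtain K where "\<And>\<phi>. \<phi> \<in> configs \<rho> \<Longrightarrow> \<bar>f \<phi>\<bar> \<le> K" by (auto simp: bdd_measurable_def)
  then show "integrable Q f"
    using f by (intro integrable_bounded_law[OF law]) (auto simp: bdd_measurable_def)
qed

lemma mean_diff_measurable:
  assumes "finite I" "f \<in> bdd_measurable \<rho>" "sets M = sets \<rho>"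
  shows "mean_diff Q I f \<in> borel_measurable (PiM I (\<lambda>_. M))"
proof -
  have "(\<lambda>z. diff_on I (fst z) f (snd z)) \<in> borel_measurable (PiM I (\<lambda>_. M) \<Otimes>\<^sub>M Q)"
    using measurable_diff_on[OF assms(3,1), of f] assms(2)
    by (simp add: bdd_measurable_def measurable_cong_sets[OF sets_pair_measure_cong[OF refl sets_Q] refl])
  then show ?thesis
    unfolding mean_diff_def[abs_def]
    by (intro Q.borel_measurable_lebesgue_integral) (simp add: case_prod_beta')
qed

lemma mean_diff_expfun:
  assumes u: "u \<in> test_funs \<rho>" and I: "finite I" and x: "x \<in> space (pow I)"
  shows "mean_diff Q I (expfun u) x = exp (- (\<integral>x. 1 - exp (- u x) \<partial>\<rho>)) * (\<Prod>j\<in>I. exp (- u (x j)) - 1)"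
proof -
  have "mean_diff Q I (expfun u) x = (\<integral>\<phi>. expfun u \<phi> * (\<Prod>j\<in>I. exp (- u (x j)) - 1) \<partial>Q)"
    unfolding mean_diff_def
  proof (intro Bochner_Integration.integral_cong refl)
    fix \<phi> assume "\<phi> \<in> space Q"
    then show "diff_on I x (expfun u) \<phi> = expfun u \<phi> * (\<Prod>j\<in>I. exp (- u (x j)) - 1)"
      using x by (intro diff_on_expfun[OF u _ I]) (auto simp: space_Q configsD space_PiM)
  qed
  then show ?thesis by (simp add: law_laplace[OF law u])
qed

lemma expfun_bdd_measurable: "u \<in> test_funs \<rho> \<Longrightarrow> expfun u \<in> bdd_measurable \<rho>"
  unfolding bdd_measurable_def
  using measurable_expfun[of u \<rho>] expfun_range[of u] by (auto intro!: exI[of _ 1])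

lemma bdd_measurable_lincomb:
  assumes "\<And>i. i \<in> A \<Longrightarrow> f i \<in> bdd_measurable \<rho>"
  shows "(\<lambda>\<phi>. \<Sum>i\<in>A. c i * f i \<phi>) \<in> bdd_measurable \<rho>"
proof -
  have "\<forall>i\<in>A. \<exists>K. \<forall>\<phi>\<in>configs \<rho>. \<bar>f i \<phi>\<bar> \<le> K" using assms by (auto simp: bdd_measurable_def)
  from bchoice[OF this] obtain K where K: "\<And>i \<phi>. i \<in> A \<Longrightarrow> \<phi> \<in> configs \<rho> \<Longrightarrow> \<bar>f i \<phi>\<bar> \<le> K i" by blast
  have "\<bar>\<Sum>i\<in>A. c i * f i \<phi>\<bar> \<le> (\<Sum>i\<in>A. \<bar>c i\<bar> * K i)" if "\<phi> \<in> configs \<rho>" for \<phi>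
    by (rule order_trans[OF sum_abs sum_mono]) (auto simp: abs_mult intro!: mult_left_mono K that)
  moreover have "(\<lambda>\<phi>. \<Sum>i\<in>A. c i * f i \<phi>) \<in> borel_measurable (config_space \<rho>)"
    using assms by (intro borel_measurable_sum borel_measurable_times) (auto simp: bdd_measurable_def)
  ultimately show ?thesis by (auto simp: bdd_measurable_def)
qed

lemma bdd_measurable_diff:
  assumes "f \<in> bdd_measurable \<rho>" "g \<in> bdd_measurable \<rho>"
  shows "(\<lambda>\<phi>. f \<phi> - g \<phi>) \<in> bdd_measurable \<rho>"
  using bdd_measurable_lincomb[of "UNIV :: bool set" "\<lambda>b. if b then f else g" "\<lambda>b. if b then 1 else -1"] assms
  by (simp add: UNIV_bool)

lemma diff_on_lincomb:
  "diff_on I x (\<lambda>\<phi>. \<Sum>i\<in>A. c i * f i \<phi>) \<phi> = (\<Sum>i\<in>A. c i * diff_on I x (f i) \<phi>)"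
  unfolding diff_on_def sum_distrib_left by (subst sum.swap) (simp add: mult.left_commute)

lemma mean_diff_lincomb:
  assumes "\<And>i. i \<in> A \<Longrightarrow> f i \<in> bdd_measurable \<rho>" "finite I" "x \<in> space (pow I)"
  shows "mean_diff Q I (\<lambda>\<phi>. \<Sum>i\<in>A. c i * f i \<phi>) x = (\<Sum>i\<in>A. c i * mean_diff Q I (f i) x)"
  unfolding mean_diff_def diff_on_lincomb
  using diff_on_integrable[OF assms(2) _ assms(3)] assms(1)
  by (subst Bochner_Integration.integral_sum) auto

text \<open>\<open>exp (- lap u)\<close> is the Laplace functional of the process at u;
  \<open>corr u w\<close> is the inner product of the one-point kernels exp (- u) - 1 and exp (- w)
  - 1 in L^2 of the intensity.\<close>

definition "lap u = (\<integral>x. 1 - exp (- u x) \<partial>\<rho>)"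
definition "corr u w = (\<integral>x. (exp (- u x) - 1) * (exp (- w x) - 1) \<partial>\<rho>)"

text \<open>Through this identity the mixed moment of two exponentials is the product of their means
  times exp (corr u w). The power series of that exponential is the chaos series, because the m-th
  power of \<open>corr\<close> is the inner product of the m-fold tensor kernels.\<close>

lemma corr:
  assumes u: "u \<in> test_funs \<rho>" and w: "w \<in> test_funs \<rho>"
  shows "integrable \<rho> (\<lambda>x. (exp (- u x) - 1) * (exp (- w x) - 1))"
    and "corr u w = lap u + lap w - lap (\<lambda>x. u x + w x)"
proof -
  have int: "integrable \<rho> (\<lambda>x. 1 - exp (- v x))" if "v \<in> test_funs \<rho>" for v
    by (rule test_fun_integral(2)[OF that]) simp
  have e: "(exp (- u x) - 1) * (exp (- w x) - 1)
      = (1 - exp (- u x)) + (1 - exp (- w x)) - (1 - exp (- (u x + w x)))" for x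
    by (simp add: algebra_simps mult_exp_exp)
  show "integrable \<rho> (\<lambda>x. (exp (- u x) - 1) * (exp (- w x) - 1))"
    unfolding e by (intro Bochner_Integration.integrable_diff Bochner_Integration.integrable_add int u w test_funs_add)
  show "corr u w = lap u + lap w - lap (\<lambda>x. u x + w x)"
    unfolding corr_def lap_def e
    using Bochner_Integration.integral_diff[OF Bochner_Integration.integrable_add[OF int[OF u] int[OF w]] int[OF test_funs_add[OF u w]]]
      Bochner_Integration.integral_add[OF int[OF u] int[OF w]] by (simp only:)
qed

text \<open>On exponentials the kernels are explicit tensor products, so the squared norm for an
  index set of size m is the quadratic form \<open>S m\<close> with entries
  \<open>corr (u i) (u j) ^ m\<close>. Summing \<open>S m / fact m\<close> produces exponentials of
  \<open>corr\<close>, that is, the second moment of f; nonnegativity of every \<open>S m\<close>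
  then isolates one term.\<close>

lemma bessel_span:
  fixes n :: nat and c :: "nat \<Rightarrow> real"
  assumes u: "\<And>i. i < n \<Longrightarrow> u i \<in> test_funs \<rho>" and I: "finite I"
  defines "f \<equiv> \<lambda>\<phi>. \<Sum>i<n. c i * expfun (u i) \<phi>"
  shows "(\<integral>\<^sup>+x. ennreal ((mean_diff Q I f x)\<^sup>2) \<partial>pow I) \<le> ennreal (fact (card I) * (\<integral>\<phi>. (f \<phi>)\<^sup>2 \<partial>Q))"
proof -
  define b where "b i = c i * exp (- lap (u i))" for i
  let ?p = "\<lambda>J i j x. \<Prod>k\<in>J. (exp (- u i (x k)) - 1) * (exp (- u j (x k)) - 1)"
  define S where "S m = (\<Sum>i<n. \<Sum>j<n. b i * b j * corr (u i) (u j) ^ m)" for m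
  have sq: "(mean_diff Q J f x)\<^sup>2
      = (\<Sum>i<n. \<Sum>j<n. b i * b j * ?p J i j x)"
    if "finite J" "x \<in> space (pow J)" for J x
  proof -
    have "mean_diff Q J f x = (\<Sum>i<n. b i * (\<Prod>k\<in>J. exp (- u i (x k)) - 1))"
      unfolding f_def using u that
      by (subst mean_diff_lincomb) (auto simp: expfun_bdd_measurable mean_diff_expfun b_def lap_def mult.assoc)
    then show ?thesis by (simp add: power2_eq_square sum_product prod.distrib mult_ac)
  qed
  have int1: "integrable (pow J) (?p J i j)"
    and val1: "(\<integral>x. ?p J i j x \<partial>pow J) = corr (u i) (u j) ^ card J"
    if "finite J" "i < n" "j < n" for i j J
  proof -
    note 1 = corr(1)[OF u[OF that(2)] u[OF that(3)]]
    show "integrable (pow J) (?p J i j)"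
      using product_integrable_prod[OF that(1), of "\<lambda>_ x. (exp (- u i x) - 1) * (exp (- u j x) - 1)"] 1 by simp
    show "(\<integral>x. ?p J i j x \<partial>pow J) = corr (u i) (u j) ^ card J"
      using product_integral_prod[OF that(1), of "\<lambda>_ x. (exp (- u i x) - 1) * (exp (- u j x) - 1)"] 1
      by (simp add: corr_def)
  qed
  have intT: "integrable (pow J) (\<lambda>x. (mean_diff Q J f x)\<^sup>2)"
    and valT: "(\<integral>x. (mean_diff Q J f x)\<^sup>2 \<partial>pow J) = S (card J)" if J: "finite J" for J
  proof -
    let ?G = "\<lambda>x. \<Sum>i<n. \<Sum>j<n. b i * b j * ?p J i j x"
    have "integrable (pow J) ?G"
      by (intro Bochner_Integration.integrable_sum integrable_mult_right int1 J) auto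
    also have "?this \<longleftrightarrow> integrable (pow J) (\<lambda>x. (mean_diff Q J f x)\<^sup>2)"
      by (intro Bochner_Integration.integrable_cong refl) (simp add: sq[OF J])
    finally show "integrable (pow J) (\<lambda>x. (mean_diff Q J f x)\<^sup>2)" .
    have "(\<integral>x. (mean_diff Q J f x)\<^sup>2 \<partial>pow J) = (\<integral>x. ?G x \<partial>pow J)"
      by (intro Bochner_Integration.integral_cong refl) (simp add: sq[OF J])
    also have "\<dots> = (\<Sum>i<n. \<integral>x. (\<Sum>j<n. b i * b j * ?p J i j x) \<partial>pow J)"
      by (intro Bochner_Integration.integral_sum Bochner_Integration.integrable_sum integrable_mult_right int1 J) auto
    also have "\<dots> = (\<Sum>i<n. \<Sum>j<n. \<integral>x. b i * b j * ?p J i j x \<partial>pow J)"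
      by (intro sum.cong refl Bochner_Integration.integral_sum integrable_mult_right int1 J) auto
    also have "\<dots> = S (card J)"
      unfolding S_def by (intro sum.cong refl) (simp add: val1[OF J])
    finally show "(\<integral>x. (mean_diff Q J f x)\<^sup>2 \<partial>pow J) = S (card J)" .
  qed
  \<comment> \<open>The coefficients have arbitrary signs, so nonnegativity is read off by realising
    the form as the integral of a square over an index set with m elements.\<close>
  have S_nonneg: "0 \<le> S m" for m
    using valT[of "{..<m}"] integral_nonneg_AE[of "\<lambda>x. (mean_diff Q {..<m} f x)\<^sup>2" "pow {..<m}"] by simp
  have "(\<lambda>m. S m / fact m) sums (\<Sum>i<n. \<Sum>j<n. b i * b j * exp (corr (u i) (u j)))"
  proof -
    have "(\<lambda>m. \<Sum>i<n. \<Sum>j<n. b i * b j * (corr (u i) (u j) ^ m /\<^sub>R fact m))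
       sums (\<Sum>i<n. \<Sum>j<n. b i * b j * exp (corr (u i) (u j)))"
      by (intro sums_sum sums_mult exp_converges)
    then show ?thesis
      by (simp add: S_def sum_divide_distrib divide_inverse sum_distrib_left mult_ac)
  qed
  also have "(\<Sum>i<n. \<Sum>j<n. b i * b j * exp (corr (u i) (u j)))
      = (\<Sum>i<n. \<Sum>j<n. c i * c j * (\<integral>\<phi>. expfun (\<lambda>x. u i x + u j x) \<phi> \<partial>Q))"
  proof (intro sum.cong refl)
    fix i j assume "i \<in> {..<n}" "j \<in> {..<n}"
    then have ij: "u i \<in> test_funs \<rho>" "u j \<in> test_funs \<rho>" using u by auto
    have "(\<integral>\<phi>. expfun (\<lambda>x. u i x + u j x) \<phi> \<partial>Q) = exp (- lap (\<lambda>x. u i x + u j x))"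
      unfolding lap_def by (rule law_laplace[OF law test_funs_add[OF ij]])
    also have "\<dots> = exp (- lap (u i)) * exp (- lap (u j)) * exp (corr (u i) (u j))"
      unfolding corr(2)[OF ij] by (simp add: mult_exp_exp)
    finally show "b i * b j * exp (corr (u i) (u j)) = c i * c j * (\<integral>\<phi>. expfun (\<lambda>x. u i x + u j x) \<phi> \<partial>Q)"
      by (simp add: b_def mult_ac)
  qed
  also have "\<dots> = (\<integral>\<phi>. (f \<phi>)\<^sup>2 \<partial>Q)"
  proof -
    have int: "integrable Q (expfun (\<lambda>x. u i x + u j x))" if "i < n" "j < n" for i j
      by (intro integrable_Q expfun_bdd_measurable test_funs_add u that)
    have "(\<integral>\<phi>. (f \<phi>)\<^sup>2 \<partial>Q) = (\<integral>\<phi>. (\<Sum>i<n. \<Sum>j<n. c i * c j * expfun (\<lambda>x. u i x + u j x) \<phi>) \<partial>Q)"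
    proof (intro Bochner_Integration.integral_cong refl)
      fix \<phi> assume "\<phi> \<in> space Q"
      then have s: "sets \<phi> = sets \<rho>" by (simp add: space_Q configsD)
      have "(f \<phi>)\<^sup>2 = (\<Sum>i<n. \<Sum>j<n. c i * c j * (expfun (u i) \<phi> * expfun (u j) \<phi>))"
        by (simp add: f_def power2_eq_square sum_product mult_ac)
      then show "(f \<phi>)\<^sup>2 = (\<Sum>i<n. \<Sum>j<n. c i * c j * expfun (\<lambda>x. u i x + u j x) \<phi>)"
        by (simp add: expfun_add[OF u u s])
    qed
    also have "\<dots> = (\<Sum>i<n. \<integral>\<phi>. (\<Sum>j<n. c i * c j * expfun (\<lambda>x. u i x + u j x) \<phi>) \<partial>Q)"
      by (intro Bochner_Integration.integral_sum Bochner_Integration.integrable_sum integrable_mult_right int) auto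
    also have "\<dots> = (\<Sum>i<n. \<Sum>j<n. \<integral>\<phi>. c i * c j * expfun (\<lambda>x. u i x + u j x) \<phi> \<partial>Q)"
      by (intro sum.cong refl Bochner_Integration.integral_sum integrable_mult_right int) auto
    finally show ?thesis by simp
  qed
  finally have sums: "(\<lambda>m. S m / fact m) sums (\<integral>\<phi>. (f \<phi>)\<^sup>2 \<partial>Q)" .
  have "S (card I) / fact (card I) \<le> (\<integral>\<phi>. (f \<phi>)\<^sup>2 \<partial>Q)"
    using sum_le_suminf[OF sums_summable[OF sums], of "{card I}"] S_nonneg sums_unique[OF sums] by simp
  then have "S (card I) \<le> fact (card I) * (\<integral>\<phi>. (f \<phi>)\<^sup>2 \<partial>Q)"
    by (simp add: field_simps)
  moreover have "(\<integral>\<^sup>+x. ennreal ((mean_diff Q I f x)\<^sup>2) \<partial>pow I) = ennreal (S (card I))"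
    using nn_integral_eq_integral[OF intT[OF I]] valT[OF I] by simp
  ultimately show ?thesis by (simp add: ennreal_leI)
qed

lemma bdd_measurable_LIMSEQ:
  assumes F: "\<And>k::nat. F k \<in> bdd_measurable \<rho>" "\<And>k \<phi>. \<phi> \<in> configs \<rho> \<Longrightarrow> \<bar>F k \<phi>\<bar> \<le> K"
    and lim: "\<And>\<phi>. \<phi> \<in> configs \<rho> \<Longrightarrow> (\<lambda>k. F k \<phi>) \<longlonglongrightarrow> f \<phi>"
  shows "f \<in> bdd_measurable \<rho>"
proof -
  have "f \<in> borel_measurable (config_space \<rho>)"
    by (rule borel_measurable_LIMSEQ_real[of _ F])
       (use F lim in \<open>auto simp: space_config_space bdd_measurable_def\<close>)
  moreover have "\<bar>f \<phi>\<bar> \<le> K" if "\<phi> \<in> configs \<rho>" for \<phi>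
    by (rule tendsto_upperbound[OF tendsto_rabs[OF lim[OF that]]]) (use F(2)[OF that] in auto)
  ultimately show ?thesis by (auto simp: bdd_measurable_def)
qed

lemma measurable_Q: "f \<in> bdd_measurable \<rho> \<Longrightarrow> f \<in> borel_measurable Q"
  by (simp add: bdd_measurable_def measurable_cong_sets[OF sets_Q refl])

lemma expectation_LIMSEQ:
  assumes F: "\<And>k::nat. F k \<in> bdd_measurable \<rho>" "\<And>k \<phi>. \<phi> \<in> configs \<rho> \<Longrightarrow> \<bar>F k \<phi>\<bar> \<le> K"
    and lim: "\<And>\<phi>. \<phi> \<in> configs \<rho> \<Longrightarrow> (\<lambda>k. F k \<phi>) \<longlonglongrightarrow> f \<phi>"
  shows "(\<lambda>k. \<integral>\<phi>. F k \<phi> \<partial>Q) \<longlonglongrightarrow> (\<integral>\<phi>. f \<phi> \<partial>Q)"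
  by (rule integral_dominated_convergence[where w="\<lambda>_. K"])
     (use F lim measurable_Q bdd_measurable_LIMSEQ[OF F lim] in \<open>auto simp: space_Q\<close>)

lemma mean_diff_LIMSEQ:
  assumes F: "\<And>k::nat. F k \<in> bdd_measurable \<rho>" "\<And>k \<phi>. \<phi> \<in> configs \<rho> \<Longrightarrow> \<bar>F k \<phi>\<bar> \<le> K"
    and lim: "\<And>\<phi>. \<phi> \<in> configs \<rho> \<Longrightarrow> (\<lambda>k. F k \<phi>) \<longlonglongrightarrow> f \<phi>"
    and I: "finite I" and x: "x \<in> space (pow I)"
  shows "(\<lambda>k. mean_diff Q I (F k) x) \<longlonglongrightarrow> mean_diff Q I f x"
  unfolding mean_diff_def
proof (rule expectation_LIMSEQ)
  show "diff_on I x (F k) \<in> bdd_measurable \<rho>" for k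
    by (rule diff_on_bdd_measurable[OF I F(1) x])
  show "\<bar>diff_on I x (F k) \<phi>\<bar> \<le> 2 ^ card I * K" if "\<phi> \<in> configs \<rho>" for k \<phi>
    by (rule abs_diff_on_le[OF I that F(2)])
  show "(\<lambda>k. diff_on I x (F k) \<phi>) \<longlonglongrightarrow> diff_on I x f \<phi>" if "\<phi> \<in> configs \<rho>" for \<phi>
    unfolding diff_on_def using I
    by (intro tendsto_intros lim add_points_mem_configs that) (auto intro: finite_subset)
qed

text \<open>On the span of the functions \<^term>\<open>expfun u\<close> the Fock space isometry
  \<open>E f\<^sup>2 = \<Sum>\<^sub>n 1/n! \<integral> (E D\<^sup>n f)\<^sup>2 d\<rho>\<^sup>n\<close> is an explicit exponential series; dropping all but one term gives an
  inequality that survives bounded pointwise limits by Fatou's lemma.\<close>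

theorem bessel:
  assumes f: "f \<in> bdd_measurable \<rho>" and I: "finite I"
  shows "(\<integral>\<^sup>+x. ennreal ((mean_diff Q I f x)\<^sup>2) \<partial>pow I) \<le> ennreal (fact (card I) * (\<integral>\<phi>. (f \<phi>)\<^sup>2 \<partial>Q))"
proof -
  let ?P = "\<lambda>f. f \<in> bdd_measurable \<rho> \<and>
    (\<integral>\<^sup>+x. ennreal ((mean_diff Q I f x)\<^sup>2) \<partial>pow I) \<le> ennreal (fact (card I) * (\<integral>\<phi>. (f \<phi>)\<^sup>2 \<partial>Q))"
  have "?P f"
  proof (rule expfun_multiplicative[OF sigma_finite_intensity, where f=f and P="?P"])
    show "f \<in> borel_measurable (config_space \<rho>)" "\<exists>K. \<forall>\<phi>\<in>space (config_space \<rho>). \<bar>f \<phi>\<bar> \<le> K"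
      using f by (auto simp: bdd_measurable_def space_config_space)
  next
    fix n c and u :: "nat \<Rightarrow> _" assume "\<And>i. i < n \<Longrightarrow> u i \<in> test_funs \<rho>"
    then show "?P (\<lambda>\<phi>. \<Sum>i<n. c i * expfun (u i) \<phi>)"
      using bessel_span[OF _ I, of n u c] by (auto intro!: bdd_measurable_lincomb expfun_bdd_measurable)
  next
    fix F :: "nat \<Rightarrow> _" and K f
    assume F: "\<And>k. ?P (F k)"
      and K: "\<And>k x. x \<in> space (config_space \<rho>) \<Longrightarrow> \<bar>F k x\<bar> \<le> K"
      and lim: "\<And>x. x \<in> space (config_space \<rho>) \<Longrightarrow> (\<lambda>k. F k x) \<longlonglongrightarrow> f x"
    have F1: "F k \<in> bdd_measurable \<rho>" for k using F by blast
    have K': "\<bar>F k x\<bar> \<le> K" "(\<lambda>k. F k x) \<longlonglongrightarrow> f x" if "x \<in> configs \<rho>" for k x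
      using K lim that by (auto simp: space_config_space)
    have fb: "f \<in> bdd_measurable \<rho>" by (rule bdd_measurable_LIMSEQ[OF F1 K'])
    have sqK: "\<bar>(F k \<phi>)\<^sup>2\<bar> \<le> K\<^sup>2" if "\<phi> \<in> configs \<rho>" for k \<phi>
      using power_mono[OF K'(1)[OF that] abs_ge_zero, of k 2] by simp
    have sq: "(\<lambda>\<phi>. (F k \<phi>)\<^sup>2) \<in> bdd_measurable \<rho>" for k
      using F1[of k] sqK[of _ k] by (auto simp: bdd_measurable_def intro!: exI[of _ "K\<^sup>2"])
    have lsq: "(\<lambda>k. \<integral>\<phi>. (F k \<phi>)\<^sup>2 \<partial>Q) \<longlonglongrightarrow> (\<integral>\<phi>. (f \<phi>)\<^sup>2 \<partial>Q)"
      by (rule expectation_LIMSEQ[OF sq sqK]) (auto intro!: tendsto_intros K')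
    have "(\<integral>\<^sup>+x. ennreal ((mean_diff Q I f x)\<^sup>2) \<partial>pow I)
        = (\<integral>\<^sup>+x. liminf (\<lambda>k. ennreal ((mean_diff Q I (F k) x)\<^sup>2)) \<partial>pow I)"
      by (intro nn_integral_cong lim_imp_Liminf[symmetric] tendsto_ennrealI tendsto_power
          mean_diff_LIMSEQ[OF F1 K' I]) auto
    also have "\<dots> \<le> liminf (\<lambda>k. \<integral>\<^sup>+x. ennreal ((mean_diff Q I (F k) x)\<^sup>2) \<partial>pow I)"
      using mean_diff_measurable[OF I F1 refl] by (intro nn_integral_liminf) auto
    also have "\<dots> \<le> liminf (\<lambda>k. ennreal (fact (card I) * (\<integral>\<phi>. (F k \<phi>)\<^sup>2 \<partial>Q)))"
      using F by (intro Liminf_mono) auto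
    also have "\<dots> = ennreal (fact (card I) * (\<integral>\<phi>. (f \<phi>)\<^sup>2 \<partial>Q))"
      by (intro lim_imp_Liminf tendsto_ennrealI tendsto_mult tendsto_const lsq) simp
    finally show "?P f"
      using fb by simp
  qed
  then show ?thesis by simp
qed

end

subsection \<open>Expansion around an intensity measure\<close>

lemma bdd_measurable_cong: "sets M = sets N \<Longrightarrow> bdd_measurable M = bdd_measurable N"
  unfolding bdd_measurable_def config_space_cong[of M N] configs_def by simp

text \<open>Writing 1 as 4^k times (1/4)^k under the root and using the inequality between geometric
  and arithmetic mean bounds each term by an exponential and a geometric series. Any constant above
  1 would serve in place of 4.\<close>

lemma summable_sqrt_exp_series:
  fixes r :: real
  assumes "0 \<le> r"
  shows "summable (\<lambda>k. sqrt (r ^ k / fact k))"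
proof (rule summable_comparison_test')
  show "summable (\<lambda>k. (4 * r) ^ k /\<^sub>R fact k + (1 / 4) ^ k)"
    by (intro summable_add summable_exp_generic summable_geometric) auto
  fix k :: nat
  have "sqrt (r ^ k / fact k) = sqrt ((4 * r) ^ k / fact k * (1 / 4) ^ k)"
    by (simp add: power_mult_distrib power_divide)
  also have "\<dots> \<le> ((4 * r) ^ k / fact k + (1 / 4) ^ k) / 2"
    using assms by (intro arith_geo_mean_sqrt) auto
  also have "\<dots> \<le> (4 * r) ^ k /\<^sub>R fact k + (1 / 4) ^ k"
    using assms by (simp add: field_simps)
  finally show "norm (sqrt (r ^ k / fact k)) \<le> (4 * r) ^ k /\<^sub>R fact k + (1 / 4) ^ k"
    using assms by simp
qed

text \<open>Both applications have a = - t with t in [0, 1]. For (i) the base measure is \<lambda> +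
  \<mu> and the perturbed one is \<lambda>; for (ii) the base is \<lambda> and the perturbed one is
  \<lambda> - \<mu>. The pointwise bound a \<ge> - 1 ensures that \<open>ennreal\<close> does not
  truncate the density 1 + a.\<close>

locale poisson_perturbation = poisson_process \<rho> Q + N: poisson_process \<nu> Q'
  for \<rho> \<nu> :: "'a measure" and Q Q' +
  fixes a :: "'a \<Rightarrow> real"
  assumes a_measurable[measurable]: "a \<in> borel_measurable \<rho>"
    and a_ge: "\<And>x. - 1 \<le> a x"
    and a_sq: "(\<integral>\<^sup>+x. ennreal ((a x)\<^sup>2) \<partial>\<rho>) < \<infinity>"
    and nu: "\<nu> = density \<rho> (\<lambda>x. ennreal (1 + a x))"
begin

lemma sets_nu: "sets \<nu> = sets \<rho>" and space_nu: "space \<nu> = space \<rho>"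
  by (simp_all add: nu)

definition "sqn = (\<integral>x. (a x)\<^sup>2 \<partial>\<rho>)"

lemma sqn: "(\<integral>\<^sup>+x. ennreal ((a x)\<^sup>2) \<partial>\<rho>) = ennreal sqn" "0 \<le> sqn" "integrable \<rho> (\<lambda>x. (a x)\<^sup>2)"
proof -
  show int: "integrable \<rho> (\<lambda>x. (a x)\<^sup>2)"
    by (rule integrableI_nonneg) (use a_sq in auto)
  show "(\<integral>\<^sup>+x. ennreal ((a x)\<^sup>2) \<partial>\<rho>) = ennreal sqn"
    unfolding sqn_def by (rule nn_integral_eq_integral[OF int]) simp
  show "0 \<le> sqn" by (simp add: sqn_def)
qed

lemma prod_a_measurable: "finite I \<Longrightarrow> (\<lambda>x. \<Prod>j\<in>I. a (x j)) \<in> borel_measurable (pow I)"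
  by measurable

lemma prod_a_sq:
  assumes I: "finite I"
  shows "(\<integral>\<^sup>+x. ennreal ((\<Prod>j\<in>I. a (x j))\<^sup>2) \<partial>pow I) = ennreal (sqn ^ card I)"
proof -
  have "(\<integral>\<^sup>+x. ennreal ((\<Prod>j\<in>I. a (x j))\<^sup>2) \<partial>pow I)
      = (\<integral>\<^sup>+x. (\<Prod>j\<in>I. ennreal ((a (x j))\<^sup>2)) \<partial>pow I)"
    by (simp add: prod_ennreal prod_power_distrib)
  also have "\<dots> = (\<Prod>j\<in>I. \<integral>\<^sup>+x. ennreal ((a x)\<^sup>2) \<partial>\<rho>)"
    by (rule product_nn_integral_prod[OF I]) simp
  finally show ?thesis by (simp add: sqn ennreal_power)
qed

text \<open>Cauchy-Schwarz with \<open>bessel\<close> for the kernel and \<open>prod_a_sq\<close>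
  for the tensor power of a. The bound grows like the square root of the factorial, so dividing by
  the factorial leaves a convergent series.\<close>

lemma coefficient_bounds:
  assumes f: "f \<in> bdd_measurable \<rho>" and I: "finite I"
  defines "C \<equiv> sqrt (fact (card I) * (\<integral>\<phi>. (f \<phi>)\<^sup>2 \<partial>Q) * sqn ^ card I)"
  shows "(\<integral>\<^sup>+x. ennreal \<bar>mean_diff Q I f x * (\<Prod>j\<in>I. a (x j))\<bar> \<partial>pow I) \<le> ennreal C"
    and "integrable (pow I) (\<lambda>x. mean_diff Q I f x * (\<Prod>j\<in>I. a (x j)))"
    and "\<bar>\<integral>x. mean_diff Q I f x * (\<Prod>j\<in>I. a (x j)) \<partial>pow I\<bar> \<le> C"
  using L2_product_bound[OF mean_diff_measurable[OF I f refl] prod_a_measurable[OF I] bessel[OF f I] eq_refl[OF prod_a_sq[OF I]]]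
  by (simp_all add: C_def sqn(2))

definition "coef I f = (\<integral>x. mean_diff Q I f x * (\<Prod>j\<in>I. a (x j)) \<partial>pow I)"

lemma coef_lincomb:
  assumes f: "\<And>i. i \<in> A \<Longrightarrow> f i \<in> bdd_measurable \<rho>" and I: "finite I"
  shows "coef I (\<lambda>\<phi>. \<Sum>i\<in>A. c i * f i \<phi>) = (\<Sum>i\<in>A. c i * coef I (f i))"
proof -
  have "coef I (\<lambda>\<phi>. \<Sum>i\<in>A. c i * f i \<phi>)
      = (\<integral>x. (\<Sum>i\<in>A. c i * (mean_diff Q I (f i) x * (\<Prod>j\<in>I. a (x j)))) \<partial>pow I)"
    unfolding coef_def
    by (intro Bochner_Integration.integral_cong refl)
       (simp add: mean_diff_lincomb[OF f I] sum_distrib_right mult.assoc)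
  also have "\<dots> = (\<Sum>i\<in>A. \<integral>x. c i * (mean_diff Q I (f i) x * (\<Prod>j\<in>I. a (x j))) \<partial>pow I)"
    by (intro Bochner_Integration.integral_sum integrable_mult_right coefficient_bounds f I)
  finally show ?thesis by (simp add: coef_def)
qed

lemma coef_diff:
  assumes "f \<in> bdd_measurable \<rho>" "g \<in> bdd_measurable \<rho>" "finite I"
  shows "coef I (\<lambda>\<phi>. f \<phi> - g \<phi>) = coef I f - coef I g"
  using coef_lincomb[of "UNIV :: bool set" "\<lambda>b. if b then f else g" I "\<lambda>b. if b then 1 else -1"] assms
  by (simp add: UNIV_bool)

text \<open>Because 1 + a is at most 2 + a^2 and a^2 is integrable, a set of finite base measure
  keeps finite measure after the perturbation.\<close>

lemma test_funs_nu: "u \<in> test_funs \<rho> \<Longrightarrow> u \<in> test_funs \<nu>"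
proof -
  assume u: "u \<in> test_funs \<rho>"
  let ?S = "{x \<in> space \<rho>. u x \<noteq> 0}"
  note [measurable] = test_funsD(2)[OF u]
  have "emeasure \<nu> ?S = (\<integral>\<^sup>+x. ennreal (1 + a x) * indicator ?S x \<partial>\<rho>)"
    unfolding nu by (rule emeasure_density) auto
  also have "\<dots> \<le> (\<integral>\<^sup>+x. 2 * indicator ?S x + ennreal ((a x)\<^sup>2) \<partial>\<rho>)"
  proof (rule nn_integral_mono)
    fix x
    have "0 \<le> (a x - 1/2)\<^sup>2" by simp
    then have "1 + a x \<le> 2 + (a x)\<^sup>2" by (simp add: power2_eq_square algebra_simps)
    then have "ennreal (1 + a x) \<le> ennreal (2 + (a x)\<^sup>2)" by (rule ennreal_leI)
    also have "\<dots> = 2 + ennreal ((a x)\<^sup>2)" by (subst ennreal_plus) auto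
    finally show "ennreal (1 + a x) * indicator ?S x \<le> 2 * indicator ?S x + ennreal ((a x)\<^sup>2)"
      by (auto simp: indicator_def)
  qed
  also have "\<dots> = 2 * emeasure \<rho> ?S + ennreal sqn"
    by (simp add: nn_integral_add nn_integral_cmult_indicator sqn(1))
  also have "\<dots> < \<infinity>" using test_funsD(4)[OF u] by (simp add: ennreal_mult_less_top)
  finally have "emeasure \<nu> ?S < \<infinity>" .
  moreover have "simple_function \<nu> u"
    using test_funsD(1)[OF u] simple_function_cong_algebra[OF sets_nu space_nu] by metis
  ultimately show "u \<in> test_funs \<nu>"
    using u by (simp add: test_funs_def space_nu)
qed

text \<open>Passing from the base to the perturbed intensity changes the exponent of the Laplace
  functional by d, the integral of (exp (- u) - 1) a, and the k-th coefficient is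
  \<open>exp (- lap u) * d ^ k\<close>. The series is that of exp d.\<close>

lemma expansion_expfun:
  assumes u: "u \<in> test_funs \<rho>" and I: "\<And>k. finite (I k)" "\<And>k. card (I k) = k"
  shows "(\<lambda>k. coef (I k) (expfun u) / fact k) sums (\<integral>\<phi>. expfun u \<phi> \<partial>Q')"
proof -
  note [measurable] = test_funsD(2)[OF u]
  have i1: "integrable \<rho> (\<lambda>x. 1 - exp (- u x))" by (rule test_fun_integral(2)[OF u]) simp
  \<comment> \<open>Only a^2 is known to be integrable, so integrability of the product of 1 - exp
    (- u) and a has to come from Cauchy-Schwarz.\<close>
  have "integrable \<rho> (\<lambda>x. (1 - exp (- u x))\<^sup>2)" by (rule test_fun_integral(2)[OF u]) simp
  then have "(\<integral>\<^sup>+x. ennreal ((1 - exp (- u x))\<^sup>2) \<partial>\<rho>) \<le> ennreal (\<integral>x. (1 - exp (- u x))\<^sup>2 \<partial>\<rho>)"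
    by (simp add: nn_integral_eq_integral)
  from L2_product_bound(2)[OF _ a_measurable this eq_refl[OF sqn(1)] _ sqn(2)]
  have i2: "integrable \<rho> (\<lambda>x. (1 - exp (- u x)) * a x)" by simp
  define d where "d = (\<integral>x. (exp (- u x) - 1) * a x \<partial>\<rho>)"
  have d: "d = - (\<integral>x. (1 - exp (- u x)) * a x \<partial>\<rho>)"
    unfolding d_def by (subst Bochner_Integration.integral_minus[symmetric]) (simp add: algebra_simps)
  have i3: "integrable \<rho> (\<lambda>x. (exp (- u x) - 1) * a x)"
    using Bochner_Integration.integrable_minus[OF i2] by (simp add: algebra_simps)
  have coef: "coef (I k) (expfun u) = exp (- lap u) * d ^ k" for k
  proof -
    have "coef (I k) (expfun u) = (\<integral>x. exp (- lap u) * (\<Prod>j\<in>I k. (exp (- u (x j)) - 1) * a (x j)) \<partial>pow (I k))"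
      unfolding coef_def
      by (intro Bochner_Integration.integral_cong refl) (simp add: mean_diff_expfun[OF u I(1)] lap_def prod.distrib)
    also have "\<dots> = exp (- lap u) * d ^ k"
      using product_integral_prod[OF I(1), of k "\<lambda>_ x. (exp (- u x) - 1) * a x"] i3 by (simp add: d_def I(2))
    finally show ?thesis .
  qed
  have "(\<lambda>k. exp (- lap u) * (d ^ k /\<^sub>R fact k)) sums (exp (- lap u) * exp d)"
    by (intro sums_mult exp_converges)
  also have "exp (- lap u) * exp d = (\<integral>\<phi>. expfun u \<phi> \<partial>Q')"
  proof -
    have "(\<integral>x. 1 - exp (- u x) \<partial>\<nu>) = (\<integral>x. (1 + a x) * (1 - exp (- u x)) \<partial>\<rho>)"
    proof -
      have "0 \<le> 1 + a x" for x using a_ge[of x] by linarith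
      then show ?thesis unfolding nu by (subst integral_density) auto
    qed
    also have "\<dots> = (\<integral>x. (1 - exp (- u x)) + (1 - exp (- u x)) * a x \<partial>\<rho>)"
      by (simp add: algebra_simps)
    also have "\<dots> = lap u - d"
      using i1 i2 by (simp add: lap_def d)
    finally show ?thesis
      using law_laplace[OF N.law test_funs_nu[OF u]] by (simp add: mult_exp_exp)
  qed
  finally show ?thesis by (simp add: coef divide_inverse mult_ac)
qed

text \<open>The last bound is the continuity estimate: the whole series is controlled by the L^2
  norm of f under the base law, with a factor independent of f.\<close>

lemma coef_sum_bound:
  assumes f: "f \<in> bdd_measurable \<rho>" and I: "\<And>k. finite (I k)" "\<And>k. card (I k) = k"
  shows "summable (\<lambda>k. norm (coef (I k) f / fact k))"
    and "summable (\<lambda>k. coef (I k) f / fact k)"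
    and "\<bar>\<Sum>k. coef (I k) f / fact k\<bar> \<le> sqrt (\<integral>\<phi>. (f \<phi>)\<^sup>2 \<partial>Q) * (\<Sum>k. sqrt (sqn ^ k / fact k))"
proof -
  let ?E = "\<integral>\<phi>. (f \<phi>)\<^sup>2 \<partial>Q"
  have E: "0 \<le> ?E" by simp
  have b: "norm (coef (I k) f / fact k) \<le> sqrt ?E * sqrt (sqn ^ k / fact k)" for k
  proof -
    have "\<bar>coef (I k) f\<bar> / fact k \<le> sqrt (fact k * ?E * sqn ^ k) / fact k"
      using coefficient_bounds(3)[OF f I(1), of k] by (intro divide_right_mono) (auto simp: coef_def I(2))
    also have "\<dots> = sqrt ?E * (sqrt (sqn ^ k) * (sqrt (fact k) / fact k))"
      by (simp add: real_sqrt_mult)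
    also have "sqrt (fact k) / fact k = 1 / sqrt (fact k)"
      by (simp add: real_div_sqrt field_simps)
    finally show ?thesis by (simp add: real_sqrt_divide)
  qed
  have s: "summable (\<lambda>k. sqrt ?E * sqrt (sqn ^ k / fact k))"
    by (intro summable_mult summable_sqrt_exp_series sqn)
  show n: "summable (\<lambda>k. norm (coef (I k) f / fact k))"
    by (rule summable_comparison_test'[OF s]) (use b in simp)
  then show "summable (\<lambda>k. coef (I k) f / fact k)" by (rule summable_norm_cancel)
  have "\<bar>\<Sum>k. coef (I k) f / fact k\<bar> \<le> (\<Sum>k. norm (coef (I k) f / fact k))"
    using summable_norm[OF n] by simp
  also have "\<dots> \<le> (\<Sum>k. sqrt ?E * sqrt (sqn ^ k / fact k))"
    by (rule suminf_le[OF b n s])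
  also have "\<dots> = sqrt ?E * (\<Sum>k. sqrt (sqn ^ k / fact k))"
    by (intro suminf_mult summable_sqrt_exp_series sqn)
  finally show "\<bar>\<Sum>k. coef (I k) f / fact k\<bar> \<le> sqrt ?E * (\<Sum>k. sqrt (sqn ^ k / fact k))" .
qed

text \<open>Both sides agree on exponentials. For a bounded limit, \<open>coef_sum_bound\<close> is
  applied to the differences \<open>F k - f\<close>, whose L^2 norms under the base law vanish by
  dominated convergence; the perturbed expectations converge for the same reason. The index sets are
  left free because the inversion uses \<open>{n+1..n+k}\<close> and part (ii) uses
  \<open>{1..k}\<close>.\<close>

theorem expansion:
  assumes f: "f \<in> bdd_measurable \<rho>" and I: "\<And>k. finite (I k)" "\<And>k. card (I k) = k"
  shows "(\<lambda>k. coef (I k) f / fact k) sums (\<integral>\<phi>. f \<phi> \<partial>Q')"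
proof -
  have bm: "bdd_measurable \<nu> = bdd_measurable \<rho>" and cf: "configs \<nu> = configs \<rho>"
    using bdd_measurable_cong[OF sets_nu] by (simp_all add: configs_def sets_nu)
  let ?P = "\<lambda>f. f \<in> bdd_measurable \<rho> \<and> (\<lambda>k. coef (I k) f / fact k) sums (\<integral>\<phi>. f \<phi> \<partial>Q')"
  have "?P f"
  proof (rule expfun_multiplicative[OF sigma_finite_intensity, where f=f and P="?P"])
    show "f \<in> borel_measurable (config_space \<rho>)" "\<exists>K. \<forall>\<phi>\<in>space (config_space \<rho>). \<bar>f \<phi>\<bar> \<le> K"
      using f by (auto simp: bdd_measurable_def space_config_space)
  next
    fix n c and u :: "nat \<Rightarrow> _" assume u: "\<And>i. i < n \<Longrightarrow> u i \<in> test_funs \<rho>"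
    have b: "i < n \<Longrightarrow> expfun (u i) \<in> bdd_measurable \<rho>" for i
      by (intro expfun_bdd_measurable u)
    have "(\<lambda>k. \<Sum>i<n. c i * (coef (I k) (expfun (u i)) / fact k)) sums (\<Sum>i<n. c i * (\<integral>\<phi>. expfun (u i) \<phi> \<partial>Q'))"
      using u by (intro sums_sum sums_mult expansion_expfun I) auto
    also have "(\<Sum>i<n. c i * (\<integral>\<phi>. expfun (u i) \<phi> \<partial>Q')) = (\<integral>\<phi>. (\<Sum>i<n. c i * expfun (u i) \<phi>) \<partial>Q')"
      using b N.integrable_Q by (subst Bochner_Integration.integral_sum) (auto simp: bm)
    finally have s: "(\<lambda>k. \<Sum>i<n. c i * (coef (I k) (expfun (u i)) / fact k)) sums (\<integral>\<phi>. (\<Sum>i<n. c i * expfun (u i) \<phi>) \<partial>Q')" .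
    show "?P (\<lambda>\<phi>. \<Sum>i<n. c i * expfun (u i) \<phi>)"
    proof -
      have "coef (I k) (\<lambda>\<phi>. \<Sum>i<n. c i * expfun (u i) \<phi>) / fact k
          = (\<Sum>i<n. c i * (coef (I k) (expfun (u i)) / fact k))" for k
        using b by (subst coef_lincomb[OF _ I(1)]) (auto simp: sum_divide_distrib)
      then show ?thesis
        using b s by (auto intro!: bdd_measurable_lincomb)
    qed
  next
    fix F :: "nat \<Rightarrow> _" and K f
    assume F: "\<And>k. ?P (F k)"
      and K: "\<And>k x. x \<in> space (config_space \<rho>) \<Longrightarrow> \<bar>F k x\<bar> \<le> K"
      and lim: "\<And>x. x \<in> space (config_space \<rho>) \<Longrightarrow> (\<lambda>k. F k x) \<longlonglongrightarrow> f x"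
    have F1: "F k \<in> bdd_measurable \<rho>" for k using F by blast
    have K': "\<bar>F k x\<bar> \<le> K" "(\<lambda>k. F k x) \<longlonglongrightarrow> f x" if "x \<in> configs \<rho>" for k x
      using K lim that by (auto simp: space_config_space)
    have fb: "f \<in> bdd_measurable \<rho>" by (rule bdd_measurable_LIMSEQ[OF F1 K'])
    have fK: "\<bar>f \<phi>\<bar> \<le> K" if "\<phi> \<in> configs \<rho>" for \<phi>
      by (rule tendsto_upperbound[OF tendsto_rabs[OF K'(2)[OF that]]]) (use K'(1)[OF that] in auto)
    define L where "L g = (\<Sum>k. coef (I k) g / fact k)" for g
    define W where "W = (\<Sum>k. sqrt (sqn ^ k / fact k))"
    have G1: "(\<lambda>\<phi>. F k \<phi> - f \<phi>) \<in> bdd_measurable \<rho>" for k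
      by (intro bdd_measurable_diff F1 fb)
    have sqK: "\<bar>(F k \<phi> - f \<phi>)\<^sup>2\<bar> \<le> (2 * K)\<^sup>2" if "\<phi> \<in> configs \<rho>" for k \<phi>
    proof -
      have "\<bar>F k \<phi> - f \<phi>\<bar> \<le> 2 * K" using K'(1)[OF that, of k] fK[OF that] by linarith
      from power_mono[OF this abs_ge_zero, of 2] show ?thesis by simp
    qed
    have sq: "(\<lambda>\<phi>. (F k \<phi> - f \<phi>)\<^sup>2) \<in> bdd_measurable \<rho>" for k
      using G1[of k] sqK[of _ k] by (auto simp: bdd_measurable_def intro!: exI[of _ "(2 * K)\<^sup>2"])
    have "(\<lambda>k. \<integral>\<phi>. (F k \<phi> - f \<phi>)\<^sup>2 \<partial>Q) \<longlonglongrightarrow> (\<integral>\<phi>. 0 \<partial>Q)"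
    proof (rule expectation_LIMSEQ[OF sq sqK])
      fix \<phi> assume "\<phi> \<in> configs \<rho>"
      then have "(\<lambda>k. (F k \<phi> - f \<phi>)\<^sup>2) \<longlonglongrightarrow> (f \<phi> - f \<phi>)\<^sup>2" by (intro tendsto_intros K')
      then show "(\<lambda>k. (F k \<phi> - f \<phi>)\<^sup>2) \<longlonglongrightarrow> 0" by simp
    qed
    then have "(\<lambda>k. sqrt (\<integral>\<phi>. (F k \<phi> - f \<phi>)\<^sup>2 \<partial>Q) * W) \<longlonglongrightarrow> sqrt 0 * W"
      by (intro tendsto_intros) simp
    then have z: "(\<lambda>k. sqrt (\<integral>\<phi>. (F k \<phi> - f \<phi>)\<^sup>2 \<partial>Q) * W) \<longlonglongrightarrow> 0" by simp
    have "L (\<lambda>\<phi>. F k \<phi> - f \<phi>) = L (F k) - L f" for k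
    proof -
      have "L (\<lambda>\<phi>. F k \<phi> - f \<phi>) = (\<Sum>j. coef (I j) (F k) / fact j - coef (I j) f / fact j)"
        unfolding L_def by (simp add: coef_diff[OF F1 fb I(1)] diff_divide_distrib)
      also have "\<dots> = L (F k) - L f"
        unfolding L_def by (intro suminf_diff[symmetric] coef_sum_bound(2) F1 fb I)
      finally show ?thesis .
    qed
    then have "norm (L (F k) - L f) \<le> sqrt (\<integral>\<phi>. (F k \<phi> - f \<phi>)\<^sup>2 \<partial>Q) * W" for k
      using coef_sum_bound(3)[OF G1 I, of k] unfolding L_def W_def by simp
    then have "(\<lambda>k. L (F k) - L f) \<longlonglongrightarrow> 0"
      by (intro Lim_null_comparison[OF _ z]) auto
    then have 1: "(\<lambda>k. L (F k)) \<longlonglongrightarrow> L f" by (simp add: LIM_zero_iff)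
    have "L (F k) = (\<integral>\<phi>. F k \<phi> \<partial>Q')" for k
      unfolding L_def using F sums_unique by metis
    moreover have "(\<lambda>k. \<integral>\<phi>. F k \<phi> \<partial>Q') \<longlonglongrightarrow> (\<integral>\<phi>. f \<phi> \<partial>Q')"
      by (rule N.expectation_LIMSEQ) (use F1 K' in \<open>auto simp: bm cf\<close>)
    ultimately have "L f = (\<integral>\<phi>. f \<phi> \<partial>Q')" using 1 by (auto intro: LIMSEQ_unique)
    then show "?P f"
      using fb summable_sums[OF coef_sum_bound(2)[OF fb I]] unfolding L_def by simp
  qed
  then show ?thesis by simp
qed

end

subsection \<open>Inverting the expansion\<close>

lemma PiM_density:
  fixes t :: "'b \<Rightarrow> ennreal"
  assumes M: "sigma_finite_measure M" "sigma_finite_measure (density M t)"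
    and t[measurable]: "t \<in> borel_measurable M" and I: "finite I"
  shows "PiM I (\<lambda>_. density M t) = density (PiM I (\<lambda>_. M)) (\<lambda>x. \<Prod>j\<in>I. t (x j))"
proof -
  interpret product_sigma_finite "\<lambda>_. M" by (rule product_sigma_finite_const[OF M(1)])
  interpret D: product_sigma_finite "\<lambda>_. density M t" by (rule product_sigma_finite_const[OF M(2)])
  have "density (PiM I (\<lambda>_. M)) (\<lambda>x. \<Prod>j\<in>I. t (x j)) = PiM I (\<lambda>_. density M t)"
  proof (rule D.PiM_eqI[OF I])
    show "sets (density (PiM I (\<lambda>_. M)) (\<lambda>x. \<Prod>j\<in>I. t (x j))) = sets (PiM I (\<lambda>_. density M t))"
      by (simp cong: sets_PiM_cong)
    fix A assume "\<And>i. i \<in> I \<Longrightarrow> A i \<in> sets (density M t)"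
    then have A[measurable]: "\<And>i. i \<in> I \<Longrightarrow> A i \<in> sets M" by simp
    have "emeasure (density (PiM I (\<lambda>_. M)) (\<lambda>x. \<Prod>j\<in>I. t (x j))) (Pi\<^sub>E I A)
        = (\<integral>\<^sup>+x. (\<Prod>j\<in>I. t (x j)) * indicator (Pi\<^sub>E I A) x \<partial>PiM I (\<lambda>_. M))"
      using I A by (intro emeasure_density) (auto intro!: sets_PiM_I_finite)
    also have "\<dots> = (\<integral>\<^sup>+x. (\<Prod>j\<in>I. t (x j) * indicator (A j) (x j)) \<partial>PiM I (\<lambda>_. M))"
    proof (rule nn_integral_cong)
      fix x assume x: "x \<in> space (PiM I (\<lambda>_. M))"
      have "indicator (Pi\<^sub>E I A) x = (\<Prod>j\<in>I. indicator (A j) (x j) :: ennreal)"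
        using x I by (auto simp: indicator_def space_PiM PiE_def Pi_def extensional_def)
      then show "(\<Prod>j\<in>I. t (x j)) * indicator (Pi\<^sub>E I A) x = (\<Prod>j\<in>I. t (x j) * indicator (A j) (x j))"
        by (simp add: prod.distrib)
    qed
    also have "\<dots> = (\<Prod>j\<in>I. \<integral>\<^sup>+x. t x * indicator (A j) x \<partial>M)"
      by (rule product_nn_integral_prod[OF I]) measurable
    also have "\<dots> = (\<Prod>j\<in>I. emeasure (density M t) (A j))"
      by (intro prod.cong refl emeasure_density[symmetric]) auto
    finally show "emeasure (density (PiM I (\<lambda>_. M)) (\<lambda>x. \<Prod>j\<in>I. t (x j))) (Pi\<^sub>E I A)
        = (\<Prod>j\<in>I. emeasure (density M t) (A j))" .
  qed
  then show ?thesis ..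
qed

lemma integral_PiM_density:
  fixes t :: "'b \<Rightarrow> real" and f :: "('i \<Rightarrow> 'b) \<Rightarrow> real"
  assumes M: "sigma_finite_measure M" "sigma_finite_measure N" and N: "N = density M (\<lambda>x. ennreal (t x))"
    and t[measurable]: "t \<in> borel_measurable M" "\<And>x. 0 \<le> t x" and I: "finite I"
    and f[measurable]: "f \<in> borel_measurable (PiM I (\<lambda>_. M))"
  shows "integrable (PiM I (\<lambda>_. N)) f \<longleftrightarrow> integrable (PiM I (\<lambda>_. M)) (\<lambda>x. f x * (\<Prod>j\<in>I. t (x j)))"
    and "(\<integral>x. f x \<partial>PiM I (\<lambda>_. N)) = (\<integral>x. f x * (\<Prod>j\<in>I. t (x j)) \<partial>PiM I (\<lambda>_. M))"
proof -
  have eq: "PiM I (\<lambda>_. N) = density (PiM I (\<lambda>_. M)) (\<lambda>x. ennreal (\<Prod>j\<in>I. t (x j)))"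
    unfolding N using PiM_density[OF M(1) M(2)[unfolded N] _ I] by (simp add: prod_ennreal t(2))
  have [measurable]: "(\<lambda>x. \<Prod>j\<in>I. t (x j)) \<in> borel_measurable (PiM I (\<lambda>_. M))" by measurable
  have nn: "AE x in PiM I (\<lambda>_. M). 0 \<le> (\<Prod>j\<in>I. t (x j))" by (simp add: prod_nonneg t(2))
  show "integrable (PiM I (\<lambda>_. N)) f \<longleftrightarrow> integrable (PiM I (\<lambda>_. M)) (\<lambda>x. f x * (\<Prod>j\<in>I. t (x j)))"
    unfolding eq by (subst integrable_density[OF f _ nn]) (auto simp: mult.commute)
  show "(\<integral>x. f x \<partial>PiM I (\<lambda>_. N)) = (\<integral>x. f x * (\<Prod>j\<in>I. t (x j)) \<partial>PiM I (\<lambda>_. M))"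
    unfolding eq by (subst integral_density[OF f _ nn]) (auto simp: mult.commute)
qed

text \<open>The exceptional set of one coordinate sits in a box with a null side. Its measure is a
  product with a factor 0, hence 0 even if the other sides have infinite measure.\<close>

lemma AE_PiM_all:
  assumes M: "sigma_finite_measure M" and I: "finite I" and P: "AE x in M. P x"
  shows "AE x in PiM I (\<lambda>_. M). \<forall>j\<in>I. P (x j)"
proof (rule AE_finite_allI[OF I])
  fix i assume i: "i \<in> I"
  interpret product_sigma_finite "\<lambda>_. M" by (rule product_sigma_finite_const[OF M])
  obtain N where N: "{x \<in> space M. \<not> P x} \<subseteq> N" "N \<in> null_sets M" using P unfolding eventually_ae_filter by auto
  let ?A = "\<lambda>j. if j = i then N else space M"
  have A: "\<And>j. j \<in> I \<Longrightarrow> ?A j \<in> sets M" using N by auto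
  have "emeasure (PiM I (\<lambda>_. M)) (Pi\<^sub>E I ?A) = (\<Prod>j\<in>I. emeasure M (?A j))"
    using A by (intro emeasure_PiM I) auto
  also have "\<dots> = 0" using I i N by (intro prod_zero) (auto intro!: bexI[of _ i])
  finally have "Pi\<^sub>E I ?A \<in> null_sets (PiM I (\<lambda>_. M))"
    using I A by (auto simp: null_sets_def intro!: sets_PiM_I_finite)
  then show "AE x in PiM I (\<lambda>_. M). P (x i)"
    by (rule AE_I') (use N(1) i in \<open>auto simp: space_PiM PiE_def Pi_def\<close>)
qed

text \<open>Fubini plus the triangle inequality: integrating out some coordinates does not increase
  the L^1 norm. This carries bounds on the (n + k)-point kernels over to their n-point
  marginals.\<close>

lemma (in product_sigma_finite) integrable_fold:
  fixes f :: "_ \<Rightarrow> real"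
  assumes IJ: "I \<inter> J = {}" "finite I" "finite J" and f: "integrable (PiM (I \<union> J) M) f"
  shows "integrable (PiM I M) (\<lambda>x. \<integral>y. f (merge I J (x, y)) \<partial>PiM J M)"
    and "(\<integral>x. \<bar>\<integral>y. f (merge I J (x, y)) \<partial>PiM J M\<bar> \<partial>PiM I M) \<le> (\<integral>x. \<bar>f x\<bar> \<partial>PiM (I \<union> J) M)"
proof -
  interpret I: finite_product_sigma_finite M I by standard fact
  interpret J: finite_product_sigma_finite M J by standard fact
  interpret P: pair_sigma_finite "PiM I M" "PiM J M" ..
  have *: "integrable (PiM I M) (\<lambda>x. \<integral>y. g (merge I J (x, y)) \<partial>PiM J M)"
    if g: "integrable (PiM (I \<union> J) M) g" for g :: "_ \<Rightarrow> real"
  proof -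
    have "integrable (distr (PiM I M \<Otimes>\<^sub>M PiM J M) (PiM (I \<union> J) M) (merge I J)) g"
      using g by (simp add: distr_merge[OF IJ])
    then have "integrable (PiM I M \<Otimes>\<^sub>M PiM J M) (\<lambda>z. g (merge I J z))"
      using g by (subst (asm) integrable_distr_eq) (auto intro: measurable_merge)
    from P.integrable_fst'[OF this] show ?thesis by simp
  qed
  show "integrable (PiM I M) (\<lambda>x. \<integral>y. f (merge I J (x, y)) \<partial>PiM J M)" by (rule *[OF f])
  then have "(\<integral>x. \<bar>\<integral>y. f (merge I J (x, y)) \<partial>PiM J M\<bar> \<partial>PiM I M)
      \<le> (\<integral>x. (\<integral>y. \<bar>f (merge I J (x, y))\<bar> \<partial>PiM J M) \<partial>PiM I M)"
    by (intro integral_mono[OF integrable_abs *[OF integrable_abs[OF f]]] integral_abs_bound)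
  also have "\<dots> = (\<integral>x. \<bar>f x\<bar> \<partial>PiM (I \<union> J) M)"
    by (rule product_integral_fold[OF IJ integrable_abs[OF f], symmetric])
  finally show "(\<integral>x. \<bar>\<integral>y. f (merge I J (x, y)) \<partial>PiM J M\<bar> \<partial>PiM I M) \<le> (\<integral>x. \<bar>f x\<bar> \<partial>PiM (I \<union> J) M)" .
qed

lemma inverse_fact_prod: "1 / (fact n * fact k :: real) = real ((n + k) choose k) / fact (n + k)"
  by (simp add: binomial_fact field_simps)

lemma inverse_fact_prod_le: "1 / (fact n * fact k :: real) \<le> 2 ^ (n + k) / fact (n + k)"
proof -
  have "real ((n + k) choose k) \<le> 2 ^ (n + k)"
    using binomial_le_pow2[of "n + k" k] by (metis of_nat_le_iff of_nat_numeral of_nat_power)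
  then show ?thesis unfolding inverse_fact_prod by (intro divide_right_mono) auto
qed

text \<open>Along the diagonal n + k = N the terms are \<open>b N / fact N\<close> times signed
  binomial coefficients, with sum (1 - 1)^N and absolute sum 2^N. The hypothesis \<open>b\<close>
  thus gives absolute summability, and rearranging leaves only N = 0.\<close>

lemma double_series_collapse:
  fixes b r :: "nat \<Rightarrow> real"
  assumes b: "summable (\<lambda>N. 2 ^ N * \<bar>b N\<bar> / fact N)"
    and rows: "\<And>n. (\<lambda>k. (- 1) ^ k * b (n + k) / (fact n * fact k)) sums r n"
  shows "r sums b 0"
proof -
  have ucont: "uniformly_continuous_on UNIV (\<lambda>(x::real, y). x + y)"
    using isUCont_plus by (simp add: case_prod_beta')
  define w where "w N = 2 ^ N * \<bar>b N\<bar> / fact N" for N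
  define g where "g = (\<lambda>(N, k). (- 1) ^ k * b N / (fact (N - k) * fact k))"
  have g: "g (N, k) = b N / fact N * ((- 1) ^ k * real (N choose k))" if "k \<le> N" for N k
    using inverse_fact_prod[of "N - k" k] that by (simp add: g_def field_simps)
  have norm_rows: "((\<lambda>k. norm (g (N, k))) has_sum w N) {..N}" for N
  proof (rule has_sum_finiteI)
    have "(\<Sum>k\<le>N. norm (g (N, k))) = (\<Sum>k\<le>N. \<bar>b N\<bar> / fact N * real (N choose k))"
      by (intro sum.cong refl) (simp add: g abs_mult power_abs)
    also have "\<dots> = \<bar>b N\<bar> / fact N * real (\<Sum>k\<le>N. N choose k)" by (simp add: sum_distrib_left)
    also have "\<dots> = w N" by (simp only: choose_row_sum) (simp add: w_def)
    finally show "w N = (\<Sum>k\<le>N. norm (g (N, k)))" ..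
  qed simp
  have sg: "(\<lambda>p. norm (g p)) summable_on (SIGMA N:UNIV. {..N})"
    unfolding Infinite_Sum.abs_summable_on_Sigma_iff
  proof (intro conjI ballI)
    have "(\<lambda>N. infsum (\<lambda>k. norm (g (N, k))) {..N}) = w"
      using infsumI[OF norm_rows] by auto
    moreover have "w summable_on UNIV"
      using b by (intro summable_nonneg_imp_summable_on) (auto simp: w_def[abs_def])
    moreover have "norm (w N) = w N" for N by (simp add: w_def)
    ultimately show "(\<lambda>N. norm (infsum (\<lambda>k. norm (g (N, k))) {..N})) summable_on UNIV" by simp
  qed simp
  obtain S where S: "(g has_sum S) (SIGMA N:UNIV. {..N})"
    using Infinite_Sum.abs_summable_summable[OF sg] by (auto simp: summable_on_def)
  have "((\<lambda>k. g (N, k)) has_sum (if N = 0 then b 0 else 0)) {..N}" for N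
  proof (rule has_sum_finiteI)
    have "(\<Sum>k\<le>N. g (N, k)) = b N / fact N * (\<Sum>k\<le>N. (- 1) ^ k * real (N choose k))"
      by (simp add: sum_distrib_left g)
    then show "(if N = 0 then b 0 else 0) = (\<Sum>k\<le>N. g (N, k))"
      using choose_alternating_sum[of N, where 'a=real] by (cases "N = 0") auto
  qed simp
  then have "((\<lambda>N::nat. if N = 0 then b 0 else 0) has_sum S) UNIV"
    by (intro has_sum_Sigma[OF ucont S])
  moreover have "((\<lambda>N::nat. if N = 0 then b 0 else 0) has_sum b 0) UNIV"
  proof (rule norm_summable_imp_has_sum)
    show "summable (\<lambda>N::nat. norm (if N = 0 then b 0 else 0))" by (rule summable_finite[of "{0}"]) auto
  qed (use sums_single[of 0 "\<lambda>_. b 0"] in simp)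
  ultimately have Sb: "S = b 0" by (rule has_sum_unique)
  \<comment> \<open>Back from diagonals to rows: (n, k) corresponds to (n + k, k), so the sum S
    found diagonally is also the sum of the row sums.\<close>
  have "bij_betw (\<lambda>(n, k). (n + k, k :: nat)) (UNIV \<times> UNIV) (SIGMA N:UNIV. {..N})"
    by (rule bij_betwI[where g="\<lambda>(N, k). (N - k, k)"]) auto
  from has_sum_reindex_bij_betw[OF this, of g "b 0"] S Sb
  have "((\<lambda>p. g (case p of (n, k) \<Rightarrow> (n + k, k))) has_sum b 0) (UNIV \<times> UNIV)" by simp
  then have "(r has_sum b 0) UNIV"
  proof (rule has_sum_Sigma[OF ucont])
    fix n :: nat
    have "summable (\<lambda>k. norm ((- 1) ^ k * b (n + k) / (fact n * fact k)))"
    proof (rule summable_comparison_test')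
      show "summable (\<lambda>k. w (k + n))"
        using summable_ignore_initial_segment[OF b, of n] by (simp add: w_def)
      show "norm (norm ((- 1) ^ k * b (n + k) / (fact n * fact k))) \<le> w (k + n)" for k
        using mult_right_mono[OF inverse_fact_prod_le[of n k], of "\<bar>b (n + k)\<bar>"]
        by (simp add: w_def abs_mult power_abs add.commute)
    qed
    from norm_summable_imp_has_sum[OF this rows]
    show "((\<lambda>k. g (case (n, k) of (n, k) \<Rightarrow> (n + k, k))) has_sum r n) UNIV" by (simp add: g_def)
  qed
  then show ?thesis by (rule has_sum_imp_sums)
qed

context poisson_perturbation
begin

text \<open>Freezing the points in I first leaves a bounded function \<open>diff_on I x f\<close>,
  to which the expansion around the base measure applies with the remaining points in J as
  variables.\<close>

lemma mean_diff_merge: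
  assumes IJ: "I \<inter> J = {}" "finite I" "finite J"
  shows "mean_diff Q (I \<union> J) f (merge I J (x, y)) = mean_diff Q J (diff_on I x f) y"
proof -
  have "diff_on I (merge I J (x, y)) f = diff_on I x f"
    by (rule ext, rule diff_on_cong) (simp add: merge_def)
  moreover have "diff_on J (merge I J (x, y)) h = diff_on J y h" for h
    by (rule ext, rule diff_on_cong) (use IJ in \<open>auto simp: merge_def\<close>)
  moreover have "diff_on (I \<union> J) z f = diff_on J z (diff_on I z f)" for z
    by (rule ext, rule diff_on_Un[OF IJ])
  ultimately show ?thesis unfolding mean_diff_def by simp
qed

text \<open>Expanding every coefficient \<open>E\<^sub>\<nu> D\<^sup>n f\<close> around \<open>\<rho>\<close> turns the series into an absolutely convergent double
  series whose diagonals carry the factor \<open>(1 - 1)\<^sup>N\<close>, so only \<open>E\<^sub>\<rho> f\<close> survives.\<close>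

theorem reverse_expansion:
  assumes f: "f \<in> bdd_measurable \<rho>"
  defines "F \<equiv> \<lambda>n x. mean_diff Q' {1..n} f x * (\<Prod>j\<in>{1..n}. - a (x j))"
  shows "integrable (pow {1..n}) (F n)"
    and "(\<lambda>n. (\<integral>x. F n x \<partial>pow {1..n}) / fact n) sums (\<integral>\<phi>. f \<phi> \<partial>Q)"
proof -
  define G where "G N z = mean_diff Q {1..N} f z * (\<Prod>j\<in>{1..N}. - a (z j))" for N :: nat and z
  define b where "b N = (\<integral>z. G N z \<partial>pow {1..N})" for N
  define E where "E = (\<integral>\<phi>. (f \<phi>)\<^sup>2 \<partial>Q)"
  define C where "C N = sqrt (fact N * E * sqn ^ N)" for N
  have E: "0 \<le> E" by (simp add: E_def)
  have prod_neg: "(\<Prod>j\<in>J. - a (z j)) = (- 1) ^ card J * (\<Prod>j\<in>J. a (z j))" for J :: "nat set" and z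
    by (subst prod_uminus) simp
  have G_alt: "G N z = (- 1) ^ N * (mean_diff Q {1..N} f z * (\<Prod>j\<in>{1..N}. a (z j)))" for N z
    unfolding G_def prod_neg by simp
  have intG: "integrable (pow {1..N}) (G N)" for N
    unfolding G_alt[abs_def] by (intro integrable_mult_right coefficient_bounds(2) f) simp
  have absG: "(\<integral>z. \<bar>G N z\<bar> \<partial>pow {1..N}) \<le> C N" for N
  proof -
    have "ennreal (\<integral>z. \<bar>G N z\<bar> \<partial>pow {1..N}) = (\<integral>\<^sup>+z. ennreal \<bar>G N z\<bar> \<partial>pow {1..N})"
      by (rule nn_integral_eq_integral[symmetric]) (use intG in auto)
    also have "\<dots> \<le> ennreal (C N)"
      using coefficient_bounds(1)[OF f, of "{1..N}"] by (simp add: G_alt abs_mult power_abs C_def E_def)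
    finally show ?thesis using E sqn(2) by (simp add: C_def ennreal_le_iff)
  qed
  have bC: "\<bar>b N\<bar> \<le> C N" for N
    unfolding b_def using integral_abs_bound[of "pow {1..N}" "G N"] absG[of N] by linarith
  have C_nonneg: "0 \<le> C N" for N using bC[of N] by linarith
  define w where "w N = 2 ^ N * C N / fact N" for N
  have sw: "summable w"
  proof -
    \<comment> \<open>The factor 2^N enters the root as 4^N, so the series stays of the type of
      \<open>summable_sqrt_exp_series\<close>.\<close>
    have "w N = sqrt E * sqrt ((4 * sqn) ^ N / fact N)" for N
    proof -
      have "sqrt (fact N) / fact N = 1 / sqrt (fact N)" by (simp add: real_div_sqrt field_simps)
      moreover have "(2::real) ^ N = sqrt (4 ^ N)"
        by (metis real_sqrt_four real_sqrt_power)
      moreover have "w N = 2 ^ N * sqrt E * sqrt (sqn ^ N) * (sqrt (fact N) / fact N)"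
        by (simp add: w_def C_def real_sqrt_mult)
      ultimately show ?thesis
        by (simp add: real_sqrt_mult real_sqrt_divide power_mult_distrib)
    qed
    then have "w = (\<lambda>N. sqrt E * sqrt ((4 * sqn) ^ N / fact N))" by (rule ext)
    then show ?thesis
      using summable_mult[OF summable_sqrt_exp_series[of "4 * sqn"], of "sqrt E"] sqn(2) by (simp only:)
  qed
  have row: "integrable (pow {1..n}) (F n) \<and>
      (\<lambda>k. (- 1) ^ k * b (n + k) / fact k) sums (\<integral>x. F n x \<partial>pow {1..n})" for n
  proof -
    let ?I = "{1..n}" and ?J = "\<lambda>k. {n+1..n+k}"
    let ?M = "pow ?I"
    have IJ: "?I \<inter> ?J k = {}" "finite ?I" "finite (?J k)" and U: "?I \<union> ?J k = {1..n+k}" for k by auto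
    \<comment> \<open>This is the k-th term in the expansion of \<open>F n x\<close> around the base
      measure, written as a marginal of the (n + k)-point kernel. \<open>G\<close> carries - a in
      all variables whereas the expansion needs a in the last k of them; the prefactor (- 1)^k
      repairs the sign.\<close>
    define H where "H k x = (- 1) ^ k / fact k * (\<integral>y. G (n + k) (merge ?I (?J k) (x, y)) \<partial>pow (?J k))" for k x
    have H: "H k x = coef (?J k) (diff_on ?I x f) / fact k * (\<Prod>j\<in>?I. - a (x j))" for k x
    proof -
      have "G (n + k) (merge ?I (?J k) (x, y))
          = (- 1) ^ k * (\<Prod>j\<in>?I. - a (x j)) * (mean_diff Q (?J k) (diff_on ?I x f) y * (\<Prod>j\<in>?J k. a (y j)))" for y
      proof -
        let ?z = "merge ?I (?J k) (x, y)"
        have "(\<Prod>j\<in>{1..n+k}. - a (?z j)) = (\<Prod>j\<in>?I. - a (?z j)) * (\<Prod>j\<in>?J k. - a (?z j))"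
          unfolding U[symmetric] by (rule prod.union_disjoint) (use IJ in auto)
        also have "(\<Prod>j\<in>?I. - a (?z j)) = (\<Prod>j\<in>?I. - a (x j))"
          by (intro prod.cong refl) (simp add: merge_def)
        also have "(\<Prod>j\<in>?J k. - a (?z j)) = (\<Prod>j\<in>?J k. - a (y j))"
          by (intro prod.cong refl) (simp add: merge_def)
        also have "(\<Prod>j\<in>?J k. - a (y j)) = (- 1) ^ k * (\<Prod>j\<in>?J k. a (y j))"
          by (subst prod_neg) simp
        finally have "(\<Prod>j\<in>{1..n+k}. - a (?z j)) = (\<Prod>j\<in>?I. - a (x j)) * ((- 1) ^ k * (\<Prod>j\<in>?J k. a (y j)))" .
        moreover have "mean_diff Q {1..n+k} f ?z = mean_diff Q (?J k) (diff_on ?I x f) y"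
          using mean_diff_merge[OF IJ(1)[of k] IJ(2) IJ(3)[of k], of f x y] by (simp only: U)
        ultimately show ?thesis unfolding G_def by (simp only: mult_ac)
      qed
      then have "(\<integral>y. G (n + k) (merge ?I (?J k) (x, y)) \<partial>pow (?J k))
          = (- 1) ^ k * (\<Prod>j\<in>?I. - a (x j)) * coef (?J k) (diff_on ?I x f)"
        by (simp only: coef_def Bochner_Integration.integral_mult_right_zero)
      then show ?thesis unfolding H_def by (simp add: power_mult_distrib[symmetric])
    qed
    have g: "diff_on ?I x f \<in> bdd_measurable \<rho>" if "x \<in> space ?M" for x
      by (rule diff_on_bdd_measurable[OF _ f that]) simp
    have J: "finite (?J k)" "card (?J k) = k" for k by auto
    have intH: "integrable ?M (H k)" for k
      unfolding H_def[abs_def]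
      by (intro integrable_mult_right integrable_fold(1)[OF IJ]) (simp only: U intG)
    have HF: "(\<lambda>k. H k x) sums F n x" if "x \<in> space ?M" for x
      unfolding H F_def mean_diff_def by (intro sums_mult2 expansion g that J)
    have 1: "AE x in ?M. summable (\<lambda>k. norm (H k x))"
      by (rule AE_I2) (simp only: H norm_mult, intro summable_mult2 coef_sum_bound(1) g J)
    \<comment> \<open>Summable L^1 norms allow the series to be integrated termwise. The factor
      \<open>1 / fact k\<close> is turned into \<open>fact n\<close> times
      \<open>1 / (fact n * fact k)\<close>, at most
      \<open>fact n * 2 ^ (n + k) / fact (n + k)\<close>, so a tail of \<open>w\<close>
      dominates.\<close>
    have 2: "summable (\<lambda>k. \<integral>x. norm (H k x) \<partial>?M)"
    proof (rule summable_comparison_test')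
      show "summable (\<lambda>k. fact n * w (k + n))"
        by (intro summable_mult summable_ignore_initial_segment sw)
      fix k :: nat
      have "(\<integral>x. \<bar>\<integral>y. G (n + k) (merge ?I (?J k) (x, y)) \<partial>pow (?J k)\<bar> \<partial>?M) \<le> C (n + k)"
        by (rule order_trans[OF integrable_fold(2)[OF IJ(1)[of k] IJ(2) IJ(3)[of k], of "G (n + k)", unfolded U, OF intG] absG])
      then have "(\<integral>x. norm (H k x) \<partial>?M) \<le> 1 / fact k * C (n + k)"
        unfolding H_def by (simp add: abs_mult power_abs divide_right_mono)
      also have "\<dots> = fact n * (1 / (fact n * fact k) * C (n + k))" by simp
      also have "\<dots> \<le> fact n * (2 ^ (n + k) / fact (n + k) * C (n + k))"
        by (intro mult_left_mono mult_right_mono inverse_fact_prod_le C_nonneg) simp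
      also have "\<dots> = fact n * w (k + n)" by (simp add: w_def add.commute)
      finally show "norm (\<integral>x. norm (H k x) \<partial>?M) \<le> fact n * w (k + n)" by simp
    qed
    have eqF: "(\<Sum>k. H k x) = F n x" if "x \<in> space ?M" for x
      using sums_unique[OF HF[OF that]] by simp
    have "integrable ?M (\<lambda>x. \<Sum>k. H k x)" by (rule integrable_suminf[OF intH 1 2])
    also have "?this \<longleftrightarrow> integrable ?M (F n)"
      by (intro Bochner_Integration.integrable_cong refl eqF)
    finally have "integrable ?M (F n)" .
    moreover have "(\<lambda>k. \<integral>x. H k x \<partial>?M) sums (\<integral>x. (\<Sum>k. H k x) \<partial>?M)"
      by (rule sums_integral[OF intH 1 2])
    moreover have "(\<integral>x. (\<Sum>k. H k x) \<partial>?M) = (\<integral>x. F n x \<partial>?M)"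
      by (intro Bochner_Integration.integral_cong refl eqF)
    moreover have "(\<integral>x. H k x \<partial>?M) = (- 1) ^ k * b (n + k) / fact k" for k
    proof -
      have "b (n + k) = (\<integral>x. (\<integral>y. G (n + k) (merge ?I (?J k) (x, y)) \<partial>pow (?J k)) \<partial>?M)"
        unfolding b_def using product_integral_fold[OF IJ(1)[of k] IJ(2) IJ(3)[of k], of "G (n + k)"] intG[of "n + k"] by (simp only: U)
      then show ?thesis unfolding H_def by simp
    qed
    ultimately show ?thesis by simp
  qed
  then show "integrable (pow {1..n}) (F n)" by blast
  have "(\<lambda>n. (\<integral>x. F n x \<partial>pow {1..n}) / fact n) sums b 0"
  proof (rule double_series_collapse)
    show "summable (\<lambda>N. 2 ^ N * \<bar>b N\<bar> / fact N)"
    proof (rule summable_comparison_test'[OF sw])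
      show "norm (2 ^ N * \<bar>b N\<bar> / fact N) \<le> w N" for N
        using bC[of N] by (simp add: w_def divide_right_mono)
    qed
    show "(\<lambda>k. (- 1) ^ k * b (n + k) / (fact n * fact k)) sums ((\<integral>x. F n x \<partial>pow {1..n}) / fact n)" for n
      using sums_divide[OF conjunct2[OF row[of n]], of "fact n"] by (simp add: mult.commute)
  qed
  \<comment> \<open>For N = 0 the integral is over a one-point space, with an empty product and no
    difference taken.\<close>
  also have "b 0 = (\<integral>\<phi>. f \<phi> \<partial>Q)"
    by (simp add: b_def G_def mean_diff_def PiM_empty lebesgue_integral_count_space_finite)
  finally show "(\<lambda>n. (\<integral>x. F n x \<partial>pow {1..n}) / fact n) sums (\<integral>\<phi>. f \<phi> \<partial>Q)" .
qed

end

subsection \<open>Failure of integrability\<close>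

text \<open>Simple functions increasing to t, cut off to an exhaustion by sets of finite measure,
  have integrals against t that increase to the integral of t^2, which is infinite.\<close>

lemma test_fun_below:
  fixes t :: "'a \<Rightarrow> real"
  assumes \<tau>: "sigma_finite_measure \<tau>" and t[measurable]: "t \<in> borel_measurable \<tau>"
    and t01: "\<And>x. 0 \<le> t x" "\<And>x. t x \<le> 1"
    and inf: "(\<integral>\<^sup>+x. ennreal ((t x)\<^sup>2) \<partial>\<tau>) = \<infinity>"
  shows "\<exists>s\<in>test_funs \<tau>. (\<forall>x\<in>space \<tau>. s x \<le> t x) \<and> m \<le> (\<integral>x. s x * t x \<partial>\<tau>)"
proof -
  interpret sigma_finite_measure \<tau> by fact
  obtain D :: "nat \<Rightarrow> _" where D: "range D \<subseteq> sets \<tau>" "(\<Union>i. D i) = space \<tau>" "\<And>i. emeasure \<tau> (D i) \<noteq> \<infinity>" "incseq D"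
    using sigma_finite_incseq by blast
  have [measurable]: "D i \<in> sets \<tau>" for i using D(1) by auto
  obtain r where r: "\<And>i x. 0 \<le> r i x" "\<And>i. simple_function \<tau> (r i)" "incseq r"
      and bdd: "\<And>x. bdd_above (range (\<lambda>i. r i x))" and tr: "t = (SUP i. r i)"
    using borel_measurable_implies_simple_function_sequence_real[OF t t01(1)] by blast
  have r_lim: "(\<lambda>i. r i x) \<longlonglongrightarrow> t x" for x
  proof -
    have "t x = (SUP i. r i x)" unfolding tr by (simp add: Sup_fun_def image_image)
    then show ?thesis
      using LIMSEQ_incseq_SUP[OF bdd[of x]] r(3) by (simp add: incseq_def le_fun_def)
  qed
  have [measurable]: "r i \<in> borel_measurable \<tau>" for i using r(2) by (rule borel_measurable_simple_function)
  have r_le: "r i x \<le> t x" for i x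
    by (rule LIMSEQ_le_const[OF r_lim]) (use r(3) in \<open>auto simp: incseq_def le_fun_def\<close>)
  define s where "s i x = r i x * indicator (D i) x" for i x
  have s_test: "s i \<in> test_funs \<tau>" for i
  proof -
    have "simple_function \<tau> (s i)" unfolding s_def by (intro simple_function_mult r(2)) auto
    moreover have "emeasure \<tau> {x\<in>space \<tau>. s i x \<noteq> 0} \<le> emeasure \<tau> (D i)"
      by (intro emeasure_mono) (auto simp: s_def indicator_def)
    ultimately show ?thesis using D(3)[of i] r(1)
      by (auto simp: test_funs_def s_def less_top[symmetric] top_unique)
  qed
  have inc: "incseq (\<lambda>i x. ennreal (s i x * t x))"
  proof (intro incseq_SucI le_funI ennreal_leI mult_right_mono t01)
    fix i x
    have "r i x \<le> r (Suc i) x" using r(3) by (auto simp: incseq_def le_fun_def)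
    moreover have "D i \<subseteq> D (Suc i)" using D(4) by (auto simp: incseq_def)
    ultimately show "s i x \<le> s (Suc i) x" using r(1) by (auto simp: s_def indicator_def)
  qed
  have sup: "(SUP i. ennreal (s i x * t x)) = ennreal ((t x)\<^sup>2)" if x: "x \<in> space \<tau>" for x
  proof (rule LIMSEQ_unique)
    show "(\<lambda>i. ennreal (s i x * t x)) \<longlonglongrightarrow> (SUP i. ennreal (s i x * t x))"
      using inc by (intro LIMSEQ_SUP) (auto simp: incseq_def le_fun_def)
    have "(\<lambda>i. indicator (D i) x) \<longlonglongrightarrow> (indicator (\<Union>i. D i) x :: real)"
      by (rule LIMSEQ_indicator_incseq[OF D(4)])
    then have "(\<lambda>i. s i x * t x) \<longlonglongrightarrow> t x * indicator (space \<tau>) x * t x"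
      unfolding s_def D(2) by (intro tendsto_intros r_lim)
    then show "(\<lambda>i. ennreal (s i x * t x)) \<longlonglongrightarrow> ennreal ((t x)\<^sup>2)"
      using x by (intro tendsto_ennrealI) (simp add: power2_eq_square)
  qed
  have [measurable]: "s i \<in> borel_measurable \<tau>" for i by (rule test_funsD(2)[OF s_test])
  have "(SUP i. \<integral>\<^sup>+x. ennreal (s i x * t x) \<partial>\<tau>) = (\<integral>\<^sup>+x. (SUP i. ennreal (s i x * t x)) \<partial>\<tau>)"
    by (rule nn_integral_monotone_convergence_SUP[OF inc, symmetric]) measurable
  also have "\<dots> = \<infinity>"
    unfolding inf[symmetric] by (intro nn_integral_cong sup)
  finally have top: "(SUP i. \<integral>\<^sup>+x. ennreal (s i x * t x) \<partial>\<tau>) = \<infinity>" .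
  have "ennreal m < (SUP i. \<integral>\<^sup>+x. ennreal (s i x * t x) \<partial>\<tau>)" unfolding top by simp
  then obtain i where i: "ennreal m < (\<integral>\<^sup>+x. ennreal (s i x * t x) \<partial>\<tau>)" by (auto simp: less_SUP_iff)
  have "integrable \<tau> (s i)" by (rule test_fun_integral(2)[OF s_test, of "\<lambda>c. c"]) simp
  then have "integrable \<tau> (\<lambda>x. s i x * t x)"
    by (rule Bochner_Integration.integrable_bound) (auto intro!: AE_I2 mult_left_le simp: abs_mult t01)
  then have "ennreal m < ennreal (\<integral>x. s i x * t x \<partial>\<tau>)"
    using i r(1) t01 by (subst (asm) nn_integral_eq_integral) (auto simp: s_def)
  then have "m \<le> (\<integral>x. s i x * t x \<partial>\<tau>)"
    using ennreal_leI[of "\<integral>x. s i x * t x \<partial>\<tau>" m] by (meson leD le_cases)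
  moreover have "s i x \<le> t x" if "x \<in> space \<tau>" for x
    using r_le[of i x] t01(1)[of x] by (auto simp: s_def indicator_def)
  ultimately show ?thesis using s_test by blast
qed

text \<open>By the mean value theorem: for u \<le> 2 the intermediate point stays within
  \<bar>y\<bar> + 2, which bounds the slope from below by a factor depending on y alone.\<close>

lemma arctan_diff_ge:
  fixes y u :: real
  assumes "0 \<le> u" "u \<le> 2"
  shows "u * (1 / (1 + (\<bar>y\<bar> + 2)\<^sup>2)) \<le> arctan (y + u) - arctan y"
proof (cases "u = 0")
  case False
  then obtain \<xi> where \<xi>: "y < \<xi>" "\<xi> < y + u" "arctan (y + u) - arctan y = (y + u - y) * inverse (1 + \<xi>\<^sup>2)"
    using MVT2[of y "y + u" arctan "\<lambda>x. inverse (1 + x\<^sup>2)"] DERIV_arctan assms by auto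
  have "\<bar>\<xi>\<bar> \<le> \<bar>y\<bar> + 2" using \<xi> assms by linarith
  then have "\<xi>\<^sup>2 \<le> (\<bar>y\<bar> + 2)\<^sup>2" by (metis abs_ge_zero power2_abs power_mono)
  then have "1 / (1 + (\<bar>y\<bar> + 2)\<^sup>2) \<le> inverse (1 + \<xi>\<^sup>2)"
    unfolding inverse_eq_divide by (intro divide_left_mono mult_pos_pos) (auto intro: add_pos_nonneg)
  then have "u * (1 / (1 + (\<bar>y\<bar> + 2)\<^sup>2)) \<le> u * inverse (1 + \<xi>\<^sup>2)"
    using assms(1) by (rule mult_left_mono)
  then show ?thesis using \<xi>(3) by simp
qed simp

lemma test_funs_mono:
  assumes "\<sigma> \<le> \<tau>" "sets \<sigma> = sets \<tau>" "u \<in> test_funs \<tau>"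
  shows "u \<in> test_funs \<sigma>"
proof -
  have sp: "space \<sigma> = space \<tau>" using assms(2) by (rule sets_eq_imp_space_eq)
  have "simple_function \<sigma> u"
    using test_funsD(1)[OF assms(3)] simple_function_cong_algebra[OF assms(2) sp] by metis
  moreover have "emeasure \<sigma> {x\<in>space \<tau>. u x \<noteq> 0} \<le> emeasure \<tau> {x\<in>space \<tau>. u x \<noteq> 0}"
    using le_measureD3[OF assms(1,2)] .
  ultimately show ?thesis using assms(3) by (auto simp: test_funs_def sp)
qed

context poisson_process
begin

text \<open>Given \<open>t \<notin> L\<^sup>2(\<tau>)\<close>, choose \<open>s\<^sub>k \<le> t\<close> simple with \<open>m\<^sub>k = \<integral> s\<^sub>k t d\<tau> \<ge> 4\<^sup>k\<close>. The variance of \<open>\<Phi>(s\<^sub>k)/m\<^sub>k\<close> is at most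
  \<open>1/m\<^sub>k\<close>, so the centred sum \<open>Z = \<Sum>\<^sub>k (\<Phi>(s\<^sub>k) - E \<Phi>(s\<^sub>k))/m\<^sub>k\<close> converges almost surely, and adding a point at
  \<open>x\<close> raises it by \<open>u(x) = \<Sum>\<^sub>k s\<^sub>k(x)/m\<^sub>k\<close>, where \<open>\<integral> u t d\<tau> = \<infinity>\<close>. The function \<open>arctan Z\<close> is then bounded,
  but its first difference is bounded below by a multiple of \<open>u\<close>.\<close>

theorem first_difference_not_integrable:
  fixes t :: "'a \<Rightarrow> real"
  assumes \<tau>: "sigma_finite_measure \<tau>" "sets \<rho> = sets \<tau>" "\<rho> \<le> \<tau>"
    and t[measurable]: "t \<in> borel_measurable \<tau>" and t01: "\<And>x. 0 \<le> t x" "\<And>x. t x \<le> 1"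
    and inf: "(\<integral>\<^sup>+x. ennreal ((t x)\<^sup>2) \<partial>\<tau>) = \<infinity>"
  shows "\<exists>f\<in>bdd_measurable \<rho>.
    (\<integral>\<^sup>+x. ennreal \<bar>mean_diff Q {1} f x * t (x 1)\<bar> \<partial>PiM {1} (\<lambda>_. \<tau>)) = \<infinity>"
proof -
  have sp: "space \<rho> = space \<tau>" using \<tau>(2) by (rule sets_eq_imp_space_eq)
  interpret T: product_sigma_finite "\<lambda>_. \<tau>" by (rule product_sigma_finite_const[OF \<tau>(1)])
  have "\<forall>k. \<exists>s. s \<in> test_funs \<tau> \<and> (\<forall>x\<in>space \<tau>. s x \<le> t x) \<and> 4 ^ k \<le> (\<integral>x. s x * t x \<partial>\<tau>)"
    using test_fun_below[OF \<tau>(1) t t01 inf] by blast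
  then obtain s where s: "\<And>k::nat. s k \<in> test_funs \<tau>" and s_le: "\<And>k x. x \<in> space \<tau> \<Longrightarrow> s k x \<le> t x"
    and s4: "\<And>k. 4 ^ k \<le> (\<integral>x. s k x * t x \<partial>\<tau>)" by metis
  have s': "s k \<in> test_funs \<rho>" for k by (rule test_funs_mono[OF \<tau>(3,2) s])
  have s0: "0 \<le> s k x" if "x \<in> space \<tau>" for k x using test_funsD(3)[OF s that] .
  have [measurable]: "s k \<in> borel_measurable \<tau>" for k by (rule test_funsD(2)[OF s])
  define m where "m k = (\<integral>x. s k x * t x \<partial>\<tau>)" for k
  have m4: "4 ^ k \<le> m k" for k using s4 by (simp add: m_def)
  have m0: "0 < m k" for k using m4[of k] by (rule less_le_trans[rotated]) simp
  \<comment> \<open>A non-integrable function has integral 0 by convention, so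
    \<open>m k > 0\<close> already implies integrability.\<close>
  have int_st: "integrable \<tau> (\<lambda>x. s k x * t x)" for k
    using m0[of k] not_integrable_integral_eq[of \<tau> "\<lambda>x. s k x * t x"] by (auto simp: m_def)
  \<comment> \<open>Here \<open>s k \<le> t\<close> and \<open>\<rho> \<le> \<tau>\<close> are used:
    the variance of the k-th functional is at most its own normalising constant
    \<open>m k\<close>.\<close>
  have sq_le: "(\<integral>x. (s k x)\<^sup>2 \<partial>\<rho>) \<le> m k" for k
  proof -
    have "ennreal (\<integral>x. (s k x)\<^sup>2 \<partial>\<rho>) = (\<integral>\<^sup>+x. ennreal ((s k x)\<^sup>2) \<partial>\<rho>)"
      by (rule nn_integral_eq_integral[symmetric]) (auto intro: test_fun_integral(2)[OF s', of "\<lambda>c. c\<^sup>2"])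
    also have "\<dots> \<le> (\<integral>\<^sup>+x. ennreal ((s k x)\<^sup>2) \<partial>\<tau>)"
      using \<tau>(2,3) by (intro nn_integral_mono_measure)
    also have "\<dots> \<le> (\<integral>\<^sup>+x. ennreal (s k x * t x) \<partial>\<tau>)"
      using s0 s_le by (intro nn_integral_mono ennreal_leI) (auto simp: power2_eq_square mult_left_mono)
    also have "\<dots> = ennreal (m k)"
      unfolding m_def using s0 t01 by (intro nn_integral_eq_integral int_st) auto
    finally show ?thesis using m0[of k] by (simp add: ennreal_le_iff)
  qed
  define S where "S k \<phi> = (\<integral>\<^sup>+x. ennreal (s k x) \<partial>\<phi>)" for k and \<phi> :: "'a measure"
  define Y where "Y k \<phi> = (enn2real (S k \<phi>) - (\<integral>x. s k x \<partial>\<rho>)) / m k" for k \<phi>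
  \<comment> \<open>Absolute convergence, rather than mere convergence, makes the good event visibly
    stable under adding a point. Off this event \<open>f\<close> is set to 0, so that it is defined
    and bounded on all configurations.\<close>
  define good where "good \<phi> \<longleftrightarrow> (\<forall>k. S k \<phi> < \<infinity>) \<and> (\<Sum>k. ennreal \<bar>Y k \<phi>\<bar>) < \<infinity>" for \<phi>
  define Z where "Z \<phi> = (\<Sum>k. Y k \<phi>)" for \<phi>
  define f where "f \<phi> = (if good \<phi> then arctan (Z \<phi>) else 0)" for \<phi>
  \<comment> \<open>The slope from \<open>arctan_diff_ge\<close> at \<open>Z \<phi>\<close>, which
    does not involve the added point.\<close>
  let ?q = "\<lambda>\<phi>. 1 / (1 + (\<bar>Z \<phi>\<bar> + 2)\<^sup>2)"
  have S_meas[measurable]: "S k \<in> borel_measurable (config_space \<rho>)" for k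
    unfolding S_def by (rule measurable_nn_integral_test_fun[OF s'])
  have Y_meas[measurable]: "Y k \<in> borel_measurable (config_space \<rho>)" for k
    unfolding Y_def by measurable
  have [measurable]: "Measurable.pred (config_space \<rho>) good"
    unfolding good_def by measurable
  have Z_meas[measurable]: "Z \<in> borel_measurable (config_space \<rho>)"
    unfolding Z_def by measurable
  have f_meas: "f \<in> borel_measurable (config_space \<rho>)"
    unfolding f_def by measurable
  have "\<bar>f \<phi>\<bar> \<le> pi" for \<phi>
    using arctan_bounded[of "Z \<phi>"] pi_gt_zero by (auto simp: f_def abs_le_iff)
  then have f: "f \<in> bdd_measurable \<rho>"
    using f_meas by (auto simp: bdd_measurable_def)
  have mQ: "g \<in> borel_measurable Q" if "g \<in> borel_measurable (config_space \<rho>)" for g :: "_ \<Rightarrow> 'c::topological_space"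
    using that by (simp add: measurable_cong_sets[OF sets_Q refl])
  note [measurable] = mQ[OF S_meas] mQ[OF Y_meas] mQ[OF Z_meas]
  have EY: "(\<integral>\<^sup>+\<phi>. ennreal \<bar>Y k \<phi>\<bar> \<partial>Q) \<le> ennreal (2 * (1 / 2) ^ k)" for k
  proof -
    have "(\<integral>\<^sup>+\<phi>. ennreal ((Y k \<phi>)\<^sup>2) \<partial>Q)
        = (\<integral>\<^sup>+\<phi>. ennreal (1 / (m k)\<^sup>2) * ennreal ((enn2real (S k \<phi>) - (\<integral>x. s k x \<partial>\<rho>))\<^sup>2) \<partial>Q)"
      by (intro nn_integral_cong) (simp add: Y_def power_divide flip: ennreal_mult)
    also have "\<dots> = ennreal (1 / (m k)\<^sup>2) * ennreal (\<integral>x. (s k x)\<^sup>2 \<partial>\<rho>)"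
      using law_test_fun_variance(2)[OF law s', of k, folded S_def] by (subst nn_integral_cmult) auto
    also have "\<dots> \<le> ennreal (1 / (m k)\<^sup>2 * m k)"
      by (subst ennreal_mult'[symmetric], simp, intro ennreal_leI mult_left_mono sq_le) simp
    also have "1 / (m k)\<^sup>2 * m k = 1 / m k" using m0[of k] by (simp add: power2_eq_square)
    also have "ennreal (1 / m k) \<le> ennreal (1 / 4 ^ k)"
      using m4[of k] m0[of k] by (intro ennreal_leI divide_left_mono) auto
    finally have v: "(\<integral>\<^sup>+\<phi>. ennreal ((Y k \<phi>)\<^sup>2) \<partial>Q) \<le> ennreal (1 / 4 ^ k)" .
    \<comment> \<open>The second moment is at most 4^(- k), so the weight 2^k makes both summands
      equal to 2^(- k). The growth 4^k of \<open>m k\<close> was chosen to make this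
      summable.\<close>
    have young: "\<bar>y\<bar> \<le> 2 ^ k * y\<^sup>2 + (1 / 2) ^ k" for y :: real
    proof -
      have "(2 ^ k * \<bar>y\<bar>)\<^sup>2 = 2 ^ k * 2 ^ k * y\<^sup>2"
        by (simp add: power_mult_distrib power2_eq_square[of "2 ^ k"])
      then have "2 * (2 ^ k * \<bar>y\<bar>) \<le> 2 ^ k * 2 ^ k * y\<^sup>2 + 1"
        using sum_squares_bound[of "2 ^ k * \<bar>y\<bar>" 1] by simp
      moreover have "0 \<le> 2 ^ k * \<bar>y\<bar>" by simp
      moreover have "2 ^ k * (2 ^ k * y\<^sup>2 + (1 / 2) ^ k) = 2 ^ k * 2 ^ k * y\<^sup>2 + 1"
        by (simp add: distrib_left power_one_over mult.assoc)
      ultimately have "2 ^ k * \<bar>y\<bar> \<le> 2 ^ k * (2 ^ k * y\<^sup>2 + (1 / 2) ^ k)" by linarith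
      then show ?thesis by (subst (asm) mult_le_cancel_left_pos) auto
    qed
    have "(\<integral>\<^sup>+\<phi>. ennreal \<bar>Y k \<phi>\<bar> \<partial>Q) \<le> (\<integral>\<^sup>+\<phi>. ennreal (2 ^ k) * ennreal ((Y k \<phi>)\<^sup>2) + ennreal ((1 / 2) ^ k) \<partial>Q)"
      using young by (intro nn_integral_mono) (simp add: ennreal_leI flip: ennreal_mult ennreal_plus)
    also have "\<dots> = ennreal (2 ^ k) * (\<integral>\<^sup>+\<phi>. ennreal ((Y k \<phi>)\<^sup>2) \<partial>Q) + ennreal ((1 / 2) ^ k)"
      by (simp add: nn_integral_add nn_integral_cmult Q.emeasure_space_1)
    also have "\<dots> \<le> ennreal (2 ^ k) * ennreal (1 / 4 ^ k) + ennreal ((1 / 2) ^ k)"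
      by (intro add_right_mono mult_left_mono v) simp
    also have "\<dots> = ennreal (2 ^ k * (1 / 4 ^ k) + (1 / 2) ^ k)"
      by (simp flip: ennreal_mult ennreal_plus)
    also have "2 ^ k * (1 / 4 ^ k) = (1 / 2 :: real) ^ k"
      by (simp add: power_divide[symmetric])
    finally show ?thesis by simp
  qed
  have ae: "AE \<phi> in Q. good \<phi>"
  proof -
    have "(\<integral>\<^sup>+\<phi>. (\<Sum>k. ennreal \<bar>Y k \<phi>\<bar>) \<partial>Q) = (\<Sum>k. \<integral>\<^sup>+\<phi>. ennreal \<bar>Y k \<phi>\<bar> \<partial>Q)"
      by (rule nn_integral_suminf) measurable
    also have "\<dots> \<le> (\<Sum>k. ennreal (2 * (1 / 2) ^ k))"
      using EY by (intro suminf_le) auto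
    also have "\<dots> < \<infinity>"
      unfolding infinity_ennreal_def less_top[symmetric]
      by (intro ennreal_suminf_neq_top summable_mult summable_geometric) auto
    finally have "(\<integral>\<^sup>+\<phi>. (\<Sum>k. ennreal \<bar>Y k \<phi>\<bar>) \<partial>Q) \<noteq> \<infinity>" by simp
    then have "AE \<phi> in Q. (\<Sum>k. ennreal \<bar>Y k \<phi>\<bar>) \<noteq> \<infinity>"
      by (intro nn_integral_noteq_infinite) measurable
    moreover have "AE \<phi> in Q. \<forall>k. S k \<phi> < \<infinity>"
      unfolding AE_all_countable S_def using law_test_fun_variance(1)[OF law s'] by blast
    ultimately show ?thesis by eventually_elim (auto simp: good_def less_top)
  qed
  \<comment> \<open>The total shift of \<open>Z\<close> caused by a point at x. As
    \<open>s k \<le> t \<le> 1\<close> and \<open>m k \<ge> 4 ^ k\<close>, it is at most 4/3, within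
    the range of \<open>arctan_diff_ge\<close>.\<close>
  define u where "u x = (\<Sum>k. s k x / m k)" for x
  have term_le: "0 \<le> s k x / m k" "s k x / m k \<le> (1 / 4) ^ k" if "x \<in> space \<tau>" for k x
  proof -
    show "0 \<le> s k x / m k" using s0[OF that, of k] m0[of k] by simp
    have "s k x / m k \<le> 1 / 4 ^ k"
      using s0[OF that, of k] s_le[OF that, of k] t01(2)[of x] m4[of k] m0[of k] by (intro frac_le) auto
    then show "s k x / m k \<le> (1 / 4) ^ k" by (simp add: power_one_over)
  qed
  have su: "summable (\<lambda>k. s k x / m k)" if "x \<in> space \<tau>" for x
  proof (rule summable_comparison_test'[of "\<lambda>k. (1 / 4) ^ k" 0])
    show "norm (s k x / m k) \<le> (1 / 4) ^ k" for k
      using term_le[OF that, of k] by (simp only: real_norm_def abs_of_nonneg)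
  qed simp
  have u: "0 \<le> u x" "u x \<le> 2" if x: "x \<in> space \<tau>" for x
  proof -
    show "0 \<le> u x" unfolding u_def by (intro suminf_nonneg su x term_le)
    have "u x \<le> (\<Sum>k. (1 / 4) ^ k)" unfolding u_def by (intro suminf_le term_le su x) simp
    also have "\<dots> \<le> 2" using suminf_geometric[of "1 / 4 :: real"] by simp
    finally show "u x \<le> 2" .
  qed
  \<comment> \<open>The augmented configuration is good as well, so both values of \<open>f\<close>
    are arctangents, at \<open>Z \<phi> + u (x 1)\<close> and at \<open>Z \<phi>\<close>.\<close>
  have diff_f: "u (x 1) * (?q \<phi>) \<le> diff_on {1} x f \<phi>"
    if \<phi>: "\<phi> \<in> configs \<rho>" "good \<phi>" and x: "x 1 \<in> space \<tau>" for x \<phi>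
  proof -
    define \<psi> where "\<psi> = add_points \<phi> {1} x"
    have fin: "S k \<phi> < \<infinity>" for k using \<phi>(2) by (simp add: good_def)
    have sY: "summable (\<lambda>k. \<bar>Y k \<phi>\<bar>)"
      using \<phi>(2) by (intro summable_suminf_not_top) (auto simp: good_def)
    have S\<psi>: "S k \<psi> = S k \<phi> + ennreal (s k (x 1))" for k
      unfolding S_def \<psi>_def by (subst nn_integral_add_points[OF s']) (use \<phi> x in \<open>auto simp: configsD sp\<close>)
    have Y\<psi>: "Y k \<psi> = Y k \<phi> + s k (x 1) / m k" for k
      using fin[of k] s0[OF x, of k]
      by (cases "S k \<phi>") (auto simp: Y_def S\<psi> add_divide_distrib diff_divide_distrib simp flip: ennreal_plus)
    have "summable (\<lambda>k. \<bar>Y k \<phi>\<bar> + s k (x 1) / m k)" by (intro summable_add sY su x)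
    then have "summable (\<lambda>k. \<bar>Y k \<psi>\<bar>)"
    proof (rule summable_comparison_test')
      show "norm \<bar>Y k \<psi>\<bar> \<le> \<bar>Y k \<phi>\<bar> + s k (x 1) / m k" for k
        using abs_triangle_ineq[of "Y k \<phi>" "s k (x 1) / m k"] term_le(1)[OF x, of k] by (simp add: Y\<psi>)
    qed
    then have "(\<Sum>k. ennreal \<bar>Y k \<psi>\<bar>) < \<infinity>"
      unfolding infinity_ennreal_def less_top[symmetric] by (rule ennreal_suminf_neq_top) simp
    moreover have "S k \<psi> < \<infinity>" for k using fin[of k] by (simp add: S\<psi>)
    ultimately have "good \<psi>" by (simp add: good_def)
    moreover have "Z \<psi> = Z \<phi> + u (x 1)"
      unfolding Z_def u_def Y\<psi> by (rule suminf_add[symmetric, OF summable_rabs_cancel[OF sY] su[OF x]])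
    moreover have "diff_on {1} x f \<phi> = f \<psi> - f (add_points \<phi> {} x)"
      by (simp add: diff_on_def Pow_insert \<psi>_def)
    moreover have "add_points \<phi> {} x = \<phi>" by (simp add: add_points_def measure_of_of_measure)
    ultimately show ?thesis using arctan_diff_ge[OF u[OF x], of "Z \<phi>"] \<phi>(2) by (simp add: f_def)
  qed
  \<comment> \<open>\<open>Z\<close> is unbounded, so the slope has no uniform positive lower bound;
    its mean is nevertheless a positive constant, and only the mean enters
    \<open>mean_diff\<close>.\<close>
  define c where "c = (\<integral>\<phi>. ?q \<phi> \<partial>Q)"
  have pos: "0 < 1 + (\<bar>Z \<phi>\<bar> + 2)\<^sup>2" for \<phi> by (intro add_pos_nonneg) auto
  have q: "norm (?q \<phi>) \<le> 1" for \<phi>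
    using pos[of \<phi>] by (simp add: divide_le_eq_1 abs_of_pos)
  have intc: "integrable Q (?q)"
    by (rule Q.integrable_const_bound[of _ 1]) (rule AE_I2[OF q], measurable)
  have c: "0 < c"
  proof -
    have "c \<noteq> 0"
    proof
      assume "c = 0"
      then have "AE \<phi> in Q. ?q \<phi> = 0"
        unfolding c_def using intc pos
        by (subst (asm) integral_nonneg_eq_0_iff_AE) (auto simp: less_imp_le)
      then have "AE \<phi> in Q. False"
        by eventually_elim (metis pos divide_eq_0_iff less_irrefl one_neq_zero)
      then show False by simp
    qed
    moreover have "0 \<le> c" unfolding c_def using pos by (simp add: less_imp_le)
    ultimately show ?thesis by simp
  qed
  have md: "u (x 1) * c \<le> mean_diff Q {1} f x" if x: "x \<in> space (PiM {1} (\<lambda>_. \<tau>))" for x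
  proof -
    have x': "x \<in> space (pow {1})" and x1: "x 1 \<in> space \<tau>"
      using x by (auto simp: space_PiM sp)
    have "u (x 1) * c = (\<integral>\<phi>. u (x 1) * (?q \<phi>) \<partial>Q)"
      unfolding c_def by (rule Bochner_Integration.integral_mult_right_zero[symmetric])
    also have "\<dots> \<le> (\<integral>\<phi>. diff_on {1} x f \<phi> \<partial>Q)"
    proof (rule integral_mono_AE)
      show "AE \<phi> in Q. u (x 1) * (?q \<phi>) \<le> diff_on {1} x f \<phi>"
        using ae AE_space by eventually_elim (intro diff_f x1, auto simp: space_Q)
    qed (intro integrable_mult_right intc, intro diff_on_integrable f x', simp)
    finally show ?thesis by (simp add: mean_diff_def)
  qed
  have "(\<integral>\<^sup>+x. ennreal (u x * t x) \<partial>\<tau>) = \<infinity>"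
  proof -
    have "(\<integral>\<^sup>+x. ennreal (u x * t x) \<partial>\<tau>) = (\<integral>\<^sup>+x. (\<Sum>k. ennreal (s k x * t x / m k)) \<partial>\<tau>)"
    proof (rule nn_integral_cong)
      fix x assume x: "x \<in> space \<tau>"
      have "(\<lambda>k. s k x / m k * t x) sums (u x * t x)"
        unfolding u_def by (intro sums_mult2 summable_sums su x)
      then have sums: "(\<lambda>k. s k x * t x / m k) sums (u x * t x)" by simp
      have "0 \<le> s k x * t x / m k" for k
        using mult_nonneg_nonneg[OF term_le(1)[OF x, of k] t01(1)[of x]] by simp
      then show "ennreal (u x * t x) = (\<Sum>k. ennreal (s k x * t x / m k))"
        by (rule suminf_ennreal_eq[OF _ sums, symmetric])
    qed
    also have "\<dots> = (\<Sum>k. \<integral>\<^sup>+x. ennreal (s k x * t x / m k) \<partial>\<tau>)"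
      by (rule nn_integral_suminf) measurable
    \<comment> \<open>The normalisation by \<open>m k\<close> makes every term contribute exactly 1,
      hence the divergence.\<close>
    also have "\<dots> = (\<Sum>k::nat. 1)"
    proof (rule suminf_cong)
      fix k
      have "(\<integral>\<^sup>+x. ennreal (s k x * t x / m k) \<partial>\<tau>) = ennreal (\<integral>x. s k x * t x / m k \<partial>\<tau>)"
        using s0 t01 m0[of k] by (intro nn_integral_eq_integral integrable_divide int_st AE_I2) (auto simp: less_imp_le)
      also have "(\<integral>x. s k x * t x / m k \<partial>\<tau>) = 1" using m0[of k] by (simp add: m_def[symmetric])
      finally show "(\<integral>\<^sup>+x. ennreal (s k x * t x / m k) \<partial>\<tau>) = 1" by simp
    qed
    also have "\<dots> = \<infinity>"
    proof -
      have "\<not> summable (\<lambda>_::nat. 1 :: real)" by (simp add: summable_const_iff)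
      then show ?thesis using summable_suminf_not_top[of "\<lambda>_. 1 :: real"] by auto
    qed
    finally show ?thesis .
  qed
  have [measurable]: "u \<in> borel_measurable \<tau>" unfolding u_def by measurable
  have "(\<integral>\<^sup>+x. ennreal (c * (u (x 1) * t (x 1))) \<partial>PiM {1::nat} (\<lambda>_. \<tau>)) = (\<integral>\<^sup>+x. ennreal (c * (u x * t x)) \<partial>\<tau>)"
    by (rule T.product_nn_integral_singleton) measurable
  also have "\<dots> = ennreal c * (\<integral>\<^sup>+x. ennreal (u x * t x) \<partial>\<tau>)"
    using c by (subst nn_integral_cmult[symmetric]) (auto simp: ennreal_mult' intro!: nn_integral_cong)
  also have "\<dots> = \<infinity>"
    using c \<open>(\<integral>\<^sup>+x. ennreal (u x * t x) \<partial>\<tau>) = \<infinity>\<close> by (simp add: ennreal_mult_top)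
  finally have "\<infinity> = (\<integral>\<^sup>+x. ennreal (c * (u (x 1) * t (x 1))) \<partial>PiM {1::nat} (\<lambda>_. \<tau>))" by (rule sym)
  also have "\<dots> \<le> (\<integral>\<^sup>+x. ennreal \<bar>mean_diff Q {1} f x * t (x 1)\<bar> \<partial>PiM {1} (\<lambda>_. \<tau>))"
  proof (intro nn_integral_mono ennreal_leI)
    fix x :: "nat \<Rightarrow> 'a" assume x: "x \<in> space (PiM {1} (\<lambda>_. \<tau>))"
    have "c * (u (x 1) * t (x 1)) \<le> mean_diff Q {1} f x * t (x 1)"
      using mult_right_mono[OF md[OF x] t01(1)[of "x 1"]] by (simp add: mult_ac)
    also have "\<dots> \<le> \<bar>mean_diff Q {1} f x * t (x 1)\<bar>" by simp
    finally show "c * (u (x 1) * t (x 1)) \<le> \<bar>mean_diff Q {1} f x * t (x 1)\<bar>" .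
  qed
  finally show ?thesis using f by (auto simp: top_unique)
qed

end

subsection \<open>The two equivalences\<close>

text \<open>Intersect two exhaustions. They are taken increasing, so that a point covered by the
  i-th and the j-th set lies in the intersection with index max i j.\<close>

lemma sigma_finite_add_measure:
  assumes M: "sigma_finite_measure M" and N: "sigma_finite_measure N" and s: "sets N = sets M"
  shows "sigma_finite_measure (add_measure M N)"
proof
  have sp: "space N = space M" using s by (rule sets_eq_imp_space_eq)
  obtain A :: "nat \<Rightarrow> _" where A: "range A \<subseteq> sets M" "(\<Union>i. A i) = space M" "\<And>i. emeasure M (A i) \<noteq> \<infinity>" "incseq A"
    using sigma_finite_measure.sigma_finite_incseq[OF M] by blast
  obtain B :: "nat \<Rightarrow> _" where B: "range B \<subseteq> sets N" "(\<Union>i. B i) = space N" "\<And>i. emeasure N (B i) \<noteq> \<infinity>" "incseq B"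
    using sigma_finite_measure.sigma_finite_incseq[OF N] by blast
  let ?C = "\<lambda>i. A i \<inter> B i"
  have sets: "?C i \<in> sets M" for i using A(1) B(1) s by auto
  have "space M \<subseteq> (\<Union>i. ?C i)"
  proof
    fix x assume x: "x \<in> space M"
    then obtain i j where "x \<in> A i" "x \<in> B j" using A(2) B(2) sp by blast
    then have "x \<in> ?C (max i j)"
      using incseqD[OF A(4), of i "max i j"] incseqD[OF B(4), of j "max i j"] by auto
    then show "x \<in> (\<Union>i. ?C i)" by blast
  qed
  then have "(\<Union>i. ?C i) = space M" using A(2) by blast
  moreover have "emeasure (add_measure M N) (?C i) \<noteq> \<infinity>" for i
  proof -
    have "emeasure M (?C i) \<le> emeasure M (A i)" "emeasure N (?C i) \<le> emeasure N (B i)"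
      using A(1) B(1) by (auto intro!: emeasure_mono)
    then show ?thesis
      using A(3)[of i] B(3)[of i] emeasure_add_measure[OF s sets, of i] by (auto simp: top_unique)
  qed
  ultimately show "\<exists>A. countable A \<and> A \<subseteq> sets (add_measure M N) \<and> \<Union>A = space (add_measure M N) \<and>
      (\<forall>a\<in>A. emeasure (add_measure M N) a \<noteq> \<infinity>)"
    using sets by (intro exI[of _ "range ?C"]) auto
qed

lemma sigma_finite_measure_mono:
  assumes M: "sigma_finite_measure M" and le: "N \<le> M" "sets N = sets M"
  shows "sigma_finite_measure N"
proof
  interpret sigma_finite_measure M by fact
  obtain A where "countable A" "A \<subseteq> sets M" "\<Union>A = space M" "\<forall>a\<in>A. emeasure M a \<noteq> \<infinity>"
    using sigma_finite_countable by blast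
  moreover have "emeasure N a \<noteq> \<infinity>" if "emeasure M a \<noteq> \<infinity>" for a
    using le_measureD3[OF le, of a] that by (auto simp: top_unique)
  ultimately show "\<exists>A. countable A \<and> A \<subseteq> sets N \<and> \<Union>A = space N \<and> (\<forall>a\<in>A. emeasure N a \<noteq> \<infinity>)"
    using le(2) sets_eq_imp_space_eq[OF le(2)] by (intro exI[of _ A]) auto
qed

lemma le_measureI:
  assumes "sets N = sets M" "\<And>A. A \<in> sets M \<Longrightarrow> emeasure N A \<le> emeasure M A"
  shows "N \<le> M"
  using assms by (simp add: le_measure)

lemma absolutely_continuous_mono:
  assumes "N \<le> M" "sets N = sets M"
  shows "absolutely_continuous M N"
  unfolding absolutely_continuous_def
proof
  fix A assume "A \<in> null_sets M"
  then show "A \<in> null_sets N"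
    using le_measureD3[OF assms, of A] assms(2) by (auto simp: null_sets_def)
qed

text \<open>On the part of a set of finite measure where the density exceeds 1, the excess
  integrates to at most 0 and must vanish. Finiteness is what permits the subtraction; countably
  many such sets cover the space.\<close>

lemma RN_deriv_le_1:
  assumes M: "sigma_finite_measure M" and le: "N \<le> M" "sets N = sets M"
  shows "AE x in M. RN_deriv M N x \<le> 1"
proof -
  interpret sigma_finite_measure M by fact
  let ?h = "RN_deriv M N"
  have d: "density M ?h = N"
    by (rule density_RN_deriv[OF absolutely_continuous_mono[OF le] le(2)])
  obtain D :: "nat \<Rightarrow> _" where D: "range D \<subseteq> sets M" "(\<Union>i. D i) = space M" "\<And>i. emeasure M (D i) \<noteq> \<infinity>"
    using sigma_finite by blast
  have [measurable]: "D i \<in> sets M" for i using D(1) by auto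
  have "AE x in M. \<not> (x \<in> D i \<and> 1 < ?h x)" for i
  proof -
    define A where "A = {x\<in>space M. x \<in> D i \<and> 1 < ?h x}"
    have [measurable]: "A \<in> sets M" unfolding A_def by measurable
    have "emeasure M A \<le> emeasure M (D i)" by (intro emeasure_mono) (auto simp: A_def)
    then have fin: "emeasure M A \<noteq> \<infinity>" using D(3)[of i] by (auto simp: top_unique)
    have "emeasure N A = (\<integral>\<^sup>+x. ?h x * indicator A x \<partial>M)"
      by (subst d[symmetric], rule emeasure_density) auto
    then have hA: "(\<integral>\<^sup>+x. ?h x * indicator A x \<partial>M) \<le> emeasure M A"
      using le_measureD3[OF le, of A] by simp
    have "(\<integral>\<^sup>+x. ?h x * indicator A x - indicator A x \<partial>M)
        = (\<integral>\<^sup>+x. ?h x * indicator A x \<partial>M) - (\<integral>\<^sup>+x. indicator A x \<partial>M)"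
    proof (rule nn_integral_diff)
      show "(\<integral>\<^sup>+x. indicator A x \<partial>M) \<noteq> \<infinity>" using fin by simp
      show "AE x in M. indicator A x \<le> ?h x * indicator A x"
        by (rule AE_I2) (auto simp: A_def indicator_def less_imp_le)
    qed measurable
    also have "\<dots> = 0" using hA fin by (simp add: diff_eq_0_iff_ennreal less_top)
    finally have "AE x in M. ?h x * indicator A x - indicator A x = 0"
      by (subst (asm) nn_integral_0_iff_AE) auto
    then show ?thesis using AE_space
    proof eventually_elim
      case (elim x)
      show ?case
      proof
        assume x: "x \<in> D i \<and> 1 < ?h x"
        then have "?h x - 1 = 0" using elim by (simp add: A_def)
        moreover have "0 < ?h x - 1" using x by (simp add: diff_gr0_ennreal)
        ultimately show False by simp
      qed
    qed
  qed
  then have "AE x in M. \<forall>i. \<not> (x \<in> D i \<and> 1 < ?h x)" by (intro AE_all_countable[THEN iffD2] allI)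
  then show ?thesis
    using AE_space by eventually_elim (use D(2) in \<open>auto simp: not_less\<close>)
qed

text \<open>The expansions start with the term n = 0, which is the unperturbed expectation, whereas
  the formulas to be proved start at n = 1.\<close>

lemma series_tail_sums:
  fixes c :: "nat \<Rightarrow> real"
  assumes "(\<lambda>n. c n / fact n) sums E"
  shows "(\<lambda>n. 1 / fact (Suc n) * c (Suc n)) sums (E - c 0)"
  using assms sums_Suc_iff[of "\<lambda>n. c n / fact n" "E - c 0"] by simp

lemma (in poisson_process) mean_diff_empty_integral:
  "(\<integral>x. mean_diff Q {1..0} f x * (\<Prod>j\<in>{1..0}. c (x j)) \<partial>PiM {1..0} (\<lambda>_. M)) = (\<integral>\<phi>. f \<phi> \<partial>Q)"
  by (simp add: mean_diff_def PiM_empty lebesgue_integral_count_space_finite)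

text \<open>With t = 1 - h, the measure \<open>mu\<close> has density t and \<open>lam\<close> has
  density 1 - t with respect to \<open>\<rho>\<close>. Integrals over powers of \<open>mu\<close>
  thus acquire the product of the t (x j), which is the product of the - a (x j) in
  \<open>reverse_expansion\<close> for a = - t. The converse takes the law of \<open>lam\<close> and
  the dominating measure \<open>\<rho>\<close> in
  \<open>first_difference_not_integrable\<close>.\<close>

theorem expansion_added_measure_iff:
  fixes lam mu :: "'a measure"
  defines "\<rho> \<equiv> add_measure lam mu"
  assumes lam: "poisson_process lam Q" and mu: "sigma_finite_measure mu" "sets mu = sets lam"
    and \<rho>: "poisson_process \<rho> Q'"
  shows "(\<forall>f\<in>bdd_measurable lam.
      (\<forall>n\<ge>1. integrable (PiM {1..n} (\<lambda>_. mu)) (mean_diff Q {1..n} f)) \<and>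
      (\<lambda>n. 1 / fact (Suc n) * (\<integral>x. mean_diff Q {1..Suc n} f x \<partial>PiM {1..Suc n} (\<lambda>_. mu)))
        sums ((\<integral>\<phi>. f \<phi> \<partial>Q') - (\<integral>\<phi>. f \<phi> \<partial>Q)))
    \<longleftrightarrow> (\<integral>\<^sup>+x. ennreal ((1 - enn2real (RN_deriv \<rho> lam x))\<^sup>2) \<partial>\<rho>) < \<infinity>" (is "?L \<longleftrightarrow> _")
proof -
  interpret L: poisson_process lam Q by fact
  interpret R: poisson_process \<rho> Q' by fact
  have sets: "sets lam = sets \<rho>" "sets mu = sets \<rho>" by (simp_all add: \<rho>_def mu)
  have em: "emeasure \<rho> A = emeasure lam A + emeasure mu A" if "A \<in> sets \<rho>" for A
    unfolding \<rho>_def using that by (intro emeasure_add_measure mu) (simp add: \<rho>_def)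
  have le: "lam \<le> \<rho>" "mu \<le> \<rho>" by (auto intro!: le_measureI sets simp: em)
  let ?h = "RN_deriv \<rho> lam" and ?k = "RN_deriv \<rho> mu"
  have h: "density \<rho> ?h = lam" and k: "density \<rho> ?k = mu"
    using le sets
    by (auto intro!: sigma_finite_measure.density_RN_deriv[OF R.sigma_finite_intensity] absolutely_continuous_mono)
  \<comment> \<open>Uniqueness of densities turns \<open>\<rho> = lam + mu\<close> into h + k = 1
    almost everywhere.\<close>
  have "density \<rho> (\<lambda>x. ?h x + ?k x) = density \<rho> (\<lambda>_. 1)"
  proof (rule measure_eqI)
    fix A assume "A \<in> sets (density \<rho> (\<lambda>x. ?h x + ?k x))"
    then have A[measurable]: "A \<in> sets \<rho>" by simp
    have "emeasure (density \<rho> (\<lambda>x. ?h x + ?k x)) A = emeasure (density \<rho> ?h) A + emeasure (density \<rho> ?k) A"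
      by (simp add: emeasure_density distrib_right nn_integral_add)
    then show "emeasure (density \<rho> (\<lambda>x. ?h x + ?k x)) A = emeasure (density \<rho> (\<lambda>_. 1)) A"
      by (simp add: h k em emeasure_density)
  qed simp
  then have hk: "AE x in \<rho>. ?h x + ?k x = 1"
    by (intro sigma_finite_measure.density_unique[OF R.sigma_finite_intensity]) auto
  \<comment> \<open>A version of 1 - h clipped to [0, 1] everywhere: the bound on a in
    \<open>poisson_perturbation\<close> is pointwise, that on h only almost everywhere.\<close>
  define t where "t x = max 0 (min 1 (1 - enn2real (?h x)))" for x
  have t[measurable]: "t \<in> borel_measurable \<rho>" unfolding t_def by measurable
  have t01: "0 \<le> t x" "t x \<le> 1" for x by (auto simp: t_def)
  have t_ae: "AE x in \<rho>. ?h x = ennreal (1 + - t x) \<and> ?k x = ennreal (t x) \<and> t x = 1 - enn2real (?h x)"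
    using hk
  proof eventually_elim
    case (elim x)
    then have "?h x \<noteq> \<top>" "?k x \<noteq> \<top>" by auto
    then obtain p q where pq: "?h x = ennreal p" "0 \<le> p" "?k x = ennreal q" "0 \<le> q"
      by (cases "?h x"; cases "?k x") auto
    then have "ennreal (p + q) = ennreal 1" using elim by (simp add: ennreal_plus)
    then have "p + q = 1" using pq by (subst (asm) ennreal_inj) auto
    then show ?case using pq by (simp add: t_def)
  qed
  have mu_t: "mu = density \<rho> (\<lambda>x. ennreal (t x))"
    by (subst k[symmetric], rule density_cong, simp, simp, use t_ae in eventually_elim) blast
  have lam_t: "lam = density \<rho> (\<lambda>x. ennreal (1 + - t x))"
    by (subst h[symmetric], rule density_cong, simp, simp, use t_ae in eventually_elim) blast
  have sq: "(\<integral>\<^sup>+x. ennreal ((1 - enn2real (?h x))\<^sup>2) \<partial>\<rho>) = (\<integral>\<^sup>+x. ennreal ((t x)\<^sup>2) \<partial>\<rho>)"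
    by (rule nn_integral_cong_AE, use t_ae in eventually_elim) metis
  have bm: "bdd_measurable lam = bdd_measurable \<rho>" by (rule bdd_measurable_cong[OF sets(1)])
  have conv: "integrable (PiM {1..n} (\<lambda>_. mu)) (mean_diff Q {1..n} f)
        \<longleftrightarrow> integrable (PiM {1..n} (\<lambda>_. \<rho>)) (\<lambda>x. mean_diff Q {1..n} f x * (\<Prod>j\<in>{1..n}. t (x j)))"
      "(\<integral>x. mean_diff Q {1..n} f x \<partial>PiM {1..n} (\<lambda>_. mu))
        = (\<integral>x. mean_diff Q {1..n} f x * (\<Prod>j\<in>{1..n}. t (x j)) \<partial>PiM {1..n} (\<lambda>_. \<rho>))"
    if "f \<in> bdd_measurable lam" for f n
    by (rule integral_PiM_density[OF R.sigma_finite_intensity mu(1) mu_t t t01(1)],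
        simp, rule L.mean_diff_measurable[OF _ that sets(1)[symmetric]], simp)+
  show ?thesis unfolding sq
  proof
    assume fin: "(\<integral>\<^sup>+x. ennreal ((t x)\<^sup>2) \<partial>\<rho>) < \<infinity>"
    interpret poisson_perturbation \<rho> lam Q' Q "\<lambda>x. - t x"
      by unfold_locales (use fin t01 lam_t in auto)
    show ?L
    proof (intro ballI conjI allI impI)
      fix f assume f: "f \<in> bdd_measurable lam"
      note rev = reverse_expansion[OF f[unfolded bm], unfolded minus_minus]
      show "integrable (PiM {1..n} (\<lambda>_. mu)) (mean_diff Q {1..n} f)" for n
        unfolding conv(1)[OF f] by (rule rev(1))
      show "(\<lambda>n. 1 / fact (Suc n) * (\<integral>x. mean_diff Q {1..Suc n} f x \<partial>PiM {1..Suc n} (\<lambda>_. mu)))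
        sums ((\<integral>\<phi>. f \<phi> \<partial>Q') - (\<integral>\<phi>. f \<phi> \<partial>Q))"
        unfolding conv(2)[OF f] using series_tail_sums[OF rev(2)] by (simp only: L.mean_diff_empty_integral)
    qed
  next
    assume formula: ?L
    show "(\<integral>\<^sup>+x. ennreal ((t x)\<^sup>2) \<partial>\<rho>) < \<infinity>"
    proof (rule ccontr)
      assume "\<not> (\<integral>\<^sup>+x. ennreal ((t x)\<^sup>2) \<partial>\<rho>) < \<infinity>"
      then have "(\<integral>\<^sup>+x. ennreal ((t x)\<^sup>2) \<partial>\<rho>) = \<infinity>" by (simp add: not_less top_unique)
      from L.first_difference_not_integrable[OF R.sigma_finite_intensity sets(1) le(1) t t01 this]
      obtain f where f: "f \<in> bdd_measurable lam"
        "(\<integral>\<^sup>+x. ennreal \<bar>mean_diff Q {1} f x * t (x 1)\<bar> \<partial>PiM {1} (\<lambda>_. \<rho>)) = \<infinity>" by blast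
      have "integrable (PiM {1..1} (\<lambda>_. mu)) (mean_diff Q {1..1} f)" using formula f(1) by blast
      then have "integrable (PiM {1} (\<lambda>_. \<rho>)) (\<lambda>x. mean_diff Q {1} f x * t (x 1))"
        unfolding conv(1)[OF f(1)] by simp
      then show False using f(2) by (simp add: integrable_iff_bounded)
    qed
  qed
qed

text \<open>If g is the density of \<open>lam\<close> with respect to \<open>rho\<close> and t that
  of \<open>mu\<close> with respect to \<open>lam\<close>, then \<open>\<nu> - lam\<close> has
  density - t g. Each integral over \<open>rho\<close> thereby becomes one over \<open>lam\<close>
  with the product of the - t (x j), whatever \<open>rho\<close> is, and \<open>expansion\<close>
  applies with a = - t.\<close>

theorem expansion_subtracted_measure_iff:
  fixes lam mu rho :: "'a measure"
  defines "\<nu> \<equiv> sub_measure lam mu"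
  assumes lam: "poisson_process lam Q" and mu: "mu \<le> lam" "sets mu = sets lam"
    and rho: "sigma_finite_measure rho" "sets lam = sets rho" "absolutely_continuous rho lam"
    and \<nu>: "poisson_process \<nu> Q'"
  shows "(\<forall>f\<in>bdd_measurable lam.
      (\<forall>n\<ge>1. integrable (PiM {1..n} (\<lambda>_. rho))
        (\<lambda>x. mean_diff Q {1..n} f x * (\<Prod>j=1..n. density_diff rho \<nu> lam (x j)))) \<and>
      (\<lambda>n. 1 / fact (Suc n) * (\<integral>x. mean_diff Q {1..Suc n} f x *
          (\<Prod>j=1..Suc n. density_diff rho \<nu> lam (x j)) \<partial>PiM {1..Suc n} (\<lambda>_. rho)))
        sums ((\<integral>\<phi>. f \<phi> \<partial>Q') - (\<integral>\<phi>. f \<phi> \<partial>Q)))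
    \<longleftrightarrow> (\<integral>\<^sup>+x. ennreal ((enn2real (RN_deriv lam mu x))\<^sup>2) \<partial>lam) < \<infinity>" (is "?L \<longleftrightarrow> _")
proof -
  interpret L: poisson_process lam Q by fact
  interpret V: poisson_process \<nu> Q' by fact
  interpret R': sigma_finite_measure rho by fact
  let ?h = "RN_deriv lam mu" and ?g = "\<lambda>x. enn2real (RN_deriv rho lam x)"
  define t where "t x = min 1 (enn2real (?h x))" for x
  have t[measurable]: "t \<in> borel_measurable lam" unfolding t_def by measurable
  have t01: "0 \<le> t x" "t x \<le> 1" for x by (auto simp: t_def)
  have t_ae: "AE x in lam. ?h x = ennreal (t x) \<and> t x = enn2real (?h x)"
    using RN_deriv_le_1[OF L.sigma_finite_intensity mu]
  proof eventually_elim
    case (elim x)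
    then obtain p where "?h x = ennreal p" "0 \<le> p" "p \<le> 1"
      by (cases "?h x") (auto simp: top_unique)
    then show ?case by (simp add: t_def)
  qed
  have \<nu>_t: "\<nu> = density lam (\<lambda>x. ennreal (1 + - t x))"
    unfolding \<nu>_def sub_measure_def
  proof (rule density_cong)
    show "AE x in lam. 1 - ?h x = ennreal (1 + - t x)"
      using t_ae
    proof eventually_elim
      case (elim x)
      from conjunct1[OF elim] show ?case using ennreal_minus[OF t01(1), of 1 x] by simp
    qed
  qed auto
  have sq: "(\<integral>\<^sup>+x. ennreal ((enn2real (?h x))\<^sup>2) \<partial>lam) = (\<integral>\<^sup>+x. ennreal ((t x)\<^sup>2) \<partial>lam)"
    by (rule nn_integral_cong_AE, use t_ae in eventually_elim) metis
  have t'[measurable]: "t \<in> borel_measurable rho" using t by (simp add: measurable_cong_sets[OF rho(2) refl])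
  \<comment> \<open>\<open>density_diff\<close> passes through \<open>enn2real\<close>, which sends
    infinity to 0, so almost sure finiteness is needed to recover \<open>lam\<close> from the
    real-valued density.\<close>
  have "AE x in rho. RN_deriv rho lam x \<noteq> \<infinity>"
    by (rule R'.RN_deriv_finite[OF L.sigma_finite_intensity rho(3,2)])
  then have g_ae: "AE x in rho. RN_deriv rho lam x = ennreal (?g x)"
    by eventually_elim (simp add: less_top)
  have lam_g: "lam = density rho (\<lambda>x. ennreal (?g x))"
  proof -
    have "lam = density rho (RN_deriv rho lam)" using R'.density_RN_deriv[OF rho(3,2)] by simp
    also have "\<dots> = density rho (\<lambda>x. ennreal (?g x))"
      by (rule density_cong) (use g_ae in auto)
    finally show ?thesis .
  qed
  \<comment> \<open>The chain rule for densities; uniqueness then identifies the density of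
    \<open>\<nu>\<close> with respect to \<open>rho\<close>.\<close>
  have "density rho (\<lambda>x. ennreal (?g x) * ennreal (1 + - t x)) = \<nu>"
    unfolding \<nu>_t by (subst (2) lam_g) (simp add: density_density_eq)
  from R'.RN_deriv_unique[OF _ this]
  have "AE x in rho. ennreal (?g x) * ennreal (1 + - t x) = RN_deriv rho \<nu> x" by simp
  then have dd: "AE x in rho. density_diff rho \<nu> lam x = - t x * ?g x"
  proof eventually_elim
    case (elim x)
    have "enn2real (RN_deriv rho \<nu> x) = ?g x * (1 + - t x)"
      using t01[of x] by (simp add: elim[symmetric] enn2real_mult)
    then show ?case by (simp add: density_diff_def algebra_simps)
  qed
  have dd_meas[measurable]: "density_diff rho \<nu> lam \<in> borel_measurable rho"
    unfolding density_diff_def[abs_def] by measurable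
  have conv: "integrable (PiM {1..n} (\<lambda>_. rho)) (\<lambda>x. mean_diff Q {1..n} f x * (\<Prod>j=1..n. density_diff rho \<nu> lam (x j)))
        \<longleftrightarrow> integrable (PiM {1..n} (\<lambda>_. lam)) (\<lambda>x. mean_diff Q {1..n} f x * (\<Prod>j\<in>{1..n}. - t (x j)))" (is "?A1 = ?B1")
      "(\<integral>x. mean_diff Q {1..n} f x * (\<Prod>j=1..n. density_diff rho \<nu> lam (x j)) \<partial>PiM {1..n} (\<lambda>_. rho))
        = (\<integral>x. mean_diff Q {1..n} f x * (\<Prod>j\<in>{1..n}. - t (x j)) \<partial>PiM {1..n} (\<lambda>_. lam))" (is "?A2 = ?B2")
    if f: "f \<in> bdd_measurable lam" for f n
  proof -
    have [measurable]: "mean_diff Q {1..n} f \<in> borel_measurable (PiM {1..n} (\<lambda>_. rho))"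
      by (rule L.mean_diff_measurable[OF _ f rho(2)[symmetric]]) simp
    let ?m = "\<lambda>x. mean_diff Q {1..n} f x * (\<Prod>j\<in>{1..n}. - t (x j))"
    have m: "?m \<in> borel_measurable (PiM {1..n} (\<lambda>_. rho))" by measurable
    note * = integral_PiM_density[OF rho(1) L.sigma_finite_intensity lam_g _ _ _ m]
    have ae: "AE x in PiM {1..n} (\<lambda>_. rho). mean_diff Q {1..n} f x * (\<Prod>j=1..n. density_diff rho \<nu> lam (x j))
        = ?m x * (\<Prod>j\<in>{1..n}. ?g (x j))"
      using AE_PiM_all[OF rho(1) finite_atLeastAtMost dd]
    proof eventually_elim
      case (elim x)
      then have "(\<Prod>j=1..n. density_diff rho \<nu> lam (x j)) = (\<Prod>j=1..n. - t (x j) * ?g (x j))"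
        by (intro prod.cong) auto
      then show ?case by (simp only: prod.distrib mult.assoc)
    qed
    have "?A1 = integrable (PiM {1..n} (\<lambda>_. rho)) (\<lambda>x. ?m x * (\<Prod>j\<in>{1..n}. ?g (x j)))"
      by (rule integrable_cong_AE[OF _ _ ae]) measurable
    then show "?A1 = ?B1" by (subst *(1)) auto
    have "?A2 = (\<integral>x. ?m x * (\<Prod>j\<in>{1..n}. ?g (x j)) \<partial>PiM {1..n} (\<lambda>_. rho))"
      by (rule integral_cong_AE[OF _ _ ae]) measurable
    then show "?A2 = ?B2" by (subst *(2)) auto
  qed
  show ?thesis unfolding sq
  proof
    assume fin: "(\<integral>\<^sup>+x. ennreal ((t x)\<^sup>2) \<partial>lam) < \<infinity>"
    interpret poisson_perturbation lam \<nu> Q Q' "\<lambda>x. - t x"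
      by unfold_locales (use fin t01 \<nu>_t in auto)
    show ?L
    proof (intro ballI conjI allI impI)
      fix f assume f: "f \<in> bdd_measurable lam"
      show "integrable (PiM {1..n} (\<lambda>_. rho)) (\<lambda>x. mean_diff Q {1..n} f x * (\<Prod>j=1..n. density_diff rho \<nu> lam (x j)))" for n
        unfolding conv(1)[OF f] by (rule coefficient_bounds(2)[OF f]) simp
      have "(\<lambda>k. coef {1..k} f / fact k) sums (\<integral>\<phi>. f \<phi> \<partial>Q')"
        by (rule expansion[OF f]) auto
      from series_tail_sums[OF this]
      show "(\<lambda>n. 1 / fact (Suc n) * (\<integral>x. mean_diff Q {1..Suc n} f x *
          (\<Prod>j=1..Suc n. density_diff rho \<nu> lam (x j)) \<partial>PiM {1..Suc n} (\<lambda>_. rho)))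
        sums ((\<integral>\<phi>. f \<phi> \<partial>Q') - (\<integral>\<phi>. f \<phi> \<partial>Q))"
        unfolding conv(2)[OF f] coef_def by (simp only: L.mean_diff_empty_integral[where c="\<lambda>y. - t y"])
    qed
  next
    assume formula: ?L
    show "(\<integral>\<^sup>+x. ennreal ((t x)\<^sup>2) \<partial>lam) < \<infinity>"
    proof (rule ccontr)
      assume "\<not> (\<integral>\<^sup>+x. ennreal ((t x)\<^sup>2) \<partial>lam) < \<infinity>"
      then have "(\<integral>\<^sup>+x. ennreal ((t x)\<^sup>2) \<partial>lam) = \<infinity>" by (simp add: not_less top_unique)
      from L.first_difference_not_integrable[OF L.sigma_finite_intensity refl order_refl t t01 this]
      obtain f where f: "f \<in> bdd_measurable lam"
        "(\<integral>\<^sup>+x. ennreal \<bar>mean_diff Q {1} f x * t (x 1)\<bar> \<partial>PiM {1} (\<lambda>_. lam)) = \<infinity>" by blast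
      have "integrable (PiM {1..1} (\<lambda>_. rho))
          (\<lambda>x. mean_diff Q {1..1} f x * (\<Prod>j=1..1. density_diff rho \<nu> lam (x j)))"
        using formula f(1) by blast
      then have "integrable (PiM {1} (\<lambda>_. lam)) (\<lambda>x. - (mean_diff Q {1} f x * t (x 1)))"
        unfolding conv(1)[OF f(1)] by simp
      then show False using f(2) by (simp add: integrable_iff_bounded)
    qed
  qed
qed

theorem corollary5p3:
  fixes X :: "'a measure" and \<Omega> :: "'w measure"
    and \<Phi> :: "'w \<Rightarrow> 'a measure" and P :: "'a measure \<Rightarrow> 'w measure"
    and lam mu :: "'a measure"
  assumes Phi: "\<Phi> \<in> measurable \<Omega> (config_space X)"
    and P: "\<And>\<kappa>. sigma_finite_measure \<kappa> \<Longrightarrow> sets \<kappa> = sets X \<Longrightarrow>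
          prob_space (P \<kappa>) \<and> sets (P \<kappa>) = sets \<Omega> \<and>
          poisson_process_law \<kappa> (distr (P \<kappa>) (config_space X) \<Phi>)"
    and lam: "sigma_finite_measure lam" "sets lam = sets X"
    and mu: "sigma_finite_measure mu" "sets mu = sets X"
  shows
    "((\<forall>f \<in> borel_measurable (config_space X). bounded (f ` space (config_space X)) \<longrightarrow>
        (\<forall>n\<ge>1. integrable (PiM {1..n} (\<lambda>_. mu)) (\<lambda>x. \<integral>\<omega>. diff_op n x f (\<Phi> \<omega>) \<partial>P lam)) \<and>
        (\<lambda>n. 1 / fact (Suc n) *
           (\<integral>x. (\<integral>\<omega>. diff_op (Suc n) x f (\<Phi> \<omega>) \<partial>P lam) \<partial>PiM {1..Suc n} (\<lambda>_. mu)))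
         sums ((\<integral>\<omega>. f (\<Phi> \<omega>) \<partial>P (add_measure lam mu)) - (\<integral>\<omega>. f (\<Phi> \<omega>) \<partial>P lam)))
      \<longleftrightarrow>
      (\<integral>\<^sup>+x. ennreal ((1 - enn2real (RN_deriv (add_measure lam mu) lam x))\<^sup>2) \<partial>add_measure lam mu) < \<infinity>)
     \<and>
     (mu \<le> lam \<longrightarrow>
      (\<forall>nu rho. nu = sub_measure lam mu \<longrightarrow>
        sigma_finite_measure rho \<longrightarrow> sets rho = sets X \<longrightarrow>
        absolutely_continuous rho lam \<longrightarrow> absolutely_continuous rho nu \<longrightarrow>
        ((\<forall>f \<in> borel_measurable (config_space X). bounded (f ` space (config_space X)) \<longrightarrow>
            (\<forall>n\<ge>1. integrable (PiM {1..n} (\<lambda>_. rho))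
               (\<lambda>x. (\<integral>\<omega>. diff_op n x f (\<Phi> \<omega>) \<partial>P lam) * (\<Prod>j=1..n. density_diff rho nu lam (x j)))) \<and>
            (\<lambda>n. 1 / fact (Suc n) *
               (\<integral>x. (\<integral>\<omega>. diff_op (Suc n) x f (\<Phi> \<omega>) \<partial>P lam) *
                  (\<Prod>j=1..Suc n. density_diff rho nu lam (x j)) \<partial>PiM {1..Suc n} (\<lambda>_. rho)))
             sums ((\<integral>\<omega>. f (\<Phi> \<omega>) \<partial>P nu) - (\<integral>\<omega>. f (\<Phi> \<omega>) \<partial>P lam)))
         \<longleftrightarrow>
         (\<integral>\<^sup>+x. ennreal ((enn2real (RN_deriv lam mu x))\<^sup>2) \<partial>lam) < \<infinity>)))"
proof -
  define law where "law \<kappa> = distr (P \<kappa>) (config_space X) \<Phi>" for \<kappa>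
  have proc: "poisson_process \<kappa> (law \<kappa>)" if "sigma_finite_measure \<kappa>" "sets \<kappa> = sets X" for \<kappa>
    using P[OF that] that by (simp add: poisson_process_def law_def)
  have \<Phi>_meas: "\<Phi> \<in> measurable (P \<kappa>) (config_space X)" if "sigma_finite_measure \<kappa>" "sets \<kappa> = sets X" for \<kappa>
    using Phi measurable_cong_sets[OF conjunct1[OF conjunct2[OF P[OF that]]] refl] by blast
  have exp_law: "(\<integral>\<omega>. f (\<Phi> \<omega>) \<partial>P \<kappa>) = (\<integral>\<phi>. f \<phi> \<partial>law \<kappa>)"
    if "sigma_finite_measure \<kappa>" "sets \<kappa> = sets X" "f \<in> borel_measurable (config_space X)" for \<kappa> and f :: "'a measure \<Rightarrow> real"
    unfolding law_def by (rule integral_distr[OF \<Phi>_meas[OF that(1,2)] that(3), symmetric])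
  interpret L: poisson_process lam "law lam" by (rule proc[OF lam])
  have cs: "config_space lam = config_space X" by (rule config_space_cong[OF lam(2)])
  have bm: "f \<in> bdd_measurable lam \<longleftrightarrow> f \<in> borel_measurable (config_space X) \<and> bounded (f ` space (config_space X))" for f
    by (simp add: bdd_measurable_iff cs)
  \<comment> \<open>Stated for points from any M with the right sigma-algebra, because the outer
    integral is over powers of \<open>mu\<close> in (i) and of \<open>rho\<close> in (ii).\<close>
  have diff_law: "(\<integral>\<omega>. diff_op n x f (\<Phi> \<omega>) \<partial>P lam) = mean_diff (law lam) {1..n} f x"
    if "f \<in> borel_measurable (config_space X)" "x \<in> space (PiM {1..n} (\<lambda>_. M))" "sets M = sets X" for f n x M
  proof -
    have "x \<in> space (PiM {1..n} (\<lambda>_. lam))"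
      using that(2) sets_eq_imp_space_eq[OF that(3)] sets_eq_imp_space_eq[OF lam(2)] by (simp add: space_PiM)
    then have "diff_on {1..n} x f \<in> borel_measurable (config_space X)"
      using L.diff_on_measurable[of "{1..n}" f x] that(1) by (simp add: cs)
    from exp_law[OF lam this] show ?thesis by (simp add: diff_op_eq_diff_on mean_diff_def)
  qed
  have conv: "integrable (PiM {1..n} (\<lambda>_. M)) (\<lambda>x. (\<integral>\<omega>. diff_op n x f (\<Phi> \<omega>) \<partial>P lam) * g x)
        \<longleftrightarrow> integrable (PiM {1..n} (\<lambda>_. M)) (\<lambda>x. mean_diff (law lam) {1..n} f x * g x)"
      "(\<integral>x. (\<integral>\<omega>. diff_op n x f (\<Phi> \<omega>) \<partial>P lam) * g x \<partial>PiM {1..n} (\<lambda>_. M))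
        = (\<integral>x. mean_diff (law lam) {1..n} f x * g x \<partial>PiM {1..n} (\<lambda>_. M))"
    if "f \<in> borel_measurable (config_space X)" "sets M = sets X" for f n M and g :: "(nat \<Rightarrow> 'a) \<Rightarrow> real"
    by (intro Bochner_Integration.integrable_cong Bochner_Integration.integral_cong refl,
        simp only: diff_law[OF that(1) _ that(2)])+
  have conv1: "integrable (PiM {1..n} (\<lambda>_. M)) (\<lambda>x. \<integral>\<omega>. diff_op n x f (\<Phi> \<omega>) \<partial>P lam)
        \<longleftrightarrow> integrable (PiM {1..n} (\<lambda>_. M)) (mean_diff (law lam) {1..n} f)"
      "(\<integral>x. (\<integral>\<omega>. diff_op n x f (\<Phi> \<omega>) \<partial>P lam) \<partial>PiM {1..n} (\<lambda>_. M))
        = (\<integral>x. mean_diff (law lam) {1..n} f x \<partial>PiM {1..n} (\<lambda>_. M))"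
    if "f \<in> borel_measurable (config_space X)" "sets M = sets X" for f n M
    by (intro Bochner_Integration.integrable_cong Bochner_Integration.integral_cong refl,
        simp only: diff_law[OF that(1) _ that(2)])+
  let ?\<rho> = "add_measure lam mu"
  have \<rho>: "sigma_finite_measure ?\<rho>" "sets ?\<rho> = sets X"
    using sigma_finite_add_measure[OF lam(1) mu(1)] lam mu by simp_all
  have mu_lam: "sets mu = sets lam" using lam mu by simp
  show ?thesis
  proof (intro conjI impI allI, goal_cases)
    case 1
    show ?case
      unfolding expansion_added_measure_iff[OF L.poisson_process_axioms mu(1) mu_lam proc[OF \<rho>], symmetric]
      by (auto simp only: bm conv1[OF _ mu(2)] exp_law[OF lam] exp_law[OF \<rho>] Ball_def imp_conjL cong: imp_cong)
  next
    case (2 nu rho)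
    note le = 2(1) and nu = 2(2) and rho = 2(3-5)
    have sets_nu: "sets nu = sets X" using lam by (simp add: nu sub_measure_def)
    \<comment> \<open>The truncated difference of 1 and the density never exceeds 1; this domination
      provides the sigma-finiteness of \<open>nu\<close> that the hypothesis on \<open>P\<close>
      asks for.\<close>
    have "nu \<le> lam"
    proof (rule le_measureI)
      fix A assume "A \<in> sets lam"
      then have "emeasure nu A = (\<integral>\<^sup>+x. (1 - RN_deriv lam mu x) * indicator A x \<partial>lam)"
        unfolding nu sub_measure_def by (intro emeasure_density) auto
      also have "\<dots> \<le> (\<integral>\<^sup>+x. indicator A x \<partial>lam)"
        by (intro nn_integral_mono) (auto simp: indicator_def diff_le_self_ennreal)
      finally show "emeasure nu A \<le> emeasure lam A" using \<open>A \<in> sets lam\<close> by simp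
    qed (simp add: sets_nu lam)
    then have nu': "sigma_finite_measure nu"
      by (rule sigma_finite_measure_mono[OF lam(1)]) (simp add: sets_nu lam)
    have lam_rho: "sets lam = sets rho" using lam rho by simp
    show ?case
      unfolding expansion_subtracted_measure_iff[OF L.poisson_process_axioms le mu_lam rho(1) lam_rho rho(3)
          proc[OF nu' sets_nu, unfolded nu], symmetric] nu[symmetric]
      by (auto simp only: bm conv[OF _ rho(2)] exp_law[OF lam] exp_law[OF nu' sets_nu] Ball_def imp_conjL cong: imp_cong)
  qed
qed

end
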